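(* Let $w(z)=\sum_pw_pz^p$ be the unique polynomial (of degree $m+1$) satisfying $f(z)=(2\sinh(\partial/2))^{n-1}(z^{n-1}w(z))$. Then for every $\lambda\in\mathfrak{h}^*$ the Casimir element $t_1'$ acts on the Verma module $M(\lambda-\rho)$ by the scalar \[ t_1'(\lambda)=\sum_{p\ge0}w_pH_p(\lambda). \]
   Context: Fix $n\ge1$; $e_{ij}$ matrix units of $\mathfrak{gl}_n$; $V$ with basis $y_1,\dots,y_n$, $e_{ij}y_k=\delta_{jk}y_i$; $V^*$ dual with dual basis $x_1,\dots,x_n$. Identify $S(\mathfrak{gl}_n)$ with polynomial functions of $A\in\mathfrak{gl}_n$ via the trace form; $\mathrm{Sym}$ is symmetrization into $U(\mathfrak{gl}_n)$. For $j\ge0$, $r_j(y,x)$ is $\mathrm{Sym}$ of the coefficient of $\tau^j$ in $(x,(1-\tau A)^{-1}y)\det(1-\tau A)^{-1}$. For $\zeta_0,\dots,\zeta_m\in\mathbb{C}$, $H_\zeta(\mathfrak{gl}_n)$ is the quotient of $U(\mathfrak{gl}_n)\ltimes T(V\oplus V^* )$ by $[x,x']=[y,y']=0$, $[y,x]=\sum_{j=0}^m\zeta_jr_j(y,x)$; $\zeta(z)=\sum_j\zeta_jz^j$. Let $f(z)=\sum_mf_mz^m$ be the polynomial with $f(0)=0$, $f(z)-f(z-1)=\frac{d^n}{dz^n}(z^n\zeta(z))$; $g_m=f_m/((m+1)\cdots(m+n-1))$. The Casimir element is $t_1'=\sum_jx_jy_j+\sum_{m\ge1}g_m\mathrm{Sym}(\mathrm{Tr}\,S^mA)$,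 a central element of $H_\zeta(\mathfrak{gl}_n)$. $2\sinh(\partial/2)$ denotes the operator $\varphi(z)\mapsto\varphi(z+\frac12)-\varphi(z-\frac12)$ on polynomials. $\mathfrak{h}$ = diagonal matrices; $\lambda\in\mathfrak{h}^*$ identified with $(\lambda_1,\dots,\lambda_n)$, $\lambda_i=\lambda(e_{ii})$; $\rho=(\frac{n-1}{2},\frac{n-3}{2},\dots,-\frac{n-1}{2})$. $\mathfrak{n}^+=\mathrm{span}(e_{ij}\,(i<j),y_1,\dots,y_n)$; the Verma module is $M(\mu)=H_\zeta(\mathfrak{gl}_n)/(H_\zeta(\mathfrak{gl}_n)\mathfrak{n}^++\sum_{h\in\mathfrak{h}}H_\zeta(\mathfrak{gl}_n)(h-\mu(h)))$. $H_p$ is the complete homogeneous symmetric polynomial of degree $p$ in $n$ variables, $H_0=1$. *)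

theory Defs
  imports "HOL-Computational_Algebra.Computational_Algebra" "HOL-Combinatorics.Combinatorics"
begin

datatype gen = E nat nat | X nat | Y nat

type_synonym fa = "gen list \<Rightarrow> complex"

definition fa_one :: fa where "fa_one = (\<lambda>w. if w = [] then 1 else 0)"
definition fa_gen :: "gen \<Rightarrow> fa" where "fa_gen g = (\<lambda>w. if w = [g] then 1 else 0)"
definition fa_add :: "fa \<Rightarrow> fa \<Rightarrow> fa" where "fa_add p q = (\<lambda>w. p w + q w)"
definition fa_sub :: "fa \<Rightarrow> fa \<Rightarrow> fa" where "fa_sub p q = (\<lambda>w. p w - q w)"
definition fa_smul :: "complex \<Rightarrow> fa \<Rightarrow> fa" where "fa_smul c p = (\<lambda>w. c * p w)"
definition fa_mul :: "fa \<Rightarrow> fa \<Rightarrow> fa" where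
  "fa_mul p q = (\<lambda>w. \<Sum>k\<le>length w. p (take k w) * q (drop k w))"
definition fa_comm :: "fa \<Rightarrow> fa \<Rightarrow> fa" where "fa_comm p q = fa_sub (fa_mul p q) (fa_mul q p)"

definition gens :: "nat \<Rightarrow> gen set" where
  "gens n = {E i j |i j. i < n \<and> j < n} \<union> {X i |i. i < n} \<union> {Y i |i. i < n}"

definition FA :: "nat \<Rightarrow> fa set" where
  "FA n = {p. finite {w. p w \<noteq> 0} \<and> (\<forall>w. p w \<noteq> 0 \<longrightarrow> set w \<subseteq> gens n)}"

inductive_set tideal :: "nat \<Rightarrow> fa set \<Rightarrow> fa set" for n R where
  gen: "r \<in> R \<Longrightarrow> r \<in> tideal n R"
| zero: "(\<lambda>w. 0) \<in> tideal n R"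
| add: "a \<in> tideal n R \<Longrightarrow> b \<in> tideal n R \<Longrightarrow> fa_add a b \<in> tideal n R"
| smul: "a \<in> tideal n R \<Longrightarrow> fa_smul c a \<in> tideal n R"
| lmul: "a \<in> tideal n R \<Longrightarrow> g \<in> gens n \<Longrightarrow> fa_mul (fa_gen g) a \<in> tideal n R"
| rmul: "a \<in> tideal n R \<Longrightarrow> g \<in> gens n \<Longrightarrow> fa_mul a (fa_gen g) \<in> tideal n R"

inductive_set lideal :: "nat \<Rightarrow> fa set \<Rightarrow> fa set" for n S where
  gen: "r \<in> S \<Longrightarrow> r \<in> lideal n S"
| zero: "(\<lambda>w. 0) \<in> lideal n S"
| add: "a \<in> lideal n S \<Longrightarrow> b \<in> lideal n S \<Longrightarrow> fa_add a b \<in> lideal n S"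
| smul: "a \<in> lideal n S \<Longrightarrow> fa_smul c a \<in> lideal n S"
| lmul: "a \<in> lideal n S \<Longrightarrow> g \<in> gens n \<Longrightarrow> fa_mul (fa_gen g) a \<in> lideal n S"

definition detn :: "nat \<Rightarrow> (nat \<Rightarrow> nat \<Rightarrow> 'a::comm_ring_1) \<Rightarrow> 'a" where
  "detn n M = (\<Sum>\<sigma> | \<sigma> permutes {..<n}. of_int (sign \<sigma>) * (\<Prod>i<n. M i (\<sigma> i)))"

definition matmul :: "nat \<Rightarrow> (nat \<Rightarrow> nat \<Rightarrow> complex) \<Rightarrow> (nat \<Rightarrow> nat \<Rightarrow> complex) \<Rightarrow> nat \<Rightarrow> nat \<Rightarrow> complex" where
  "matmul n A B = (\<lambda>i j. \<Sum>k<n. A i k * B k j)"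

definition matpow :: "nat \<Rightarrow> (nat \<Rightarrow> nat \<Rightarrow> complex) \<Rightarrow> nat \<Rightarrow> nat \<Rightarrow> nat \<Rightarrow> complex" where
  "matpow n A s = (matmul n A ^^ s) (\<lambda>i j. if i = j then 1 else 0)"

definition matunit :: "nat \<Rightarrow> nat \<Rightarrow> nat \<Rightarrow> nat \<Rightarrow> complex" where
  "matunit a b = (\<lambda>i j. if i = a \<and> j = b then 1 else 0)"

text \<open>r_j(y_k, x_l) as a polynomial function of A: coefficient of tau^j in
  (x_l, (1 - tau A)^{-1} y_k) det(1 - tau A)^{-1}; here (x_l,(1-tau A)^{-1} y_k) is the
  (l,k) entry of the formal inverse (1 - tau A)^{-1} = sum_s tau^s A^s.\<close>
definition r_fun :: "nat \<Rightarrow> nat \<Rightarrow> nat \<Rightarrow> nat \<Rightarrow> (nat \<Rightarrow> nat \<Rightarrow> complex) \<Rightarrow> complex" where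
  "r_fun n k l j A = fps_nth
     (Abs_fps (\<lambda>s. matpow n A s l k) *
      inverse (detn n (\<lambda>a b. (if a = b then 1 else 0) - fps_const (A a b) * fps_X))) j"

text \<open>Tr S^m A, the trace of A on the symmetric power S^m V (= image of the symmetrizer in V^{\<otimes>m}).\<close>
definition trSym :: "nat \<Rightarrow> nat \<Rightarrow> (nat \<Rightarrow> nat \<Rightarrow> complex) \<Rightarrow> complex" where
  "trSym n m A = (1 / fact m) *
     (\<Sum>\<sigma> | \<sigma> permutes {..<m}. \<Sum>is \<in> {is. length is = m \<and> set is \<subseteq> {..<n}}.
        \<Prod>t<m. A (is ! t) (is ! (\<sigma> t)))"

definition polar :: "nat \<Rightarrow> ((nat \<Rightarrow> nat \<Rightarrow> complex) \<Rightarrow> complex) \<Rightarrow> (nat \<times> nat) list \<Rightarrow> complex" where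
  "polar d P ps = (1 / fact d) *
     (\<Sum>S\<in>Pow {..<d}. (-1) ^ (d - card S) *
        P (\<lambda>i j. \<Sum>t\<in>S. matunit (fst (ps ! t)) (snd (ps ! t)) i j))"

text \<open>Sym of a homogeneous degree-d polynomial function P on gl_n, where S(gl_n) is identified
  with polynomial functions via the trace form (e_ba corresponds to the coordinate A_ab):
  Sym(P) = sum over words of Phi(E_{a1 b1},...,E_{ad bd}) e_{b1 a1} ... e_{bd ad}.\<close>
definition symm :: "nat \<Rightarrow> nat \<Rightarrow> ((nat \<Rightarrow> nat \<Rightarrow> complex) \<Rightarrow> complex) \<Rightarrow> fa" where
  "symm n d P = (\<lambda>word. if length word = d \<and> (\<forall>g\<in>set word. \<exists>a b. a < n \<and> b < n \<and> g = E b a)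
      then polar d P (map (\<lambda>g. case g of E b a \<Rightarrow> (a, b) | _ \<Rightarrow> (0, 0)) word) else 0)"

definition kd :: "nat \<Rightarrow> nat \<Rightarrow> complex" where "kd a b = (if a = b then 1 else 0)"

definition hrels :: "nat \<Rightarrow> complex poly \<Rightarrow> fa set" where
  "hrels n zeta =
     {fa_sub (fa_comm (fa_gen (E i j)) (fa_gen (E k l)))
        (fa_sub (fa_smul (kd j k) (fa_gen (E i l))) (fa_smul (kd l i) (fa_gen (E k j))))
       |i j k l. i < n \<and> j < n \<and> k < n \<and> l < n}
   \<union> {fa_sub (fa_comm (fa_gen (E i j)) (fa_gen (Y k))) (fa_smul (kd j k) (fa_gen (Y i)))
       |i j k. i < n \<and> j < n \<and> k < n}
   \<union> {fa_add (fa_comm (fa_gen (E i j)) (fa_gen (X k))) (fa_smul (kd i k) (fa_gen (X j)))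
       |i j k. i < n \<and> j < n \<and> k < n}
   \<union> {fa_comm (fa_gen (X i)) (fa_gen (X j)) |i j. i < n \<and> j < n}
   \<union> {fa_comm (fa_gen (Y i)) (fa_gen (Y j)) |i j. i < n \<and> j < n}
   \<union> {fa_sub (fa_comm (fa_gen (Y k)) (fa_gen (X l)))
        (\<lambda>w. \<Sum>j\<le>degree zeta. coeff zeta j * symm n j (r_fun n k l j) w)
       |k l. k < n \<and> l < n}"

text \<open>Preimage in the free algebra of the left ideal
  H n^+ + sum_h H (h - mu(h)) defining the Verma module M(mu).\<close>
definition verma_ideal :: "nat \<Rightarrow> complex poly \<Rightarrow> (nat \<Rightarrow> complex) \<Rightarrow> fa set" where
  "verma_ideal n zeta mu = lideal n (tideal n (hrels n zeta)
     \<union> {fa_gen (Y k) |k. k < n}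
     \<union> {fa_gen (E i j) |i j. i < j \<and> j < n}
     \<union> {fa_sub (fa_gen (E i i)) (fa_smul (mu i) fa_one) |i. i < n})"

definition casimir :: "nat \<Rightarrow> complex poly \<Rightarrow> fa" where
  "casimir n f = fa_add (\<lambda>w. \<Sum>j<n. fa_mul (fa_gen (X j)) (fa_gen (Y j)) w)
     (\<lambda>w. \<Sum>m\<in>{1..degree f}.
        (coeff f m / pochhammer (of_nat (m + 1) :: complex) (n - 1)) * symm n m (trSym n m) w)"

definition rho :: "nat \<Rightarrow> nat \<Rightarrow> complex" where
  "rho n i = of_nat (n - 1) / 2 - of_nat i"

definition complete_hom :: "nat \<Rightarrow> nat \<Rightarrow> (nat \<Rightarrow> complex) \<Rightarrow> complex" where
  "complete_hom n p lam = (\<Sum>\<alpha>\<in>{\<alpha>. (\<forall>i. n \<le> i \<longrightarrow> \<alpha> i = 0) \<and> sum \<alpha> {..<n} = p}.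
      \<Prod>i<n. lam i ^ \<alpha> i)"

definition sinh_op :: "complex poly \<Rightarrow> complex poly" where
  "sinh_op p = pcompose p [:1/2, 1:] - pcompose p [:-1/2, 1:]"

end

(* Integrals over the unit sphere are replaced by a finite cubature: points (v, w) with w . v = 1
   whose moments are those of the sphere.  For such a point put e = sum v_i w_j e_ij.  Then Sym Tr S^m
   and Sym r_j are, up to explicit factors, the averages of e^m and of v_l w_k e^j, so that
   t_1' = sum x_j y_j + T(f) / (n-1)! and [y_k, x_l] = Q_lk(f(z) - f(z-1)) / (n-1)!, where T(g) and
   Q_ab(g) denote the averages of g(e) and of v_a w_b g(e).
   Centrality holds pointwise: with xi = sum w_j x_j one has e xi = xi (e - 1) and
   [e, x_k] = - v_k xi, hence [g(e), x_k] = - v_k xi (g(e) - g(e-1)).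
   Integration by parts on the sphere gives, with D g(z) = g(z+1) - g(z),
     sum_j Q_aj(D g) e_bj = Q_ab(z D g) + n Q_ab(g) - delta_ab T(g),
   and on a highest weight vector this recursion determines T(g) and Q_aa(g) by induction on deg g.
   It is solved by divided differences: T(D^(n-1) G) is (n-1)! times the divided difference of G
   at the points mu_j - j + n - 1 (0 <= j < n). *)
theory Submission
  imports Defs "HOL-Library.Poly_Mapping"
begin

section \<open>Finite differences of polynomials\<close>

text \<open>Rank one is what makes symmetrization harmless: Sym of the m-th power of a linear
  function of A is the m-th power of the corresponding element of gl_n. Every Sym thus becomes a
  polynomial in a single element, which can be moved through x and y. With finite sums in place of
  integrals the averages are elements of the free algebra itself, at the price of a bound on the
  degrees. The normalization w . v = 1 makes the matrix of e idempotent; from this come the unit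
  shifts, and hence difference operators instead of derivatives. The closed formula rests on two
  facts. The (n-1)-st power of the central difference operator is D^(n-1) with the argument
  translated by -(n-1)/2, and this translation takes the points mu_j - j + n - 1, for mu = lambda -
  rho, to lambda_j. The divided difference of z^(n-1+p) at n points is H_p of these points.\<close>

lemma shift_diff_coeff:
  fixes p :: "complex poly"
  shows "degree p \<le> Suc k \<Longrightarrow> degree (pcompose p [:z, 1:] - p) \<le> k
    \<and> coeff (pcompose p [:z, 1:] - p) k = of_nat (Suc k) * z * coeff p (Suc k)"
proof (induction p arbitrary: k)
  case 0
  then show ?case by simp
next
  case (pCons a p)
  let ?D = "\<lambda>p. pcompose p [:z, 1:] - p"
  have D: "?D (pCons a p) = smult z p + pCons 0 (?D p) + smult z (?D p)"
    by (simp add: pcompose_pCons smult_diff_right)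
  have d: "degree p \<le> k"
    using pCons.prems by (cases "p = 0") auto
  show ?case
  proof (cases k)
    case 0
    then obtain c where "p = [:c:]" using d degree_eq_zeroE[of p] by auto
    then show ?thesis using 0 by (simp add: pcompose_pCons)
  next
    case (Suc j)
    then have IH: "degree (?D p) \<le> j" "coeff (?D p) j = of_nat (Suc j) * z * coeff p (Suc j)"
      using pCons.IH d by auto
    have "degree (pCons 0 (?D p)) \<le> Suc j"
      using IH(1) degree_pCons_le le_trans by blast
    then have "degree (?D (pCons a p)) \<le> Suc j"
      unfolding D using d Suc IH(1)
      by (intro degree_add_le order.trans[OF degree_smult_le]) auto
    moreover have "coeff (?D p) (Suc j) = 0"
      using IH(1) by (intro coeff_eq_0) simp
    ultimately show ?thesis
      unfolding Suc D using IH(2) by (simp add: algebra_simps)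
  qed
qed

section \<open>Forward differences with step 1\<close>

definition fdiff :: "complex poly \<Rightarrow> complex poly" where
  "fdiff p = pcompose p [:1, 1:] - p"

lemma fdiff_pCons: "fdiff (pCons a p) = p + pCons 0 (fdiff p) + fdiff p"
  by (simp add: fdiff_def pcompose_pCons algebra_simps)

lemma fdiff_0 [simp]: "fdiff 0 = 0"
  by (simp add: fdiff_def)

lemma fdiff_const [simp]: "fdiff [:c:] = 0"
  by (simp add: fdiff_def)

lemma fdiff_add: "fdiff (p + q) = fdiff p + fdiff q"
  by (simp add: fdiff_def pcompose_add)

lemma fdiff_diff: "fdiff (p - q) = fdiff p - fdiff q"
  by (simp add: fdiff_def pcompose_diff)

lemma fdiff_smult: "fdiff (smult c p) = smult c (fdiff p)"
  by (simp add: fdiff_def pcompose_smult smult_diff_right)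

lemma fdiff_iter_diff: "(fdiff ^^ k) (p - q) = (fdiff ^^ k) p - (fdiff ^^ k) q"
  by (induction k) (simp_all add: fdiff_diff)

lemma fdiff_iter_add: "(fdiff ^^ k) (p + q) = (fdiff ^^ k) p + (fdiff ^^ k) q"
  by (induction k) (simp_all add: fdiff_add)

lemma fdiff_iter_smult: "(fdiff ^^ k) (smult c p) = smult c ((fdiff ^^ k) p)"
  by (induction k) (simp_all add: fdiff_smult)

lemma fdiff_coeff:
  "degree p \<le> Suc k \<Longrightarrow> degree (fdiff p) \<le> k \<and> coeff (fdiff p) k = of_nat (Suc k) * coeff p (Suc k)"
  using shift_diff_coeff[of p k 1] by (simp add: fdiff_def)

lemma fdiff_degree: "degree (fdiff p) = degree p - 1"
proof (cases "degree p")
  case 0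
  then show ?thesis by (metis degree_eq_zeroE diff_0_eq_0 fdiff_const degree_0)
next
  case (Suc k)
  then have "p \<noteq> 0" by auto
  then have "coeff p (Suc k) \<noteq> 0" using Suc by (metis leading_coeff_0_iff)
  then have "coeff (fdiff p) k \<noteq> 0" using fdiff_coeff[of p k] Suc
    by (metis mult_eq_0_iff nat.distinct(1) of_nat_eq_0_iff order_refl)
  then show ?thesis using fdiff_coeff[of p k] Suc le_degree by fastforce
qed

lemma fdiff_eq_0: "fdiff p = 0 \<Longrightarrow> degree p = 0"
proof (rule ccontr)
  assume a: "fdiff p = 0" "degree p \<noteq> 0"
  then obtain k where k: "degree p = Suc k" using not0_implies_Suc by blast
  then have "p \<noteq> 0" by auto
  then have "coeff p (Suc k) \<noteq> 0" using k by (metis leading_coeff_0_iff)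
  then show False using fdiff_coeff[of p k] k a
    by (metis coeff_0 mult_eq_0_iff nat.distinct(1) of_nat_eq_0_iff order_refl)
qed

text \<open>Descent on the degree: a monomial of the next degree reproduces the leading term, and
  the rest has smaller degree or is zero.\<close>

lemma fdiff_surj: "\<exists>q. fdiff q = p"
proof (induction "degree p" arbitrary: p rule: less_induct)
  case less
  let ?k = "degree p"
  define q where "q = monom (coeff p ?k / of_nat (Suc ?k)) (Suc ?k)"
  have dq: "degree q \<le> Suc ?k" by (simp add: q_def degree_monom_le)
  have c: "coeff (fdiff q) ?k = coeff p ?k"
    using fdiff_coeff[OF dq] by (simp add: q_def del: of_nat_Suc)
  have d: "degree (fdiff q) \<le> ?k" using fdiff_coeff[OF dq] by simp
  show ?case
  proof (cases "p - fdiff q = 0")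
    case True
    then show ?thesis by (metis eq_iff_diff_eq_0)
  next
    case False
    have "degree (p - fdiff q) \<le> ?k" using d by (simp add: degree_diff_le)
    moreover have "degree (p - fdiff q) \<noteq> ?k"
    proof
      assume e: "degree (p - fdiff q) = ?k"
      have "coeff (p - fdiff q) ?k = 0" using c by simp
      then show False using False e by (metis leading_coeff_0_iff)
    qed
    ultimately have "degree (p - fdiff q) < ?k" by simp
    then obtain r where "fdiff r = p - fdiff q" using less by blast
    then have "fdiff (q + r) = p" by (simp add: fdiff_add)
    then show ?thesis by blast
  qed
qed

lemma fdiff_iter_surj: "\<exists>q. (fdiff ^^ k) q = p"
proof (induction k arbitrary: p)
  case (Suc k)
  then obtain q where "(fdiff ^^ k) q = p" by blast
  moreover obtain r where "fdiff r = q" using fdiff_surj by blast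
  ultimately have "(fdiff ^^ Suc k) r = p" by (simp add: funpow_swap1)
  then show ?case by blast
qed auto

lemma fdiff_iter_degree: "degree ((fdiff ^^ k) p) = degree p - k"
  by (induction k) (simp_all add: fdiff_degree)

lemma fdiff_iter_eq_0: "(fdiff ^^ k) p = 0 \<Longrightarrow> p = 0 \<or> degree p < k"
proof (induction k arbitrary: p)
  case (Suc k)
  from Suc.prems have "(fdiff ^^ k) (fdiff p) = 0" by (simp add: funpow_swap1)
  then have "fdiff p = 0 \<or> degree (fdiff p) < k" by (rule Suc.IH)
  then show ?case using fdiff_eq_0[of p] by (auto simp: fdiff_degree)
qed simp

lemma fdiff_iter_small: "degree p < k \<Longrightarrow> (fdiff ^^ k) p = 0"
proof (induction k arbitrary: p)
  case (Suc k)
  show ?case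
  proof (cases "degree p")
    case 0
    then have "fdiff p = 0" by (metis degree_eq_zeroE fdiff_const)
    moreover have "(fdiff ^^ k) 0 = 0" by (induction k) auto
    ultimately show ?thesis by (simp add: funpow_swap1)
  next
    case (Suc j)
    then have "(fdiff ^^ k) (fdiff p) = 0"
      using Suc.IH[of "fdiff p"] Suc.prems by (simp add: fdiff_degree)
    then show ?thesis by (simp add: funpow_swap1)
  qed
qed simp

lemma fdiff_pcompose_shift: "fdiff (pcompose p [:c, 1:]) = pcompose (fdiff p) [:c, 1:]"
proof -
  have "pcompose (pcompose p [:c, 1:]) [:1, 1:] = pcompose (pcompose p [:1, 1:]) [:c, 1:]"
    by (simp add: pcompose_assoc[symmetric] pcompose_pCons add.commute)
  then show ?thesis by (simp add: fdiff_def pcompose_diff)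
qed

lemma fdiff_iter_pcompose_shift:
  "(fdiff ^^ k) (pcompose p [:c, 1:]) = pcompose ((fdiff ^^ k) p) [:c, 1:]"
  by (induction k) (simp_all add: fdiff_pcompose_shift)

lemma pcompose_shift_shift: "pcompose (pcompose p [:a, 1:]) [:b, 1:] = pcompose p [:a + b, 1:]"
  for p :: "complex poly"
  by (simp add: pcompose_assoc[symmetric] pcompose_pCons add.commute)

lemma pcompose_0_shift [simp]: "pcompose p [:0, 1:] = p" for p :: "complex poly"
  using pcompose_idR[of p] by simp

section \<open>Central differences and the polynomial w(z)\<close>

lemma sinh_op_conv: "sinh_op p = pcompose (fdiff p) [:-1/2, 1:]"
  by (simp add: sinh_op_def fdiff_def pcompose_diff pcompose_shift_shift)

text \<open>The half steps add up. For k = n - 1 the resulting translation is the one that takes the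
  points \<open>kap j\<close> to \<open>lam j\<close> in \<open>cas_highest_weight\<close>.\<close>

lemma sinh_op_iter_conv: "(sinh_op ^^ k) p = pcompose ((fdiff ^^ k) p) [:- of_nat k / 2, 1:]"
proof (induction k)
  case (Suc k)
  then show ?case
    by (simp add: sinh_op_conv fdiff_pcompose_shift pcompose_shift_shift field_simps)
qed simp

text \<open>The kernel of the k-th difference consists of the polynomials of degree below k, and
  these are exactly the remainders modulo z^k. So a k-th antidifference of the translated f can be
  reduced to a multiple of z^k, in only one way.\<close>

lemma ex1_sinh_op: "\<exists>!w. (sinh_op ^^ k) (monom 1 k * w) = f"
proof -
  obtain G where G: "(fdiff ^^ k) G = pcompose f [:of_nat k / 2, 1:]"
    using fdiff_iter_surj by blast
  define w where "w = G div monom 1 k"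
  have m0: "monom (1::complex) k \<noteq> 0" by simp
  have deg: "degree (G mod monom 1 k) < k \<or> G mod monom 1 k = 0"
    using degree_mod_less[OF m0, of G] by (auto simp: degree_monom_eq)
  have z: "(fdiff ^^ k) (G mod monom 1 k) = 0"
  proof (cases "G mod monom 1 k = 0")
    case True
    have "(fdiff ^^ k) 0 = 0" by (induction k) auto
    then show ?thesis using True by simp
  qed (use deg fdiff_iter_small in auto)
  have "G = monom 1 k * w + G mod monom 1 k" by (simp add: w_def)
  then have "(fdiff ^^ k) (monom 1 k * w) = pcompose f [:of_nat k / 2, 1:]"
    using G z by (metis add.right_neutral fdiff_iter_add)
  then have ex: "(sinh_op ^^ k) (monom 1 k * w) = f"
    by (simp add: sinh_op_iter_conv pcompose_shift_shift)
  have "w' = w" if w': "(sinh_op ^^ k) (monom 1 k * w') = f" for w'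
  proof -
    have "(sinh_op ^^ k) (monom 1 k * (w' - w)) = 0"
      using ex w' by (simp add: sinh_op_iter_conv right_diff_distrib fdiff_iter_diff pcompose_diff)
    then have "pcompose (pcompose ((fdiff ^^ k) (monom 1 k * (w' - w))) [:- of_nat k / 2, 1:]) [:of_nat k / 2, 1:] = 0"
      by (simp add: sinh_op_iter_conv)
    then have "(fdiff ^^ k) (monom 1 k * (w' - w)) = 0"
      by (simp add: pcompose_shift_shift)
    then have "monom 1 k * (w' - w) = 0 \<or> degree (monom 1 k * (w' - w)) < k"
      by (rule fdiff_iter_eq_0)
    moreover have "degree (monom 1 k * (w' - w)) \<ge> k" if "w' - w \<noteq> 0"
      using that by (simp add: degree_mult_eq degree_monom_eq)
    ultimately have "monom 1 k * (w' - w) = 0"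
      using m0 by (cases "w' - w = 0") auto
    then show ?thesis using m0 by simp
  qed
  with ex show ?thesis by blast
qed

lemma fdiff_mult_X: "fdiff (pCons 0 p) = pCons 0 (fdiff p) + fdiff p + p"
  by (simp add: fdiff_pCons)

text \<open>Leibniz rule for the factor z. It makes the remainder \<open>r\<close> in
  \<open>highest_weight_values_aux\<close> again an n-th difference.\<close>

lemma fdiff_iter_mult_X:
  "(fdiff ^^ Suc k) (pCons 0 p)
     = pCons 0 ((fdiff ^^ Suc k) p) + smult (of_nat (Suc k)) ((fdiff ^^ Suc k) p + (fdiff ^^ k) p)"
proof (induction k)
  case 0
  then show ?case by (simp add: fdiff_pCons)
next
  case (Suc k)
  have "fdiff ((fdiff ^^ Suc k) (pCons 0 p)) = pCons 0 (fdiff ((fdiff ^^ Suc k) p))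
      + smult (1 + of_nat (Suc k)) (fdiff ((fdiff ^^ Suc k) p) + (fdiff ^^ Suc k) p)"
    unfolding Suc by (simp add: fdiff_add fdiff_smult fdiff_mult_X smult_add_right smult_add_left del: of_nat_Suc)
  then show ?case by (simp only: funpow.simps o_apply of_nat_Suc)
qed

text \<open>The alternating sum over subsets is the product of the difference operators with steps
  \<open>z t\<close>, applied to p at x. Each of them lowers the degree by one, so
  \<open>card T\<close> of them leave only the top coefficient. For this purpose
  \<open>shift_diff_coeff\<close> allows an arbitrary step.\<close>

lemma polarization_poly:
  fixes z :: "'b \<Rightarrow> complex"
  assumes "finite T" "degree p \<le> card T"
  shows "(\<Sum>S\<in>Pow T. (-1) ^ (card T - card S) * poly p (x + sum z S)) = fact (card T) * coeff p (card T) * prod z T"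
  using assms
proof (induction T arbitrary: p x)
  case empty
  then obtain c where "p = [:c:]" using degree_eq_zeroE[of p] by auto
  then show ?case by simp
next
  case (insert t T)
  let ?D = "pcompose p [:z t, 1:] - p"
  have D: "degree ?D \<le> card T" "coeff ?D (card T) = of_nat (Suc (card T)) * z t * coeff p (Suc (card T))"
    using shift_diff_coeff[of p "card T" "z t"] insert by auto
  have sub: "finite S \<and> t \<notin> S \<and> card S \<le> card T" if "S \<in> Pow T" for S
    using that insert.hyps by (auto intro: finite_subset card_mono)
  \<comment> \<open>Subsets with and without t pair up into a difference with step
    \<open>z t\<close>.\<close>
  have "(\<Sum>S\<in>Pow (insert t T). (-1) ^ (card (insert t T) - card S) * poly p (x + sum z S))
      = (\<Sum>S\<in>Pow T. (-1) ^ (Suc (card T) - card S) * poly p (x + sum z S))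
        + (\<Sum>S\<in>insert t ` Pow T. (-1) ^ (Suc (card T) - card S) * poly p (x + sum z S))"
    unfolding Pow_insert using insert.hyps by (subst sum.union_disjoint) auto
  also have "(\<Sum>S\<in>insert t ` Pow T. (-1) ^ (Suc (card T) - card S) * poly p (x + sum z S))
      = (\<Sum>S\<in>Pow T. (-1) ^ (Suc (card T) - card (insert t S)) * poly p (x + sum z (insert t S)))"
    using insert.hyps by (subst sum.reindex) (auto simp: inj_on_def)
  also have "(\<Sum>S\<in>Pow T. (-1) ^ (Suc (card T) - card S) * poly p (x + sum z S))
      + (\<Sum>S\<in>Pow T. (-1) ^ (Suc (card T) - card (insert t S)) * poly p (x + sum z (insert t S)))
      = (\<Sum>S\<in>Pow T. (-1) ^ (card T - card S) * poly ?D (x + sum z S))"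
    unfolding sum.distrib[symmetric]
    by (intro sum.cong refl) (use sub in \<open>auto simp: Suc_diff_le poly_pcompose algebra_simps\<close>)
  also have "\<dots> = fact (card T) * coeff ?D (card T) * prod z T"
    by (rule insert.IH[OF D(1)])
  also have "\<dots> = fact (card (insert t T)) * coeff p (card (insert t T)) * prod z (insert t T)"
    unfolding D(2) using insert.hyps by (simp add: algebra_simps)
  finally show ?case .
qed

lemma polarization_power:
  fixes z :: "nat \<Rightarrow> complex"
  shows "(\<Sum>S\<in>Pow {..<d}. (-1) ^ (d - card S) * sum z S ^ d) = fact d * (\<Prod>t<d. z t)"
  using polarization_poly[of "{..<d}" "monom 1 d" 0 z] by (simp add: degree_monom_le poly_monom)

section \<open>Divided differences\<close>

text \<open>The generating series of the complete homogeneous symmetric polynomials of the points in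
  U.\<close>

definition hfps :: "complex multiset \<Rightarrow> complex fps" where
  "hfps U = (\<Prod>x\<in>#U. inverse (1 - fps_const x * fps_X))"

definition pair_fps :: "complex fps \<Rightarrow> complex poly \<Rightarrow> complex" where
  "pair_fps \<phi> p = (\<Sum>k\<le>degree p. coeff p k * fps_nth \<phi> k)"

text \<open>For nonempty U, the value on z^k is the complete homogeneous polynomial of degree k -
  size U + 1 in the points (zero for negative degree). This is the divided difference, and it makes
  sense for repeated points at once.\<close>

definition ddiff :: "complex multiset \<Rightarrow> complex poly \<Rightarrow> complex" where
  "ddiff U p = pair_fps (fps_X ^ (size U - 1) * hfps U) p"

lemma pair_fps_bound: "degree p \<le> N \<Longrightarrow> pair_fps \<phi> p = (\<Sum>k\<le>N. coeff p k * fps_nth \<phi> k)"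
  unfolding pair_fps_def
  by (rule sum.mono_neutral_left) (auto simp: coeff_eq_0)

lemma pair_fps_add: "pair_fps \<phi> (p + q) = pair_fps \<phi> p + pair_fps \<phi> q"
proof -
  let ?N = "max (degree p) (degree q)"
  have "degree (p + q) \<le> ?N" by (rule degree_add_le_max)
  then show ?thesis
    by (simp add: pair_fps_bound[of _ ?N] sum.distrib[symmetric] algebra_simps)
qed

lemma pair_fps_smult: "pair_fps \<phi> (smult c p) = c * pair_fps \<phi> p"
  by (simp add: pair_fps_bound[of _ "degree p"] sum_distrib_left algebra_simps degree_smult_le)

lemma pair_fps_diff: "pair_fps \<phi> (p - q) = pair_fps \<phi> p - pair_fps \<phi> q"
  using pair_fps_add[of \<phi> "p - q" q] by simp

lemma pair_fps_diff_left: "pair_fps (\<phi> - \<psi>) p = pair_fps \<phi> p - pair_fps \<psi> p"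
  by (simp add: pair_fps_def sum_subtractf[symmetric] algebra_simps)

lemma pair_fps_const_left: "pair_fps (fps_const c * \<phi>) p = c * pair_fps \<phi> p"
  by (simp add: pair_fps_def sum_distrib_left algebra_simps)

lemma pair_fps_X_mult: "pair_fps (fps_X * \<phi>) (pCons a p) = pair_fps \<phi> p"
proof -
  have "degree (pCons a p) \<le> Suc (degree p)" by (rule degree_pCons_le)
  then have "pair_fps (fps_X * \<phi>) (pCons a p)
      = (\<Sum>k\<le>Suc (degree p). coeff (pCons a p) k * fps_nth (fps_X * \<phi>) k)"
    by (rule pair_fps_bound)
  then show ?thesis by (simp add: pair_fps_def sum.atMost_Suc_shift del: sum.atMost_Suc)
qed

lemma hfps_add_mset: "(1 - fps_const x * fps_X) * hfps (add_mset x U) = hfps U"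
proof -
  have "(1 - fps_const x * fps_X) * inverse (1 - fps_const x * fps_X) = 1"
    by (rule inverse_mult_eq_1') simp
  then show ?thesis by (simp add: hfps_def mult.assoc[symmetric])
qed

lemmas ddiff_add = pair_fps_add[of "fps_X ^ (size U - 1) * hfps U" for U, folded ddiff_def]
lemmas ddiff_diff = pair_fps_diff[of "fps_X ^ (size U - 1) * hfps U" for U, folded ddiff_def]
lemmas ddiff_smult = pair_fps_smult[of "fps_X ^ (size U - 1) * hfps U" for U, folded ddiff_def]

text \<open>Under the pairing, multiplication by z - x is adjoint, up to one power of X, to
  multiplication of the series by 1 - x X. The latter cancels the factor of x in
  \<open>hfps\<close>, so that the point x disappears.\<close>

lemma ddiff_factor:
  assumes "U \<noteq> {#}"
  shows "ddiff (add_mset x U) (pCons 0 p - smult x p) = ddiff U p"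
proof -
  obtain s where s: "size U = Suc s" using assms by (metis not0_implies_Suc size_eq_0_iff_empty)
  have "ddiff (add_mset x U) (pCons 0 p - smult x p)
      = pair_fps (fps_X * (fps_X ^ s * hfps (add_mset x U))) (pCons 0 p)
        - x * pair_fps (fps_X ^ Suc s * hfps (add_mset x U)) p"
    by (simp add: ddiff_def s pair_fps_diff pair_fps_smult mult.assoc)
  also have "\<dots> = pair_fps (fps_X ^ s * hfps (add_mset x U)
        - fps_const x * (fps_X ^ Suc s * hfps (add_mset x U))) p"
    by (simp only: pair_fps_X_mult pair_fps_diff_left pair_fps_const_left)
  also have "fps_X ^ s * hfps (add_mset x U) - fps_const x * (fps_X ^ Suc s * hfps (add_mset x U))
      = fps_X ^ s * ((1 - fps_const x * fps_X) * hfps (add_mset x U))"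
    by (simp add: algebra_simps)
  finally show ?thesis by (simp add: hfps_add_mset ddiff_def s)
qed

text \<open>The classical recursion in a form without division, hence meaningful for x = y
  too.\<close>

lemma ddiff_exchange:
  "ddiff (add_mset x U) p - ddiff (add_mset y U) p = (x - y) * ddiff (add_mset x (add_mset y U)) p"
proof -
  let ?h = "hfps (add_mset x (add_mset y U))"
  have 1: "hfps (add_mset x U) = (1 - fps_const y * fps_X) * ?h"
    by (metis add_mset_commute hfps_add_mset)
  have 2: "hfps (add_mset y U) = (1 - fps_const x * fps_X) * ?h"
    by (simp add: hfps_add_mset)
  have "fps_X ^ size U * hfps (add_mset x U) - fps_X ^ size U * hfps (add_mset y U)
     = fps_const (x - y) * (fps_X ^ Suc (size U) * ?h)"
    by (simp add: 1 2 algebra_simps fps_const_sub[symmetric] del: fps_const_sub)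
  then show ?thesis
    by (simp add: ddiff_def pair_fps_diff_left[symmetric] pair_fps_const_left[symmetric])
qed

lemma fps_nth_geometric: "fps_nth (inverse (1 - fps_const x * fps_X)) k = x ^ k" for x :: complex
proof -
  have "inverse (1 - fps_const x * fps_X) = Abs_fps (\<lambda>k. x ^ k)"
  proof (rule fps_inverse_unique)
    show "(1 - fps_const x * fps_X) * Abs_fps (\<lambda>k. x ^ k) = 1"
    proof (rule fps_ext)
      fix k
      show "fps_nth ((1 - fps_const x * fps_X) * Abs_fps (\<lambda>k. x ^ k)) k = fps_nth 1 k"
        by (cases k) (simp_all add: left_diff_distrib mult.assoc)
    qed
  qed
  then show ?thesis by simp
qed

lemma ddiff_single: "ddiff {#x#} p = poly p x"
  by (simp add: ddiff_def hfps_def pair_fps_def fps_nth_geometric poly_altdef)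

lemma ddiff_const: "size U \<ge> 2 \<Longrightarrow> ddiff U [:c:] = 0"
  by (simp add: ddiff_def pair_fps_def)

text \<open>Induction on the points: division of p by z - (x + a) leaves a constant, which is
  annihilated as soon as there are two points, and \<open>ddiff_factor\<close> removes one point on
  both sides.\<close>

lemma ddiff_shift:
  assumes "U \<noteq> {#}"
  shows "ddiff (image_mset (\<lambda>x. x + a) U) p = ddiff U (pcompose p [:a, 1:])"
  using assms
proof (induction U arbitrary: p)
  case (add x U)
  show ?case
  proof (cases "U = {#}")
    case True
    then show ?thesis by (simp add: ddiff_single poly_pcompose add.commute)
  next
    case False
    obtain q c where "p = [:-(x + a), 1:] * q + [:c:]"
    proof -
      have "[:-(x + a), 1:] dvd p - [:poly p (x + a):]"
        by (subst poly_eq_0_iff_dvd[symmetric]) simp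
      then obtain q where "p - [:poly p (x + a):] = [:-(x + a), 1:] * q" by (rule dvdE)
      then have "p = [:-(x + a), 1:] * q + [:poly p (x + a):]" by (simp add: algebra_simps)
      then show ?thesis using that by blast
    qed
    then have p: "p = (pCons 0 q - smult (x + a) q) + [:c:]"
      by (simp only: mult_pCons_left smult_minus_left smult_1_left mult_zero_left pCons_0_0) simp
    have sz: "size (add_mset x U) \<ge> 2" "size (image_mset (\<lambda>x. x + a) (add_mset x U)) \<ge> 2"
      using False by (cases U; simp)+
    have "pcompose p [:a, 1:]
        = (pCons 0 (pcompose q [:a, 1:]) - smult x (pcompose q [:a, 1:])) + [:c:]"
      unfolding p by (simp add: pcompose_add pcompose_diff pcompose_pCons pcompose_smult smult_add_left algebra_simps)
    then have "ddiff (add_mset x U) (pcompose p [:a, 1:]) = ddiff U (pcompose q [:a, 1:])"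
      using False sz(1) by (simp add: ddiff_add ddiff_const ddiff_factor)
    moreover have "ddiff (image_mset (\<lambda>x. x + a) (add_mset x U)) p = ddiff (image_mset (\<lambda>x. x + a) U) q"
      using False sz(2) unfolding p by (simp add: ddiff_add ddiff_const ddiff_factor del: image_mset_add_mset) (simp add: ddiff_factor)
    ultimately show ?thesis using add.IH False by simp
  qed
qed simp

section \<open>Divided differences and complete homogeneous polynomials\<close>

lemma finite_exponents: "finite {\<alpha>::nat \<Rightarrow> nat. (\<forall>i. n \<le> i \<longrightarrow> \<alpha> i = 0) \<and> sum \<alpha> {..<n} = p}"
proof (rule finite_subset)
  show "{\<alpha>::nat \<Rightarrow> nat. (\<forall>i. n \<le> i \<longrightarrow> \<alpha> i = 0) \<and> sum \<alpha> {..<n} = p}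
    \<subseteq> {\<alpha>. \<forall>i. (i \<in> {..<n} \<longrightarrow> \<alpha> i \<in> {..p}) \<and> (i \<notin> {..<n} \<longrightarrow> \<alpha> i = 0)}"
    by (auto intro: member_le_sum)
  show "finite {\<alpha>::nat \<Rightarrow> nat. \<forall>i. (i \<in> {..<n} \<longrightarrow> \<alpha> i \<in> {..p}) \<and> (i \<notin> {..<n} \<longrightarrow> \<alpha> i = 0)}"
    by (rule finite_set_of_finite_funs) auto
qed

lemma complete_hom_Suc:
  "complete_hom (Suc n) p lam = (\<Sum>k\<le>p. complete_hom n k lam * lam n ^ (p - k))"
proof -
  let ?A = "\<lambda>n p. {\<alpha>::nat \<Rightarrow> nat. (\<forall>i. n \<le> i \<longrightarrow> \<alpha> i = 0) \<and> sum \<alpha> {..<n} = p}"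
  have "(\<Sum>k\<le>p. complete_hom n k lam * lam n ^ (p - k))
      = (\<Sum>k\<le>p. \<Sum>\<alpha>\<in>?A n k. (\<Prod>i<n. lam i ^ \<alpha> i) * lam n ^ (p - k))"
    by (simp add: complete_hom_def sum_distrib_right)
  also have "\<dots> = (\<Sum>(k, \<alpha>)\<in>Sigma {..p} (?A n). (\<Prod>i<n. lam i ^ \<alpha> i) * lam n ^ (p - k))"
    by (rule sum.Sigma) (auto simp: finite_exponents)
  also have "\<dots> = (\<Sum>\<beta>\<in>?A (Suc n) p. \<Prod>i<Suc n. lam i ^ \<beta> i)"
  proof (rule sum.reindex_bij_witness[where
        i = "\<lambda>\<beta>. (p - \<beta> n, \<beta>(n := 0))" and j = "\<lambda>(k, \<alpha>). \<alpha>(n := p - k)"], goal_cases)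
    case (4 \<beta>)
    then have "sum \<beta> {..<n} + \<beta> n = p" by auto
    moreover have "sum (\<beta>(n := 0)) {..<n} = sum \<beta> {..<n}" by (rule sum.cong) auto
    ultimately show ?case using 4 by (auto simp: not_less_eq_eq)
  next
    case (2 a)
    obtain k \<alpha> where a: "a = (k, \<alpha>)" by (cases a)
    then have z: "\<forall>i\<ge>n. \<alpha> i = 0" "sum \<alpha> {..<n} = k" "k \<le> p" using 2 by auto
    have "sum (\<alpha>(n := p - k)) {..<n} = sum \<alpha> {..<n}" by (rule sum.cong) auto
    then show ?case using z a by auto
  next
    case (1 a)
    then show ?case by (auto simp: fun_eq_iff)
  next
    case (3 b)
    then show ?case by auto
  next
    case (5 a)
    obtain k \<alpha> where a: "a = (k, \<alpha>)" by (cases a)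
    have "(\<Prod>i<n. lam i ^ (\<alpha>(n := p - k)) i) = (\<Prod>i<n. lam i ^ \<alpha> i)" by (rule prod.cong) auto
    then show ?case using a by simp
  qed
  finally show ?thesis by (simp add: complete_hom_def)
qed

lemma fps_nth_hfps_complete_hom:
  "fps_nth (hfps (image_mset lam (mset_set {..<n}))) p = complete_hom n p lam"
proof (induction n arbitrary: p)
  case 0
  have "{\<alpha>::nat \<Rightarrow> nat. (\<forall>i. \<alpha> i = 0) \<and> 0 = p} = (if p = 0 then {\<lambda>_. 0} else {})"
    by auto
  then show ?case by (simp add: hfps_def complete_hom_def)
next
  case (Suc n)
  have "mset_set {..<Suc n} = add_mset n (mset_set {..<n})"
    by (simp add: lessThan_Suc)
  then have "hfps (image_mset lam (mset_set {..<Suc n}))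
      = hfps (image_mset lam (mset_set {..<n})) * inverse (1 - fps_const (lam n) * fps_X)"
    by (simp add: hfps_def mult.commute)
  then show ?case
    by (simp add: fps_mult_nth Suc.IH fps_nth_geometric complete_hom_Suc atMost_atLeast0)
qed

text \<open>The power z^(n-1) exactly compensates the power of X in \<open>ddiff\<close>; this is
  the reason why w enters f through z^(n-1) w(z).\<close>

lemma ddiff_complete_hom:
  assumes "n \<ge> 1"
  shows "ddiff (image_mset lam (mset_set {..<n})) (monom 1 (n - 1) * w)
    = (\<Sum>p\<le>degree w. coeff w p * complete_hom n p lam)"
proof -
  have key: "pair_fps (fps_X ^ k * \<phi>) (monom 1 k * w) = pair_fps \<phi> w" for k \<phi>
  proof (induction k)
    case (Suc k)
    have "monom 1 (Suc k) * w = pCons 0 (monom 1 k * w)" by (simp add: monom_Suc)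
    then show ?case using Suc by (simp add: pair_fps_X_mult mult.assoc)
  qed (simp flip: one_pCons add: monom_0)
  show ?thesis
    unfolding ddiff_def by (simp add: key) (simp add: pair_fps_def fps_nth_hfps_complete_hom)
qed

text \<open>Only the constant term 1 of \<open>hfps\<close> is reached. Together with
  \<open>coeff_fdiff_iter\<close> this evaluates the predicted values for constant f.\<close>

lemma ddiff_top:
  assumes "size U = Suc s" "degree p \<le> s"
  shows "ddiff U p = coeff p s"
proof -
  have h0: "fps_nth (hfps U) 0 = 1"
    by (induction U) (simp_all add: hfps_def)
  have "ddiff U p = (\<Sum>k\<le>s. coeff p k * fps_nth (fps_X ^ s * hfps U) k)"
    unfolding ddiff_def using assms by (simp add: pair_fps_bound)
  also have "\<dots> = (\<Sum>k\<le>s. if k = s then coeff p k else 0)"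
    by (rule sum.cong) (auto simp: fps_X_power_mult_nth h0)
  finally show ?thesis by simp
qed

lemma coeff_fdiff_iter: "degree p \<le> s \<Longrightarrow> coeff ((fdiff ^^ s) p) 0 = fact s * coeff p s"
proof (induction s arbitrary: p)
  case (Suc s)
  have "coeff ((fdiff ^^ s) (fdiff p)) 0 = fact s * coeff (fdiff p) s"
    using Suc fdiff_coeff[of p s] by simp
  then show ?case
    using fdiff_coeff[of p s] Suc.prems by (simp add: funpow_swap1 algebra_simps)
qed simp

section \<open>Moments of the sphere and cubature\<close>

text \<open>Evaluations at D + 1 distinct nodes span all functionals on polynomials of degree at
  most D; \<open>c q\<close> is the desired functional applied to the Lagrange polynomial
  \<open>L q\<close>. Nodes starting at 1 keep the normalizing factor in
  \<open>cubature_exists\<close> nonzero.\<close>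

lemma interpolation_weights:
  fixes m :: "nat \<Rightarrow> complex"
  shows "\<exists>c. \<forall>a\<le>D. (\<Sum>q\<in>{1..Suc D}. c q * of_nat q ^ a) = m a"
proof -
  define L :: "nat \<Rightarrow> complex poly" where
    "L q = (\<Prod>r\<in>{1..Suc D} - {q}. smult (1 / (of_nat q - of_nat r)) [:- of_nat r, 1:])" for q
  have degL: "degree (L q) \<le> D" if "q \<in> {1..Suc D}" for q
  proof -
    have "degree (L q) \<le> sum (degree \<circ> (\<lambda>r. smult (1 / (of_nat q - of_nat r)) [:- of_nat r, 1::complex:])) ({1..Suc D} - {q})"
      unfolding L_def by (rule degree_prod_sum_le) simp
    also have "\<dots> \<le> (\<Sum>r\<in>{1..Suc D} - {q}. 1)"
      by (rule sum_mono) (simp add: degree_pCons_le)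
    also have "\<dots> = D" using that by simp
    finally show ?thesis .
  qed
  have L0: "poly (L q) (of_nat r) = (if r = q then 1 else 0)"
    if "q \<in> {1..Suc D}" "r \<in> {1..Suc D}" for q r
  proof (cases "r = q")
    case True
    have "poly (L q) (of_nat q) = (\<Prod>r\<in>{1..Suc D} - {q}. 1)"
      unfolding L_def poly_prod
    proof (rule prod.cong)
      fix r assume "r \<in> {1..Suc D} - {q}"
      then have "(of_nat q :: complex) - of_nat r \<noteq> 0" by simp
      then show "poly (smult (1 / (of_nat q - of_nat r)) [:- of_nat r, 1:]) (of_nat q :: complex) = 1"
        by (simp add: diff_divide_distrib[symmetric])
    qed simp
    then show ?thesis using True by simp
  next
    case False
    then have "poly (smult (1 / (of_nat q - of_nat r)) [:- of_nat r, 1:]) (of_nat r :: complex) = 0"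
      by simp
    moreover have "r \<in> {1..Suc D} - {q}" using False that by simp
    ultimately have "poly (L q) (of_nat r) = 0"
      unfolding L_def poly_prod by (intro prod_zero) (auto intro!: bexI[of _ r])
    then show ?thesis using False by simp
  qed
  define c where "c q = (\<Sum>k\<le>D. coeff (L q) k * m k)" for q
  have "(\<Sum>q\<in>{1..Suc D}. c q * of_nat q ^ a) = m a" if a: "a \<le> D" for a
  proof -
    have "(\<Sum>q\<in>{1..Suc D}. smult (of_nat q ^ a) (L q)) = monom 1 a"
    proof (rule poly_eqI_degree[of "of_nat ` {1..Suc D}"])
      fix x :: complex assume "x \<in> of_nat ` {1..Suc D}"
      then obtain r where r: "r \<in> {1..Suc D}" "x = of_nat r" by blast
      have "poly (\<Sum>q\<in>{1..Suc D}. smult (of_nat q ^ a) (L q)) x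
          = (\<Sum>q\<in>{1..Suc D}. if r = q then of_nat q ^ a else 0)"
        unfolding poly_sum poly_smult r(2) using r(1) by (intro sum.cong) (auto simp: L0)
      also have "\<dots> = of_nat r ^ a" using r(1) by simp
      finally show "poly (\<Sum>q\<in>{1..Suc D}. smult (of_nat q ^ a) (L q)) x = poly (monom 1 a) x"
        by (simp add: poly_monom r(2))
    next
      have card: "card ((of_nat :: nat \<Rightarrow> complex) ` {1..Suc D}) = Suc D"
        by (subst card_image) (auto simp: inj_on_def)
      have "degree (\<Sum>q\<in>{1..Suc D}. smult (of_nat q ^ a) (L q)) \<le> D"
        by (rule degree_sum_le) (auto intro: order.trans[OF degree_smult_le] degL)
      then show "degree (\<Sum>q\<in>{1..Suc D}. smult (of_nat q ^ a) (L q)) < card ((of_nat :: nat \<Rightarrow> complex) ` {1..Suc D})"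
        using card by simp
      show "degree (monom 1 a :: complex poly) < card ((of_nat :: nat \<Rightarrow> complex) ` {1..Suc D})"
        using card a by (simp add: degree_monom_eq)
    qed
    then have co: "(\<Sum>q\<in>{1..Suc D}. of_nat q ^ a * coeff (L q) k) = (if k = a then 1 else 0)" for k
      by (metis (no_types, lifting) coeff_monom coeff_smult coeff_sum sum.cong)
    have "(\<Sum>q\<in>{1..Suc D}. c q * of_nat q ^ a)
        = (\<Sum>k\<le>D. (\<Sum>q\<in>{1..Suc D}. of_nat q ^ a * coeff (L q) k) * m k)"
      unfolding c_def sum_distrib_right by (subst sum.swap) (simp add: mult_ac)
    also have "\<dots> = (\<Sum>k\<le>D. if k = a then m k else 0)"
      unfolding co by (rule sum.cong) auto
    also have "\<dots> = m a" using a by simp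
    finally show ?thesis .
  qed
  then show ?thesis by blast
qed

lemma interpolation_weights2:
  fixes m :: "nat \<Rightarrow> nat \<Rightarrow> complex"
  shows "\<exists>c. \<forall>a\<le>D. \<forall>b\<le>D.
    (\<Sum>x\<in>{1..Suc D} \<times> {1..Suc D}. c x * (of_nat (fst x) ^ a * of_nat (snd x) ^ b)) = m a b"
proof -
  have "\<forall>b. \<exists>c. \<forall>a\<le>D. (\<Sum>q\<in>{1..Suc D}. c q * of_nat q ^ a) = m a b"
    by (intro allI interpolation_weights)
  then obtain c where c: "\<And>a b. a \<le> D \<Longrightarrow> (\<Sum>q\<in>{1..Suc D}. c b q * of_nat q ^ a) = m a b"
    by metis
  have "\<forall>p. \<exists>d. \<forall>b\<le>D. (\<Sum>q\<in>{1..Suc D}. d q * of_nat q ^ b) = c b p"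
    by (intro allI interpolation_weights)
  then obtain d where d: "\<And>b p. b \<le> D \<Longrightarrow> (\<Sum>q\<in>{1..Suc D}. d p q * of_nat q ^ b) = c b p"
    by metis
  have "(\<Sum>x\<in>{1..Suc D} \<times> {1..Suc D}. d (fst x) (snd x) * (of_nat (fst x) ^ a * of_nat (snd x) ^ b)) = m a b"
    if "a \<le> D" "b \<le> D" for a b
  proof -
    have "(\<Sum>x\<in>{1..Suc D} \<times> {1..Suc D}. d (fst x) (snd x) * (of_nat (fst x) ^ a * of_nat (snd x) ^ b))
        = (\<Sum>p\<in>{1..Suc D}. \<Sum>q\<in>{1..Suc D}. d p q * (of_nat p ^ a * of_nat q ^ b))"
      unfolding sum.cartesian_product case_prod_beta ..
    also have "\<dots> = (\<Sum>p\<in>{1..Suc D}. (\<Sum>q\<in>{1..Suc D}. d p q * of_nat q ^ b) * of_nat p ^ a)"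
      unfolding sum_distrib_right by (intro sum.cong refl) (simp only: mult_ac)
    also have "\<dots> = m a b" using that by (simp only: d c)
    finally show ?thesis .
  qed
  then show ?thesis by (intro exI[of _ "\<lambda>x. d (fst x) (snd x)"]) blast
qed

section \<open>Moments of the unit sphere and their exact cubature\<close>

definition vmono :: "(nat \<Rightarrow> complex) \<Rightarrow> nat multiset \<Rightarrow> complex" where
  "vmono v A = (\<Prod>i\<in>#A. v i)"

lemma vmono_simps [simp]: "vmono v {#} = 1" "vmono v (add_mset i A) = v i * vmono v A"
  "vmono v (A + B) = vmono v A * vmono v B"
  by (simp_all add: vmono_def)

lemma vmono_altdef:
  assumes "set_mset A \<subseteq> {..<n}"
  shows "vmono v A = (\<Prod>i<n. v i ^ count A i)"
  unfolding vmono_def image_prod_mset_multiplicity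
  by (rule prod.mono_neutral_left) (use assms in \<open>auto simp: not_in_iff\<close>)

definition mfact :: "nat \<Rightarrow> nat multiset \<Rightarrow> complex" where
  "mfact n A = (\<Prod>i<n. fact (count A i))"

text \<open>The integral of v^A w^B over the unit sphere of C^n with total mass 1, where w is the
  complex conjugate of v.\<close>

definition moment :: "nat \<Rightarrow> nat multiset \<Rightarrow> nat multiset \<Rightarrow> complex" where
  "moment n A B = (if A = B then mfact n A / pochhammer (of_nat n) (size A) else 0)"

lemma moment_sym: "moment n A B = moment n B A"
  by (simp add: moment_def)

lemma pochhammer_nat_nz: "n \<ge> 1 \<Longrightarrow> pochhammer (of_nat n :: complex) d \<noteq> 0"
proof -
  assume "n \<ge> 1"
  then have "pochhammer n d > 0" by (intro pochhammer_pos) simp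
  then show ?thesis by (metis less_numeral_extra(3) of_nat_eq_0_iff pochhammer_of_nat)
qed

lemma mfact_add_mset:
  assumes "i < n"
  shows "mfact n (add_mset i A) = of_nat (Suc (count A i)) * mfact n A"
proof -
  have "mfact n (add_mset i A)
      = (\<Prod>j<n. (if j = i then of_nat (Suc (count A i)) else 1) * fact (count A j))"
    unfolding mfact_def by (rule prod.cong) auto
  also have "\<dots> = (\<Prod>j<n. if j = i then of_nat (Suc (count A i)) else 1) * mfact n A"
    by (simp add: prod.distrib mfact_def)
  also have "(\<Prod>j<n. if j = i then of_nat (Suc (count A i)) else 1 :: complex) = of_nat (Suc (count A i))"
    using assms by (subst prod.delta) auto
  finally show ?thesis .
qed

text \<open>Integration by parts on the sphere: up to the factor n + size B, multiplication by w_b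
  acts as the derivative in v_b.\<close>

lemma moment_Wick:
  assumes "n \<ge> 1" "b < n" "size A = Suc (size B)"
  shows "of_nat (n + size B) * moment n A (add_mset b B) = of_nat (count A b) * moment n (A - {#b#}) B"
proof (cases "A = add_mset b B")
  case True
  have "pochhammer (of_nat n :: complex) (Suc (size B)) = pochhammer (of_nat n) (size B) * of_nat (n + size B)"
    by (simp add: pochhammer_Suc)
  moreover have "of_nat (n + size B) \<noteq> (0::complex)" using assms(1) by (simp del: of_nat_add)
  ultimately show ?thesis
    using True assms(2) by (simp add: moment_def mfact_add_mset del: of_nat_add of_nat_Suc)
next
  case False
  then have "b \<notin># A \<or> A - {#b#} \<noteq> B" by (metis insert_DiffM)
  then show ?thesis using False by (auto simp: moment_def not_in_iff)
qed

text \<open>Compatibility of the moments with v . w = 1; it leads from degree d + 1 down to degree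
  d.\<close>

lemma moment_contract:
  assumes "n \<ge> 1" "set_mset A \<subseteq> {..<n}"
  shows "(\<Sum>i<n. moment n (add_mset i A) (add_mset i B)) = moment n A B"
proof (cases "A = B")
  case True
  have "(\<Sum>i<n. of_nat (count A i)) = (of_nat (\<Sum>i<n. count A i) :: complex)" by simp
  also have "(\<Sum>i<n. count A i) = size A"
    unfolding size_multiset_overloaded_eq
    by (rule sum.mono_neutral_right) (use assms in \<open>auto simp: not_in_iff\<close>)
  finally have s: "(\<Sum>i<n. of_nat (Suc (count A i))) = (of_nat (n + size A) :: complex)"
    by (simp add: sum.distrib)
  have "of_nat (n + size A) \<noteq> (0::complex)" using assms(1) by (simp del: of_nat_add)
  have "(\<Sum>i<n. moment n (add_mset i A) (add_mset i B))
    = (\<Sum>i<n. of_nat (Suc (count A i)) * (mfact n A / pochhammer (of_nat n) (Suc (size A))))"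
    using True by (intro sum.cong) (simp_all add: moment_def mfact_add_mset del: of_nat_Suc)
  also have "\<dots> = of_nat (n + size A) * (mfact n A / pochhammer (of_nat n) (Suc (size A)))"
    by (simp only: s sum_distrib_right[symmetric])
  also have "\<dots> = moment n A B"
    using True \<open>of_nat (n + size A) \<noteq> (0::complex)\<close> by (simp add: moment_def pochhammer_Suc)
  finally show ?thesis .
qed (simp add: moment_def)

text \<open>An algebraic substitute for the sphere: complex weights, and \<open>w p\<close> in the
  role of the conjugate of \<open>v p\<close>. Moments are prescribed only for equally many factors
  v and w, the only ones that occur in averages of rank-one powers.\<close>

locale cubature =
  fixes n D :: nat and K :: "'p set" and c :: "'p \<Rightarrow> complex" and v w :: "'p \<Rightarrow> nat \<Rightarrow> complex"
  assumes n_pos: "n \<ge> 1" and finite_K: "finite K"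
    and normalized: "p \<in> K \<Longrightarrow> (\<Sum>i<n. v p i * w p i) = 1"
    and moments: "\<lbrakk>set_mset A \<subseteq> {..<n}; set_mset B \<subseteq> {..<n}; size A = size B; size A \<le> D\<rbrakk> \<Longrightarrow>
      (\<Sum>p\<in>K. c p * (vmono (v p) A * vmono (w p) B)) = moment n A B"

text \<open>Inserting 1 = v . w raises the degree, so exactness in degree D is inherited by all
  lower degrees.\<close>

lemma cubature_moments_degree:
  assumes n: "n \<ge> 1" and N: "\<And>p. p \<in> K \<Longrightarrow> (\<Sum>i<n. v p i * w p i) = 1"
    and top: "\<And>A B. \<lbrakk>set_mset A \<subseteq> {..<n}; set_mset B \<subseteq> {..<n}; size A = D; size B = D\<rbrakk> \<Longrightarrow>
      (\<Sum>p\<in>K. c p * (vmono (v p) A * vmono (w p) B)) = moment n A B"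
    and "set_mset A \<subseteq> {..<n}" "set_mset B \<subseteq> {..<n}" "size A = size B" "size A \<le> D"
  shows "(\<Sum>p\<in>K. c p * (vmono (v p) A * vmono (w p) B)) = moment n A B"
  using assms(4-)
proof (induction "D - size A" arbitrary: A B)
  case 0
  then show ?case using top by simp
next
  case (Suc k)
  have IH: "(\<Sum>p\<in>K. c p * (vmono (v p) (add_mset i A) * vmono (w p) (add_mset i B)))
      = moment n (add_mset i A) (add_mset i B)" if "i < n" for i
    using that Suc.prems Suc.hyps(2) by (intro Suc.hyps(1)) auto
  have "(\<Sum>p\<in>K. c p * (vmono (v p) A * vmono (w p) B))
      = (\<Sum>p\<in>K. c p * (vmono (v p) A * vmono (w p) B) * (\<Sum>i<n. v p i * w p i))"
    using N by simp
  also have "\<dots> = (\<Sum>i<n. \<Sum>p\<in>K. c p * (vmono (v p) (add_mset i A) * vmono (w p) (add_mset i B)))"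
    unfolding sum_distrib_left by (subst sum.swap) (simp add: mult_ac)
  also have "\<dots> = moment n A B" using IH moment_contract[OF n] Suc.prems by simp
  finally show ?case .
qed

text \<open>The sphere is reached from a Gaussian: \<open>d\<close> imitates a complex Gaussian
  variable with moments a!, and its n-fold product has the moments \<open>mfact\<close>. Dividing v
  by \<open>N\<close>, the value of v . w before normalization, makes v . w = 1; the weight
  \<open>N g ^ D\<close> undoes this in degree D, and the Pochhammer symbol is the ratio of Gaussian
  and spherical moments.\<close>

lemma cubature_exists:
  assumes "n \<ge> 1"
  shows "\<exists>K c v w. cubature n D (K :: (nat \<Rightarrow> nat \<times> nat) set) c v w"
proof -
  let ?S = "{1..Suc D} \<times> {1..Suc D}"
  obtain d where d: "\<And>a b. \<lbrakk>a \<le> D; b \<le> D\<rbrakk> \<Longrightarrow>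
      (\<Sum>x\<in>?S. d x * (of_nat (fst x) ^ a * of_nat (snd x) ^ b)) = (if a = b then fact a else 0 :: complex)"
    using interpolation_weights2[of D "\<lambda>a b. if a = b then fact a else 0"] by blast
  define K where "K = PiE {..<n} (\<lambda>_. ?S)"
  define N :: "(nat \<Rightarrow> nat \<times> nat) \<Rightarrow> complex" where "N g = of_nat (\<Sum>i<n. fst (g i) * snd (g i))" for g
  define v :: "(nat \<Rightarrow> nat \<times> nat) \<Rightarrow> nat \<Rightarrow> complex" where "v g i = of_nat (fst (g i)) / N g" for g i
  define w :: "(nat \<Rightarrow> nat \<times> nat) \<Rightarrow> nat \<Rightarrow> complex" where "w g i = of_nat (snd (g i))" for g i
  define c where "c g = (\<Prod>i<n. d (g i)) * N g ^ D / pochhammer (of_nat n) D" for g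
  have fin: "finite K" by (auto simp: K_def intro: finite_PiE)
  have Nnz: "N g \<noteq> 0" if "g \<in> K" for g
  proof -
    have "0 \<in> {..<n}" using assms by simp
    then have "g 0 \<in> ?S" using that unfolding K_def by (rule PiE_mem[rotated])
    then have "fst (g 0) > 0 \<and> snd (g 0) > 0" by (cases "g 0") simp
    then have "fst (g 0) * snd (g 0) > 0" by simp
    moreover have "fst (g 0) * snd (g 0) \<le> (\<Sum>i<n. fst (g i) * snd (g i))"
      using assms by (intro member_le_sum[of 0 _ "\<lambda>i. fst (g i) * snd (g i)"]) auto
    ultimately have "(\<Sum>i<n. fst (g i) * snd (g i)) \<noteq> 0" by linarith
    then show ?thesis unfolding N_def of_nat_eq_0_iff .
  qed
  have norm: "(\<Sum>i<n. v g i * w g i) = 1" if "g \<in> K" for g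
  proof -
    have "(\<Sum>i<n. v g i * w g i) = (\<Sum>i<n. of_nat (fst (g i) * snd (g i))) / N g"
      by (simp add: v_def w_def sum_divide_distrib)
    also have "(\<Sum>i<n. of_nat (fst (g i) * snd (g i))) = N g"
      unfolding N_def of_nat_sum ..
    finally show ?thesis using Nnz[OF that] by simp
  qed
  have top: "(\<Sum>g\<in>K. c g * (vmono (v g) A * vmono (w g) B)) = moment n A B"
    if A: "set_mset A \<subseteq> {..<n}" and B: "set_mset B \<subseteq> {..<n}" and s: "size A = D" "size B = D" for A B
  proof -
    have cnt: "count A i \<le> D" "count B i \<le> D" for i
      using count_le_size[of A i] count_le_size[of B i] s by simp_all
    have "(\<Sum>g\<in>K. c g * (vmono (v g) A * vmono (w g) B))
      = (\<Sum>g\<in>K. (\<Prod>i<n. d (g i) * (of_nat (fst (g i)) ^ count A i * of_nat (snd (g i)) ^ count B i)))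
          / pochhammer (of_nat n) D"
      unfolding sum_divide_distrib
    proof (rule sum.cong)
      fix g assume g: "g \<in> K"
      have "vmono (v g) A = vmono (\<lambda>i. of_nat (fst (g i))) A / N g ^ size A"
        by (simp add: vmono_def v_def prod_mset.distrib divide_inverse power_inverse)
      then have "c g * (vmono (v g) A * vmono (w g) B)
        = (\<Prod>i<n. d (g i)) * (vmono (\<lambda>i. of_nat (fst (g i))) A * vmono (\<lambda>i. of_nat (snd (g i))) B) / pochhammer (of_nat n) D"
        using Nnz[OF g] s by (simp add: c_def w_def[abs_def])
      then show "c g * (vmono (v g) A * vmono (w g) B)
        = (\<Prod>i<n. d (g i) * (of_nat (fst (g i)) ^ count A i * of_nat (snd (g i)) ^ count B i)) / pochhammer (of_nat n) D"
        by (simp add: vmono_altdef[OF A] vmono_altdef[OF B] prod.distrib)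
    qed simp
    also have "(\<Sum>g\<in>K. (\<Prod>i<n. d (g i) * (of_nat (fst (g i)) ^ count A i * of_nat (snd (g i)) ^ count B i)))
        = (\<Prod>i<n. \<Sum>x\<in>?S. d x * (of_nat (fst x) ^ count A i * of_nat (snd x) ^ count B i))"
      unfolding K_def by (rule prod_sum_PiE[symmetric]) auto
    also have "\<dots> = (\<Prod>i<n. if count A i = count B i then fact (count A i) else 0)"
      using cnt by (simp only: d)
    also have "\<dots> = (if A = B then mfact n A else 0)"
    proof (cases "A = B")
      case False
      then obtain i where i: "count A i \<noteq> count B i" by (metis multiset_eqI)
      then have "i < n" using A B by (metis count_eq_zero_iff lessThan_iff subsetD)
      then show ?thesis using False i by (auto intro!: prod_zero bexI[of _ i])
    qed (simp add: mfact_def)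
    finally show ?thesis using s by (simp add: moment_def)
  qed
  have "cubature n D K c v w"
  proof
    fix A B :: "nat multiset"
    assume "set_mset A \<subseteq> {..<n}" "set_mset B \<subseteq> {..<n}" "size A = size B" "size A \<le> D"
    then show "(\<Sum>p\<in>K. c p * (vmono (v p) A * vmono (w p) B)) = moment n A B"
      by (intro cubature_moments_degree[OF assms norm top]) auto
  qed (use assms fin norm in auto)
  then show ?thesis by blast
qed

section \<open>Scalars, congruences and averages of rank-one elements\<close>

text \<open>A central copy of the complex numbers. The instances are the free algebra
  \<open>fr\<close> and the complex numbers themselves, so that the same averages serve for
  operators and for polynomial functions.\<close>

locale scalars =
  fixes sc :: "complex \<Rightarrow> 'a::ring_1"
  assumes sc_add: "sc (a + b) = sc a + sc b"
    and sc_mult: "sc (a * b) = sc a * sc b"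
    and sc_1 [simp]: "sc 1 = 1"
    and sc_commute: "sc a * x = x * sc a"
begin

lemma sc_0 [simp]: "sc 0 = 0"
  using sc_add[of 0 0] by simp

lemma sc_uminus: "sc (- a) = - sc a"
  using sc_add[of a "- a"] by (simp add: eq_neg_iff_add_eq_0 add.commute)

lemma sc_diff: "sc (a - b) = sc a - sc b"
  using sc_add[of a "- b"] by (simp add: sc_uminus)

lemma sc_sum: "sc (sum f A) = (\<Sum>x\<in>A. sc (f x))"
  by (induction A rule: infinite_finite_induct) (auto simp: sc_add)

lemma sc_of_nat: "sc (of_nat k) = of_nat k"
  by (induction k) (auto simp: sc_add)

lemma sc_left_commute: "x * (sc a * y) = sc a * (x * y)"
  by (metis mult.assoc sc_commute)

lemma sc_mult_left: "sc a * (sc b * x) = sc (a * b) * x"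
  by (simp add: sc_mult mult.assoc)

lemma sc_word: "sc a * x * (sc b * y) = sc (a * b) * (x * y)"
  by (metis mult.assoc sc_left_commute sc_mult)

definition pev :: "complex poly \<Rightarrow> 'a \<Rightarrow> 'a" where
  "pev p a = fold_coeffs (\<lambda>c r. sc c + a * r) p 0"

lemma pev_0 [simp]: "pev 0 a = 0"
  by (simp add: pev_def)

lemma pev_pCons [simp]: "pev (pCons c p) a = sc c + a * pev p a"
  by (cases "p = 0 \<and> c = 0") (auto simp: pev_def)

lemma pev_add: "pev (p + q) a = pev p a + pev q a"
proof (induction p arbitrary: q)
  case (pCons c p)
  obtain d r where "q = pCons d r" by (cases q)
  then show ?case by (simp add: sc_add pCons.IH distrib_left add_ac)
qed simp

lemma pev_smult: "pev (smult c p) a = sc c * pev p a"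
  by (induction p) (simp_all add: distrib_left sc_mult sc_left_commute)

lemma pev_uminus: "pev (- p) a = - pev p a"
  using pev_add[of p "- p" a] by (simp add: eq_neg_iff_add_eq_0 add.commute)

lemma pev_diff: "pev (p - q) a = pev p a - pev q a"
  using pev_add[of p "- q" a] by (simp add: pev_uminus)

lemma pev_monom: "pev (monom c k) a = sc c * a ^ k"
  by (induction k) (simp_all add: monom_0 monom_Suc sc_left_commute)

lemma pev_commute: "a * pev p a = pev p a * a"
proof (induction p)
  case (pCons c p)
  have "a * pev (pCons c p) a = a * sc c + a * (a * pev p a)" by (simp add: distrib_left)
  also have "\<dots> = sc c * a + (a * pev p a) * a"
    unfolding pCons.IH by (simp add: sc_commute mult.assoc[symmetric] pCons.IH)
  finally show ?case by (simp add: distrib_right)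
qed simp

lemma pev_pcompose_shift_pCons:
  "pev (pcompose (pCons c p) [:s, 1:]) a = sc c + (a + sc s) * pev (pcompose p [:s, 1:]) a"
  by (simp add: pcompose_pCons pev_add pev_smult algebra_simps)

lemma pev_shift_monom: "pev (pcompose (monom 1 k) [:s, 1:]) a = (a + sc s) ^ k"
  by (induction k) (simp_all add: monom_0 monom_Suc pev_pcompose_shift_pCons)

end

text \<open>Equations in a quotient algebra are stated as congruences modulo \<open>J\<close>, and
  all elements stay in the free ring.\<close>

locale two_sided = scalars sc for sc :: "complex \<Rightarrow> 'a::ring_1" +
  fixes J :: "'a set"
  assumes J_0: "0 \<in> J" and J_add: "\<lbrakk>a \<in> J; b \<in> J\<rbrakk> \<Longrightarrow> a + b \<in> J"
    and J_left: "a \<in> J \<Longrightarrow> x * a \<in> J" and J_right: "a \<in> J \<Longrightarrow> a * x \<in> J"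
begin

definition cg :: "'a \<Rightarrow> 'a \<Rightarrow> bool"  (infix "\<approx>" 50) where
  "a \<approx> b \<longleftrightarrow> a - b \<in> J"

lemma J_uminus: "a \<in> J \<Longrightarrow> - a \<in> J"
  using J_left[of a "- 1"] by simp

lemma J_diff: "\<lbrakk>a \<in> J; b \<in> J\<rbrakk> \<Longrightarrow> a - b \<in> J"
  using J_add[of a "- b"] J_uminus[of b] by simp

lemma J_sum: "(\<And>x. x \<in> A \<Longrightarrow> f x \<in> J) \<Longrightarrow> sum f A \<in> J"
  by (induction A rule: infinite_finite_induct) (auto simp: J_0 J_add)

lemma cg_refl [simp]: "a \<approx> a"
  by (simp add: cg_def J_0)

lemma cg_sym: "a \<approx> b \<Longrightarrow> b \<approx> a"
  using J_uminus[of "a - b"] by (simp add: cg_def)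

lemma cg_trans [trans]: "a \<approx> b \<Longrightarrow> b \<approx> c \<Longrightarrow> a \<approx> c"
  using J_add[of "a - b" "b - c"] by (simp add: cg_def)

lemma cg_eq_trans [trans]: "a \<approx> b \<Longrightarrow> b = c \<Longrightarrow> a \<approx> c"
  by simp

lemma eq_cg_trans [trans]: "a = b \<Longrightarrow> b \<approx> c \<Longrightarrow> a \<approx> c"
  by simp

lemma cg_add: "a \<approx> b \<Longrightarrow> c \<approx> d \<Longrightarrow> a + c \<approx> b + d"
  using J_add[of "a - b" "c - d"] by (simp add: cg_def algebra_simps)

lemma cg_diff: "a \<approx> b \<Longrightarrow> c \<approx> d \<Longrightarrow> a - c \<approx> b - d"
  using J_diff[of "a - b" "c - d"] by (simp add: cg_def algebra_simps)

lemma cg_left: "a \<approx> b \<Longrightarrow> x * a \<approx> x * b"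
  using J_left[of "a - b" x] by (simp add: cg_def algebra_simps)

lemma cg_right: "a \<approx> b \<Longrightarrow> a * x \<approx> b * x"
  using J_right[of "a - b" x] by (simp add: cg_def algebra_simps)

lemma cg_sum: "(\<And>x. x \<in> A \<Longrightarrow> f x \<approx> g x) \<Longrightarrow> sum f A \<approx> sum g A"
  using J_sum[of A "\<lambda>x. f x - g x"] by (simp add: cg_def sum_subtractf)

text \<open>A shift relation passes from \<open>a\<close> to all polynomials in \<open>a\<close>.
  For \<open>s = -1\<close> it produces the polynomial f(z - 1), for \<open>s = 0\<close> plain
  commutation.\<close>

lemma pev_intertwine_left:
  assumes "a * z \<approx> z * (a + sc s)"
  shows "pev p a * z \<approx> z * pev (pcompose p [:s, 1:]) a"
proof (induction p)
  case (pCons c p)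
  have "pev (pCons c p) a * z = sc c * z + a * (pev p a * z)"
    by (simp add: algebra_simps)
  also have "\<dots> \<approx> sc c * z + a * (z * pev (pcompose p [:s, 1:]) a)"
    by (intro cg_add cg_left pCons cg_refl)
  also have "\<dots> = sc c * z + (a * z) * pev (pcompose p [:s, 1:]) a"
    by (simp add: mult.assoc)
  also have "\<dots> \<approx> sc c * z + (z * (a + sc s)) * pev (pcompose p [:s, 1:]) a"
    by (intro cg_add cg_right assms cg_refl)
  also have "\<dots> = z * pev (pcompose (pCons c p) [:s, 1:]) a"
    unfolding pev_pcompose_shift_pCons by (simp add: algebra_simps sc_commute)
  finally show ?case .
qed simp

lemma pev_intertwine_right:
  assumes "z * a \<approx> (a + sc s) * z"
  shows "z * pev p a \<approx> pev (pcompose p [:s, 1:]) a * z"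
proof (induction p)
  case (pCons c p)
  have "z * pev (pCons c p) a = sc c * z + (z * a) * pev p a"
    by (simp add: algebra_simps sc_commute)
  also have "\<dots> \<approx> sc c * z + ((a + sc s) * z) * pev p a"
    by (intro cg_add cg_right assms cg_refl)
  also have "\<dots> = sc c * z + (a + sc s) * (z * pev p a)"
    by (simp add: mult.assoc)
  also have "\<dots> \<approx> sc c * z + (a + sc s) * (pev (pcompose p [:s, 1:]) a * z)"
    by (intro cg_add cg_left pCons cg_refl)
  also have "\<dots> = pev (pcompose (pCons c p) [:s, 1:]) a * z"
    unfolding pev_pcompose_shift_pCons by (simp add: algebra_simps)
  finally show ?case .
qed simp

end

section \<open>Powers of rank-one elements as sums over words\<close>

definition pair_lists :: "nat \<Rightarrow> nat \<Rightarrow> (nat \<times> nat) list set" where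
  "pair_lists n m = {xs. set xs \<subseteq> {..<n} \<times> {..<n} \<and> length xs = m}"

lemma finite_pair_lists [simp]: "finite (pair_lists n m)"
  unfolding pair_lists_def by (rule finite_lists_length_eq) auto

lemma sum_pair_lists_0: "sum F (pair_lists n 0) = F []"
  by (simp add: pair_lists_def conj_commute cong: conj_cong)

lemma sum_pair_lists_Suc:
  fixes F :: "(nat \<times> nat) list \<Rightarrow> 'b::comm_monoid_add"
  shows "sum F (pair_lists n (Suc m)) = (\<Sum>i<n. \<Sum>j<n. \<Sum>xs\<in>pair_lists n m. F ((i, j) # xs))"
proof -
  have "sum F (pair_lists n (Suc m)) = (\<Sum>(x, xs)\<in>({..<n} \<times> {..<n}) \<times> pair_lists n m. F (x # xs))"
    by (rule sum.reindex_bij_witness[of _ "\<lambda>(x, xs). x # xs" "\<lambda>xs. (hd xs, tl xs)"])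
       (auto simp: pair_lists_def length_Suc_conv)
  also have "\<dots> = (\<Sum>x\<in>{..<n} \<times> {..<n}. \<Sum>xs\<in>pair_lists n m. F (x # xs))"
    by (simp add: sum.cartesian_product)
  also have "\<dots> = (\<Sum>i<n. \<Sum>j<n. \<Sum>xs\<in>pair_lists n m. F ((i, j) # xs))"
  proof -
    have "(\<Sum>x\<in>{..<n} \<times> {..<n}. H x) = (\<Sum>i<n. \<Sum>j<n. H (i, j))" for H :: "nat \<times> nat \<Rightarrow> 'b"
      by (simp add: sum.cartesian_product case_prod_beta)
    then show ?thesis .
  qed
  finally show ?thesis .
qed

context scalars
begin

definition rank1 :: "nat \<Rightarrow> (nat \<Rightarrow> nat \<Rightarrow> 'a) \<Rightarrow> (nat \<Rightarrow> complex) \<Rightarrow> (nat \<Rightarrow> complex) \<Rightarrow> 'a" where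
  "rank1 n M v w = (\<Sum>i<n. \<Sum>j<n. sc (v i * w j) * M i j)"

definition lrow :: "nat \<Rightarrow> (nat \<Rightarrow> nat \<Rightarrow> 'a) \<Rightarrow> (nat \<Rightarrow> complex) \<Rightarrow> nat \<Rightarrow> 'a" where
  "lrow n M w b = (\<Sum>j<n. sc (w j) * M b j)"

text \<open>The product rule for the formal derivative of \<open>rank1 n M v w ^ m\<close> in
  \<open>v b\<close>, with noncommuting coefficients; \<open>lrow n M w b\<close> is the derivative
  of \<open>rank1\<close> itself.\<close>

primrec drank1 :: "nat \<Rightarrow> (nat \<Rightarrow> nat \<Rightarrow> 'a) \<Rightarrow> (nat \<Rightarrow> complex) \<Rightarrow> (nat \<Rightarrow> complex) \<Rightarrow> nat \<Rightarrow> nat \<Rightarrow> 'a" where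
  "drank1 n M v w b 0 = 0"
| "drank1 n M v w b (Suc m) = lrow n M w b * rank1 n M v w ^ m + rank1 n M v w * drank1 n M v w b m"

definition word :: "(nat \<Rightarrow> nat \<Rightarrow> 'a) \<Rightarrow> (nat \<times> nat) list \<Rightarrow> 'a" where
  "word M xs = prod_list (map (\<lambda>x. M (fst x) (snd x)) xs)"

lemma word_simps [simp]: "word M [] = 1" "word M ((i, j) # xs) = M i j * word M xs"
  by (simp_all add: word_def)

abbreviation rows :: "(nat \<times> nat) list \<Rightarrow> nat multiset" where "rows xs \<equiv> mset (map fst xs)"
abbreviation cols :: "(nat \<times> nat) list \<Rightarrow> nat multiset" where "cols xs \<equiv> mset (map snd xs)"

lemma rank1_power:
  "rank1 n M v w ^ m = (\<Sum>xs\<in>pair_lists n m. sc (vmono v (rows xs) * vmono w (cols xs)) * word M xs)"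
proof (induction m)
  case 0
  then show ?case by (simp add: sum_pair_lists_0)
next
  case (Suc m)
  have "rank1 n M v w ^ Suc m = (\<Sum>i<n. \<Sum>j<n. \<Sum>xs\<in>pair_lists n m.
      sc (v i * w j) * M i j * (sc (vmono v (rows xs) * vmono w (cols xs)) * word M xs))"
    unfolding power_Suc Suc by (simp only: rank1_def sum_distrib_right) (simp only: sum_distrib_left)
  then show ?case
    unfolding sum_pair_lists_Suc
    by (simp only: sc_word list.map fst_conv snd_conv mset.simps word_simps vmono_simps; simp only: mult_ac)
qed

text \<open>The derivative in v_b acts on the coefficient of each word separately: the monomial in v
  loses one factor v_b and is multiplied by its exponent.\<close>

lemma drank1_expand:
  assumes b: "b < n"
  shows "drank1 n M v w b m = (\<Sum>xs\<in>pair_lists n m.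
    sc (of_nat (count (rows xs) b) * vmono v (rows xs - {#b#}) * vmono w (cols xs)) * word M xs)"
proof (induction m)
  case 0
  then show ?case by (simp add: sum_pair_lists_0)
next
  case (Suc m)
  have co: "of_nat (count (add_mset i A) b) * vmono v (add_mset i A - {#b#})
      = (if i = b then vmono v A else 0) + v i * (of_nat (count A b) * vmono v (A - {#b#}))" for i A
  proof (cases "b \<in># A")
    case True
    then obtain C where "A = add_mset b C" by (metis insert_DiffM)
    then show ?thesis by (simp add: algebra_simps add_mset_commute)
  next
    case False
    then show ?thesis by (simp add: not_in_iff)
  qed
  have 1: "lrow n M w b * rank1 n M v w ^ m = (\<Sum>i<n. \<Sum>j<n. \<Sum>xs\<in>pair_lists n m.
      sc ((if i = b then vmono v (rows xs) else 0) * (w j * vmono w (cols xs))) * (M i j * word M xs))"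
  proof -
    have "(\<Sum>i<n. \<Sum>j<n. \<Sum>xs\<in>pair_lists n m.
      sc ((if i = b then vmono v (rows xs) else 0) * (w j * vmono w (cols xs))) * (M i j * word M xs))
      = (\<Sum>i<n. if i = b then \<Sum>j<n. \<Sum>xs\<in>pair_lists n m.
      sc (vmono v (rows xs) * (w j * vmono w (cols xs))) * (M b j * word M xs) else 0)"
      by (rule sum.cong) auto
    also have "\<dots> = (\<Sum>j<n. \<Sum>xs\<in>pair_lists n m.
      sc (vmono v (rows xs) * (w j * vmono w (cols xs))) * (M b j * word M xs))"
      using b by (simp add: sum.delta)
    also have "\<dots> = (\<Sum>j<n. \<Sum>xs\<in>pair_lists n m.
       sc (w j) * M b j * (sc (vmono v (rows xs) * vmono w (cols xs)) * word M xs))"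
      by (simp only: sc_word list.map fst_conv snd_conv mset.simps word_simps vmono_simps; simp only: mult_ac)
    also have "\<dots> = lrow n M w b * rank1 n M v w ^ m"
      unfolding rank1_power lrow_def by (simp only: sum_distrib_right) (simp only: sum_distrib_left)
    finally show ?thesis ..
  qed
  have 2: "rank1 n M v w * drank1 n M v w b m = (\<Sum>i<n. \<Sum>j<n. \<Sum>xs\<in>pair_lists n m.
      sc (v i * (of_nat (count (rows xs) b) * vmono v (rows xs - {#b#})) * (w j * vmono w (cols xs))) * (M i j * word M xs))"
  proof -
    have "rank1 n M v w * drank1 n M v w b m = (\<Sum>i<n. \<Sum>j<n. \<Sum>xs\<in>pair_lists n m.
      sc (v i * w j) * M i j * (sc (of_nat (count (rows xs) b) * vmono v (rows xs - {#b#}) * vmono w (cols xs)) * word M xs))"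
      unfolding Suc rank1_def by (simp only: sum_distrib_right) (simp only: sum_distrib_left)
    then show ?thesis
      by (simp only: sc_word list.map fst_conv snd_conv mset.simps word_simps vmono_simps; simp only: mult_ac)
  qed
  show ?case
    unfolding sum_pair_lists_Suc drank1.simps 1 2 sum.distrib[symmetric]
    by (intro sum.cong refl) (simp only: list.map fst_conv snd_conv mset.simps co word_simps vmono_simps
         distrib_right[symmetric] sc_add[symmetric])
qed

end

locale cubature_alg = scalars sc + cubature n D K c v w
  for sc :: "complex \<Rightarrow> 'a::ring_1" and n D and K :: "'p set" and c v w +
  fixes M :: "nat \<Rightarrow> nat \<Rightarrow> 'a"
begin

abbreviation EE :: "'p \<Rightarrow> 'a" where "EE p \<equiv> rank1 n M (v p) (w p)"

definition avg :: "('p \<Rightarrow> 'a) \<Rightarrow> 'a" where "avg F = (\<Sum>p\<in>K. sc (c p) * F p)"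

lemma avg_add: "avg (\<lambda>p. F p + H p) = avg F + avg H"
  by (simp add: avg_def algebra_simps sum.distrib)

lemma avg_diff: "avg (\<lambda>p. F p - H p) = avg F - avg H"
  by (simp add: avg_def algebra_simps sum_subtractf)

lemma avg_sc: "avg (\<lambda>p. sc a * F p) = sc a * avg F"
  unfolding avg_def sum_distrib_left by (rule sum.cong[OF refl]) (rule sc_left_commute[symmetric])

lemma avg_sum: "avg (\<lambda>p. \<Sum>x\<in>A. F x p) = (\<Sum>x\<in>A. avg (F x))"
  unfolding avg_def sum_distrib_left by (rule sum.swap)

lemma avg_right: "avg (\<lambda>p. F p * a) = avg F * a"
  by (simp add: avg_def sum_distrib_right mult.assoc)

lemma avg_left: "avg (\<lambda>p. a * F p) = a * avg F"
  by (simp add: avg_def sum_distrib_left sc_left_commute)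

lemma pair_lists_rows: "xs \<in> pair_lists n m \<Longrightarrow> set_mset (rows xs) \<subseteq> {..<n} \<and> set_mset (cols xs) \<subseteq> {..<n} \<and> length xs = m"
  by (auto simp: pair_lists_def)

lemma avg_power:
  assumes "set_mset A \<subseteq> {..<n}" "set_mset B \<subseteq> {..<n}" "size A = size B" "size A + m \<le> D"
  shows "avg (\<lambda>p. sc (vmono (v p) A * vmono (w p) B) * EE p ^ m)
    = (\<Sum>xs\<in>pair_lists n m. sc (moment n (A + rows xs) (B + cols xs)) * word M xs)"
proof -
  have "avg (\<lambda>p. sc (vmono (v p) A * vmono (w p) B) * EE p ^ m)
    = (\<Sum>xs\<in>pair_lists n m. sc (\<Sum>p\<in>K. c p * (vmono (v p) (A + rows xs) * vmono (w p) (B + cols xs))) * word M xs)"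
    unfolding avg_def rank1_power sum_distrib_left sc_sum sum_distrib_right
    by (subst sum.swap) (simp add: sc_mult_left mult_ac)
  also have "\<dots> = (\<Sum>xs\<in>pair_lists n m. sc (moment n (A + rows xs) (B + cols xs)) * word M xs)"
  proof (rule sum.cong[OF refl])
    fix xs assume "xs \<in> pair_lists n m"
    then have "(\<Sum>p\<in>K. c p * (vmono (v p) (A + rows xs) * vmono (w p) (B + cols xs))) = moment n (A + rows xs) (B + cols xs)"
      using assms pair_lists_rows[of xs m] by (intro moments) auto
    then show "sc (\<Sum>p\<in>K. c p * (vmono (v p) (A + rows xs) * vmono (w p) (B + cols xs))) * word M xs
       = sc (moment n (A + rows xs) (B + cols xs)) * word M xs" by simp
  qed
  finally show ?thesis .
qed

lemma avg_drank1:
  assumes "set_mset A \<subseteq> {..<n}" "set_mset B \<subseteq> {..<n}" "size A = Suc (size B)" "size B + m \<le> D" "b < n"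
  shows "avg (\<lambda>p. sc (vmono (v p) A * vmono (w p) B) * drank1 n M (v p) (w p) b m)
    = (\<Sum>xs\<in>pair_lists n m. sc (of_nat (count (rows xs) b) * moment n (A + (rows xs - {#b#})) (B + cols xs)) * word M xs)"
proof -
  have "avg (\<lambda>p. sc (vmono (v p) A * vmono (w p) B) * drank1 n M (v p) (w p) b m)
    = (\<Sum>xs\<in>pair_lists n m. sc (of_nat (count (rows xs) b) *
        (\<Sum>p\<in>K. c p * (vmono (v p) (A + (rows xs - {#b#})) * vmono (w p) (B + cols xs)))) * word M xs)"
    unfolding avg_def drank1_expand[OF assms(5)] sum_distrib_left sc_sum sum_distrib_right
    by (subst sum.swap) (simp add: sc_mult_left mult_ac)
  also have "\<dots> = (\<Sum>xs\<in>pair_lists n m. sc (of_nat (count (rows xs) b) * moment n (A + (rows xs - {#b#})) (B + cols xs)) * word M xs)"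
  proof (rule sum.cong[OF refl])
    fix xs assume xs: "xs \<in> pair_lists n m"
    show "sc (of_nat (count (rows xs) b) *
        (\<Sum>p\<in>K. c p * (vmono (v p) (A + (rows xs - {#b#})) * vmono (w p) (B + cols xs)))) * word M xs
       = sc (of_nat (count (rows xs) b) * moment n (A + (rows xs - {#b#})) (B + cols xs)) * word M xs"
    \<comment> \<open>If b does not occur, nothing is removed and the numbers of factors v and w
      differ, so \<open>moments\<close> does not apply; the count then makes the term zero.\<close>
    proof (cases "b \<in># rows xs")
      case True
      then have "size (rows xs) = Suc (size (rows xs - {#b#}))" by (metis size_Suc_Diff1)
      moreover have "set_mset (rows xs - {#b#}) \<subseteq> {..<n}"
        using pair_lists_rows[OF xs] by (meson in_diffD subset_iff)
      ultimately have "(\<Sum>p\<in>K. c p * (vmono (v p) (A + (rows xs - {#b#})) * vmono (w p) (B + cols xs))) = moment n (A + (rows xs - {#b#})) (B + cols xs)"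
        using assms pair_lists_rows[OF xs] by (intro moments) auto
      then show ?thesis by simp
    qed (simp only: not_in_iff of_nat_0 mult_zero_left)
  qed
  finally show ?thesis .
qed

text \<open>\<open>moment_Wick\<close> summed over words, that is, the integral of the
  v_b-derivative of v^A w^B e^m. The first summand differentiates e^m, the second the monomial
  v^A.\<close>

lemma avg_Wick:
  assumes "set_mset A \<subseteq> {..<n}" "set_mset B \<subseteq> {..<n}" "size A = Suc (size B)" "size A + m \<le> D" "b < n"
  shows "avg (\<lambda>p. sc (vmono (v p) A * vmono (w p) B) * drank1 n M (v p) (w p) b m)
     + sc (of_nat (count A b)) * avg (\<lambda>p. sc (vmono (v p) (A - {#b#}) * vmono (w p) B) * EE p ^ m)
    = sc (of_nat (n + size B + m)) * avg (\<lambda>p. sc (vmono (v p) A * vmono (w p) (add_mset b B)) * EE p ^ m)"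
proof -
  have 1: "sc (of_nat (count A b)) * avg (\<lambda>p. sc (vmono (v p) (A - {#b#}) * vmono (w p) B) * EE p ^ m)
    = (\<Sum>xs\<in>pair_lists n m. sc (of_nat (count A b) * moment n (A - {#b#} + rows xs) (B + cols xs)) * word M xs)"
  proof (cases "b \<in># A")
    case True
    then have "size A = Suc (size (A - {#b#}))" by (metis size_Suc_Diff1)
    then show ?thesis using assms
      by (subst avg_power) (auto dest: in_diffD simp: sum_distrib_left sc_mult_left)
  qed (simp add: not_in_iff)
  have 2: "avg (\<lambda>p. sc (vmono (v p) A * vmono (w p) (add_mset b B)) * EE p ^ m)
    = (\<Sum>xs\<in>pair_lists n m. sc (moment n (A + rows xs) (add_mset b B + cols xs)) * word M xs)"
    using assms by (intro avg_power) auto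
  have 3: "avg (\<lambda>p. sc (vmono (v p) A * vmono (w p) B) * drank1 n M (v p) (w p) b m)
    = (\<Sum>xs\<in>pair_lists n m. sc (of_nat (count (rows xs) b) * moment n (A + (rows xs - {#b#})) (B + cols xs)) * word M xs)"
    using assms by (intro avg_drank1) auto
  have "of_nat (count (rows xs) b) * moment n (A + (rows xs - {#b#})) (B + cols xs)
      + of_nat (count A b) * moment n (A - {#b#} + rows xs) (B + cols xs)
     = of_nat (n + size B + m) * moment n (A + rows xs) (add_mset b B + cols xs)"
    if xs: "xs \<in> pair_lists n m" for xs
  proof -
    have "of_nat (n + size (B + cols xs)) * moment n (A + rows xs) (add_mset b (B + cols xs))
        = of_nat (count (A + rows xs) b) * moment n (A + rows xs - {#b#}) (B + cols xs)"
      using pair_lists_rows[OF xs] assms n_pos by (intro moment_Wick) auto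
    \<comment> \<open>Truncated subtraction of b may be moved past a union only if b occurs in R;
      otherwise the count makes both sides vanish.\<close>
    moreover have "of_nat (count R b) * moment n (S + (R - {#b#})) C = of_nat (count R b) * moment n (S + R - {#b#}) C"
      for R S C :: "nat multiset"
      by (cases "b \<in># R") (simp, simp only: not_in_iff of_nat_0 mult_zero_left)
    from this[of "rows xs" A] this[of A "rows xs"]
    have "of_nat (count (rows xs) b) * moment n (A + (rows xs - {#b#})) (B + cols xs)
        = of_nat (count (rows xs) b) * moment n (A + rows xs - {#b#}) (B + cols xs)"
      "of_nat (count A b) * moment n (A - {#b#} + rows xs) (B + cols xs)
        = of_nat (count A b) * moment n (A + rows xs - {#b#}) (B + cols xs)"
      by (simp_all only: add.commute[of "rows xs"])
    moreover have "size (B + cols xs) = size B + m" using pair_lists_rows[OF xs] by simp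
    ultimately show ?thesis
      by (simp only: count_union of_nat_add distrib_right union_mset_add_mset_left add.assoc) (rule add.commute)
  qed
  note key = this
  show ?thesis
    unfolding 1 2 3 sum_distrib_left sum.distrib[symmetric] sc_mult_left distrib_right[symmetric] sc_add[symmetric]
    by (rule sum.cong[OF refl]) (simp only: key)
qed

end

section \<open>Representations of the general linear Lie algebra\<close>

text \<open>The congruences for averages are linear in f, so that they have to be verified only on
  monomials of bounded degree.\<close>

lemma poly_linear_induct:
  fixes p :: "complex poly"
  assumes "degree p \<le> N" "\<And>k. k \<le> N \<Longrightarrow> P (monom 1 k)"
    "\<And>c q. P q \<Longrightarrow> P (smult c q)" "\<And>q r. P q \<Longrightarrow> P r \<Longrightarrow> P (q + r)"
  shows "P p"
proof -
  have mon: "P (monom c k)" if "k \<le> N" for c k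
    using assms(3)[OF assms(2)[OF that], of c] by (simp only: smult_monom mult_1_right)
  have "P (\<Sum>i\<le>k. monom (coeff p i) i)" if "k \<le> N" for k
    using that
  proof (induction k)
    case 0
    then show ?case using mon[of 0 "coeff p 0"] by (simp only: atMost_0) simp
  next
    case (Suc k)
    then have "P (\<Sum>i\<le>k. monom (coeff p i) i)" "P (monom (coeff p (Suc k)) (Suc k))"
      by (auto intro: mon)
    then show ?case unfolding sum.atMost_Suc by (rule assms(4))
  qed
  from this[of N] show ?thesis by (simp add: poly_as_sum_of_monoms'[OF assms(1)])
qed

lemmas cmult_ac = mult_ac[where 'a = complex]

context scalars
begin

text \<open>Opaque scalar multiplication: the rules below terminate, whereas moving \<open>sc a\<close> to the front does not.\<close>

definition sm :: "complex \<Rightarrow> 'a \<Rightarrow> 'a" where "sm a x = sc a * x"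

lemma sm_fold: "sc a * x = sm a x"
  by (simp add: sm_def)

lemma sm_simps:
  "sm a (sm b x) = sm (a * b) x" "x * sm a y = sm a (x * y)" "sm a x * y = sm a (x * y)"
  "sm a (x + y) = sm a x + sm a y" "sm a (x - y) = sm a x - sm a y" "sm a (- x) = - sm a x"
  "sm a 0 = 0" "sm 0 x = 0" "sm 1 x = x" "x * sc a = sm a x"
  "sm (a + b) x = sm a x + sm b x" "sm (a - b) x = sm a x - sm b x"
  "sm a (sum f A) = (\<Sum>i\<in>A. sm a (f i))"
proof -
  show "x * sm a y = sm a (x * y)" unfolding sm_def by (rule sc_left_commute)
  show "x * sc a = sm a x" unfolding sm_def by (rule sc_commute[symmetric])
qed (simp_all add: sm_def sc_mult sc_add sc_diff mult.assoc sum_distrib_left algebra_simps)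

lemmas sm_norm = sm_fold sm_simps cmult_ac mult.assoc sum_distrib_left sum_distrib_right
  sum_subtractf sum.distrib distrib_left distrib_right left_diff_distrib right_diff_distrib

end

locale gl_rel = two_sided sc J for sc :: "complex \<Rightarrow> 'a::ring_1" and J +
  fixes n :: nat and M :: "nat \<Rightarrow> nat \<Rightarrow> 'a"
  assumes MM: "\<lbrakk>i < n; j < n; k < n; l < n\<rbrakk> \<Longrightarrow>
    M i j * M k l - M k l * M i j \<approx> sc (kd j k) * M i l - sc (kd l i) * M k j"
begin

abbreviation MT :: "nat \<Rightarrow> nat \<Rightarrow> 'a" where "MT \<equiv> \<lambda>i j. M j i"

text \<open>With \<open>MT\<close> the roles of v and w are exchanged, so \<open>lrow n MT v\<close>
  and \<open>drank1 n MT w v\<close> are the derivatives in w.\<close>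

lemma rank1_transpose: "rank1 n MT w v = rank1 n M v w"
  unfolding rank1_def by (subst sum.swap) (simp add: mult.commute)

lemma sum_kd: "j < n \<Longrightarrow> (\<Sum>k<n. sc (kd j k) * g k) = g j"
proof -
  assume j: "j < n"
  have "(\<Sum>k<n. sc (kd j k) * g k) = (\<Sum>k<n. if j = k then g k else 0)"
    by (rule sum.cong) (auto simp: kd_def)
  then show ?thesis using j by simp
qed

lemma kd_sym: "kd i j = kd j i"
  by (simp add: kd_def)

text \<open>The adjoint action of e_ij on the rank-one element is the vector field v_j d/dv_i - w_i
  d/dw_j. By the product rule \<open>M_power\<close> extends this to powers.\<close>

lemma M_rank1:
  assumes "i < n" "j < n"
  shows "M i j * rank1 n M v w - rank1 n M v w * M i j
    \<approx> sc (v j) * lrow n M w i - sc (w i) * lrow n MT v j"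
proof -
  have "M i j * rank1 n M v w - rank1 n M v w * M i j
      = (\<Sum>k<n. \<Sum>l<n. sc (v k * w l) * (M i j * M k l - M k l * M i j))"
    by (simp add: rank1_def sm_norm)
  also have "\<dots> \<approx> (\<Sum>k<n. \<Sum>l<n. sc (v k * w l) * (sc (kd j k) * M i l - sc (kd l i) * M k j))"
    by (intro cg_sum cg_left MM) (use assms in auto)
  also have "\<dots> = (\<Sum>k<n. sc (kd j k) * (\<Sum>l<n. sc (v k * w l) * M i l))
      - (\<Sum>k<n. \<Sum>l<n. sc (kd i l) * (sc (v k * w l) * M k j))"
    by (simp add: sm_norm kd_sym)
  also have "\<dots> = (\<Sum>l<n. sc (v j * w l) * M i l) - (\<Sum>k<n. sc (v k * w i) * M k j)"
    using assms by (simp add: sum_kd)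
  also have "\<dots> = sc (v j) * lrow n M w i - sc (w i) * lrow n MT v j"
    by (simp add: lrow_def sm_norm)
  finally show ?thesis .
qed

lemma sum_lrow: "(\<Sum>l<n. sc (w l) * lrow n MT v l) = rank1 n M v w"
  unfolding rank1_def lrow_def sum_distrib_left by (subst sum.swap) (simp add: sm_norm)

lemma lrow_rank1:
  assumes "b < n" "(\<Sum>i<n. v i * w i) = 1"
  shows "lrow n M w b * rank1 n M v w - rank1 n M v w * lrow n M w b
    \<approx> lrow n M w b - sc (w b) * rank1 n M v w"
proof -
  have "lrow n M w b * rank1 n M v w - rank1 n M v w * lrow n M w b
      = (\<Sum>l<n. sc (w l) * (M b l * rank1 n M v w - rank1 n M v w * M b l))"
    by (simp add: lrow_def sm_norm)
  also have "\<dots> \<approx> (\<Sum>l<n. sc (w l) * (sc (v l) * lrow n M w b - sc (w b) * lrow n MT v l))"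
    by (intro cg_sum cg_left M_rank1) (use assms in auto)
  also have "\<dots> = sc (\<Sum>l<n. v l * w l) * lrow n M w b - sc (w b) * (\<Sum>l<n. sc (w l) * lrow n MT v l)"
    by (simp add: sc_sum sm_norm)
  finally show ?thesis by (simp add: assms sum_lrow)
qed

text \<open>Here the difference operator arises. By \<open>lrow_rank1\<close> the corrected row
  \<open>e\<close> satisfies e R = (R + 1) e, where \<open>R\<close> is the rank-one element. So in
  the Leibniz sum of \<open>drank1\<close> all factors R can be brought to the left, where the sum
  telescopes to (R + 1)^m - R^m.\<close>

lemma drank1_cg:
  fixes v w b
  defines "R \<equiv> rank1 n M v w" and "e \<equiv> lrow n M w b - sc (w b) * rank1 n M v w"
  assumes b: "b < n" and norm: "(\<Sum>i<n. v i * w i) = 1"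
  shows "drank1 n M v w b m \<approx> ((R + 1) ^ m - R ^ m) * e + sc (of_nat m * w b) * R ^ m"
proof -
  have "e * R - R * e = lrow n M w b * R - R * lrow n M w b"
    by (simp add: e_def R_def sm_norm)
  also have "\<dots> \<approx> e" unfolding R_def e_def by (rule lrow_rank1[OF b norm])
  finally have "e * R \<approx> (R + sc 1) * e"
    by (simp add: cg_def algebra_simps)
  from pev_intertwine_right[OF this, of "monom 1 k" for k]
  have eR: "e * R ^ k \<approx> (R + 1) ^ k * e" for k
    by (simp only: pev_monom pev_shift_monom sc_1 mult_1_left)
  have l: "lrow n M w b = e + sc (w b) * R" by (simp add: e_def R_def)
  show ?thesis
  proof (induction m)
    case (Suc m)
    have "drank1 n M v w b (Suc m) = e * R ^ m + sc (w b) * R ^ Suc m + R * drank1 n M v w b m"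
      by (simp add: l R_def[symmetric] distrib_right mult.assoc)
    also have "\<dots> \<approx> (R + 1) ^ m * e + sc (w b) * R ^ Suc m
        + R * (((R + 1) ^ m - R ^ m) * e + sc (of_nat m * w b) * R ^ m)"
      by (intro cg_add cg_left eR Suc cg_refl)
    also have "\<dots> = ((R + 1) ^ Suc m - R ^ Suc m) * e + sc (of_nat (Suc m) * w b) * R ^ Suc m"
      by (simp add: sc_add sm_norm)
    finally show ?case .
  qed simp
qed

lemma M_power:
  assumes "i < n" "j < n"
  shows "M i j * rank1 n M v w ^ m - rank1 n M v w ^ m * M i j
    \<approx> sc (v j) * drank1 n M v w i m - sc (w i) * drank1 n MT w v j m"
proof (induction m)
  case (Suc m)
  let ?R = "rank1 n M v w"
  have "M i j * ?R ^ Suc m - ?R ^ Suc m * M i j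
      = (M i j * ?R - ?R * M i j) * ?R ^ m + ?R * (M i j * ?R ^ m - ?R ^ m * M i j)"
    by (simp add: algebra_simps)
  also have "\<dots> \<approx> (sc (v j) * lrow n M w i - sc (w i) * lrow n MT v j) * ?R ^ m
      + ?R * (sc (v j) * drank1 n M v w i m - sc (w i) * drank1 n MT w v j m)"
    by (intro cg_add cg_right cg_left M_rank1 Suc assms)
  also have "\<dots> = sc (v j) * drank1 n M v w i (Suc m) - sc (w i) * drank1 n MT w v j (Suc m)"
    by (simp add: rank1_transpose sm_norm)
  finally show ?case .
qed simp

end

locale gl_cubature = gl_rel sc J n M + cubature n D K c v w
  for sc :: "complex \<Rightarrow> 'a::ring_1" and J n M D and K :: "'p set" and c v w
begin

sublocale cubature_alg sc n D K c v w M ..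

text \<open>\<open>moment\<close> is symmetric, so exchanging v and w gives a cubature again;
  \<open>dual.avg_Wick\<close> is integration by parts in w.\<close>

sublocale dual: cubature_alg sc n D K c w v MT
proof unfold_locales
  fix A B assume "set_mset A \<subseteq> {..<n}" "set_mset B \<subseteq> {..<n}" "size A = size B" "size A \<le> D"
  then show "(\<Sum>p\<in>K. c p * (vmono (w p) A * vmono (v p) B)) = moment n A B"
    using moments[of B A] by (simp add: moment_sym mult.commute)
qed (use n_pos finite_K normalized in \<open>auto simp: mult.commute\<close>)

lemma dual_rank1: "rank1 n MT (w p) (v p) = EE p"
  by (rule rank1_transpose)

text \<open>T(f), followed by Q_ab(f), of the overview.\<close>

definition avg_fun :: "complex poly \<Rightarrow> 'a" where "avg_fun f = avg (\<lambda>p. pev f (EE p))"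
definition avg_mat :: "nat \<Rightarrow> nat \<Rightarrow> complex poly \<Rightarrow> 'a" where
  "avg_mat a b f = avg (\<lambda>p. sc (v p a * w p b) * pev f (EE p))"

lemma avg_cg: "(\<And>p. p \<in> K \<Longrightarrow> F p \<approx> H p) \<Longrightarrow> avg F \<approx> avg H"
  unfolding avg_def by (intro cg_sum cg_left)

lemma avg_cong: "(\<And>p. p \<in> K \<Longrightarrow> F p = H p) \<Longrightarrow> avg F = avg H"
  unfolding avg_def by (intro sum.cong) auto

lemma avg_fun_add: "avg_fun (f + g) = avg_fun f + avg_fun g"
  by (simp add: avg_fun_def pev_add avg_add)

lemma avg_fun_smult: "avg_fun (smult a f) = sc a * avg_fun f"
  by (simp add: avg_fun_def pev_smult avg_sc)

lemma avg_mat_add: "avg_mat a b (f + g) = avg_mat a b f + avg_mat a b g"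
  by (simp add: avg_mat_def pev_add avg_add distrib_left)

lemma avg_mat_smult: "avg_mat a b (smult s f) = sc s * avg_mat a b f"
  unfolding avg_mat_def avg_sc[symmetric] by (simp add: pev_smult sm_norm)

lemma avg_fun_monom: "avg_fun (monom 1 m) = avg (\<lambda>p. EE p ^ m)"
  by (simp add: avg_fun_def pev_monom)

lemma avg_mat_monom: "avg_mat a b (monom 1 m) = avg (\<lambda>p. sc (v p a * w p b) * EE p ^ m)"
  by (simp add: avg_mat_def pev_monom)

lemma sum_avg_mat: "(\<Sum>a<n. avg_mat a a f) = avg_fun f"
proof -
  have "(\<Sum>a<n. avg_mat a a f) = avg (\<lambda>p. sc (\<Sum>a<n. v p a * w p a) * pev f (EE p))"
    unfolding avg_mat_def avg_sum[symmetric] sc_sum sum_distrib_right ..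
  also have "\<dots> = avg_fun f" unfolding avg_fun_def by (rule avg_cong) (simp add: normalized)
  finally show ?thesis .
qed

lemma count_avg_single:
  "sc (of_nat (count {#a#} i)) * avg (\<lambda>p. sc (vmono (F p) ({#a#} - {#i#}) * H p) * EE p ^ m)
    = sc (kd a i) * avg (\<lambda>p. sc (H p) * EE p ^ m)"
  by (cases "a = i") (auto simp: kd_def)

lemma count_avg_double:
  "sc (of_nat (count {#a, j#} i)) * avg (\<lambda>p. sc (vmono (F p) ({#a, j#} - {#i#}) * H p) * EE p ^ m)
    = sc (kd a i) * avg (\<lambda>p. sc (F p j * H p) * EE p ^ m) + sc (kd j i) * avg (\<lambda>p. sc (F p a * H p) * EE p ^ m)"
proof -
  have "sc 2 = 1 + 1" using sc_add[of 1 1] by simp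
  then show ?thesis by (auto simp: kd_def distrib_right mult_2)
qed

text \<open>Invariance of the sphere: integration by parts in v and in w turns the two terms of
  \<open>M_power\<close> into the same expression.\<close>

lemma avg_fun_commute_M:
  assumes "degree f + 1 \<le> D" "i < n" "j < n"
  shows "M i j * avg_fun f \<approx> avg_fun f * M i j"
proof -
  have "degree f \<le> D - 1" using assms(1) by simp
  then show ?thesis
  proof (rule poly_linear_induct[where P = "\<lambda>f. M i j * avg_fun f \<approx> avg_fun f * M i j"])
    fix m assume "m \<le> D - 1"
    then have m: "m + 1 \<le> D" using assms(1) by simp
    have "M i j * avg_fun (monom 1 m) - avg_fun (monom 1 m) * M i j
        = avg (\<lambda>p. M i j * EE p ^ m - EE p ^ m * M i j)"
      by (simp add: avg_fun_monom avg_diff avg_left avg_right)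
    also have "\<dots> \<approx> avg (\<lambda>p. sc (v p j) * drank1 n M (v p) (w p) i m - sc (w p i) * drank1 n MT (w p) (v p) j m)"
      by (intro avg_cg M_power assms)
    also have "\<dots> = avg (\<lambda>p. sc (vmono (v p) {#j#} * vmono (w p) {#}) * drank1 n M (v p) (w p) i m)
        - avg (\<lambda>p. sc (vmono (w p) {#i#} * vmono (v p) {#}) * drank1 n MT (w p) (v p) j m)"
      by (simp add: avg_diff)
    also have "\<dots> = 0"
    proof -
      have 1: "avg (\<lambda>p. sc (vmono (v p) {#j#} * vmono (w p) {#}) * drank1 n M (v p) (w p) i m)
         = sc (of_nat (n + m)) * avg (\<lambda>p. sc (v p j * w p i) * EE p ^ m) - sc (kd i j) * avg_fun (monom 1 m)"
        using avg_Wick[of "{#j#}" "{#}" m i, unfolded count_avg_single] assms m by (simp add: avg_fun_monom kd_sym[of i j] eq_diff_eq)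
      have 2: "avg (\<lambda>p. sc (vmono (w p) {#i#} * vmono (v p) {#}) * drank1 n MT (w p) (v p) j m)
         = sc (of_nat (n + m)) * avg (\<lambda>p. sc (v p j * w p i) * EE p ^ m) - sc (kd i j) * avg_fun (monom 1 m)"
        using dual.avg_Wick[of "{#i#}" "{#}" m j, unfolded dual_rank1 count_avg_single] assms m
        by (simp add: avg_fun_monom eq_diff_eq cmult_ac)
      show ?thesis unfolding 1 2 by simp
    qed
    finally show "M i j * avg_fun (monom 1 m) \<approx> avg_fun (monom 1 m) * M i j" by (simp add: cg_def)
  next
    fix s q assume "M i j * avg_fun q \<approx> avg_fun q * M i j"
    then show "M i j * avg_fun (smult s q) \<approx> avg_fun (smult s q) * M i j"
      using cg_left[of "M i j * avg_fun q" "avg_fun q * M i j" "sc s"] by (simp add: avg_fun_smult sm_norm)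
  next
    fix q r assume "M i j * avg_fun q \<approx> avg_fun q * M i j" "M i j * avg_fun r \<approx> avg_fun r * M i j"
    then show "M i j * avg_fun (q + r) \<approx> avg_fun (q + r) * M i j"
      by (simp add: avg_fun_add distrib_left distrib_right cg_add)
  qed
qed

text \<open>Q_ab transforms like e_ba under the adjoint action. The two integrations by parts share
  the term \<open>?W\<close>, which cancels; its four vector factors account for the degree
  bound.\<close>

lemma avg_mat_commutator:
  assumes "degree f + 2 \<le> D" "i < n" "j < n" "a < n" "b < n"
  shows "M i j * avg_mat a b f - avg_mat a b f * M i j \<approx> sc (kd b j) * avg_mat a i f - sc (kd a i) * avg_mat j b f"
    (is "?P f")
proof -
  have "degree f \<le> D - 2" using assms(1) by simp
  then show ?thesis
  proof (rule poly_linear_induct[where P = ?P])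
    fix m assume "m \<le> D - 2"
    then have m: "m + 2 \<le> D" using assms(1) by simp
    have "M i j * avg_mat a b (monom 1 m) - avg_mat a b (monom 1 m) * M i j
        = avg (\<lambda>p. sc (v p a * w p b) * (M i j * EE p ^ m - EE p ^ m * M i j))"
      by (simp add: avg_mat_monom avg_diff[symmetric] avg_left[symmetric] avg_right[symmetric] sm_norm)
    also have "\<dots> \<approx> avg (\<lambda>p. sc (v p a * w p b) *
        (sc (v p j) * drank1 n M (v p) (w p) i m - sc (w p i) * drank1 n MT (w p) (v p) j m))"
      by (intro avg_cg cg_left M_power assms)
    also have "\<dots> = avg (\<lambda>p. sc (vmono (v p) {#a, j#} * vmono (w p) {#b#}) * drank1 n M (v p) (w p) i m)
        - avg (\<lambda>p. sc (vmono (w p) {#b, i#} * vmono (v p) {#a#}) * drank1 n MT (w p) (v p) j m)"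
      by (simp add: avg_diff[symmetric] sm_norm)
    also have "\<dots> = sc (kd b j) * avg_mat a i (monom 1 m) - sc (kd a i) * avg_mat j b (monom 1 m)"
    proof -
      let ?W = "sc (of_nat (n + 1 + m)) * avg (\<lambda>p. sc (v p a * v p j * (w p b * w p i)) * EE p ^ m)"
      have 1: "avg (\<lambda>p. sc (vmono (v p) {#a, j#} * vmono (w p) {#b#}) * drank1 n M (v p) (w p) i m)
         = ?W - (sc (kd a i) * avg_mat j b (monom 1 m) + sc (kd j i) * avg_mat a b (monom 1 m))"
        using avg_Wick[of "{#a, j#}" "{#b#}" m i, unfolded count_avg_double] assms m
        by (simp add: avg_mat_monom eq_diff_eq cmult_ac)
      have 2: "avg (\<lambda>p. sc (vmono (w p) {#b, i#} * vmono (v p) {#a#}) * drank1 n MT (w p) (v p) j m)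
         = ?W - (sc (kd b j) * avg_mat a i (monom 1 m) + sc (kd i j) * avg_mat a b (monom 1 m))"
        using dual.avg_Wick[of "{#b, i#}" "{#a#}" m j, unfolded dual_rank1 count_avg_double] assms m
        by (simp add: avg_mat_monom eq_diff_eq cmult_ac)
      show ?thesis unfolding 1 2 kd_sym[of i j] by simp
    qed
    finally show "?P (monom 1 m)" .
  next
    fix s q assume "?P q"
    then have "sc s * (M i j * avg_mat a b q - avg_mat a b q * M i j) \<approx> sc s * (sc (kd b j) * avg_mat a i q - sc (kd a i) * avg_mat j b q)"
      by (rule cg_left)
    then show "?P (smult s q)"
      by (simp add: avg_mat_smult sm_norm)
  next
    fix q r assume "?P q" "?P r"
    from cg_add[OF this] show "?P (q + r)" by (simp add: avg_mat_add algebra_simps)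
  qed
qed

text \<open>For f = z^m, the row of b is split into the eigenvector of \<open>drank1_cg\<close> and
  w_b times the rank-one element e. The second part yields the term with z D f. The first is a
  v_b-derivative of e^m up to m w_b e^m, and \<open>avg_Wick\<close> evaluates it.\<close>

lemma avg_mat_recursion:
  assumes "degree f + 1 \<le> D" "a < n" "b < n"
  shows "(\<Sum>j<n. avg_mat a j (fdiff f) * M b j)
    \<approx> avg_mat a b (pCons 0 (fdiff f)) + sc (of_nat n) * avg_mat a b f - sc (kd a b) * avg_fun f" (is "?P f")
proof -
  have "degree f \<le> D - 1" using assms(1) by simp
  then show ?thesis
  proof (rule poly_linear_induct[where P = ?P])
    fix m assume "m \<le> D - 1"
    then have m: "m + 1 \<le> D" using assms(1) by simp
    let ?e = "\<lambda>p. lrow n M (w p) b - sc (w p b) * EE p"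
    let ?g = "fdiff (monom 1 m)"
    have g: "pev ?g (EE p) = (EE p + 1) ^ m - EE p ^ m" for p
      using pev_shift_monom[of m 1 "EE p"] by (simp add: fdiff_def pev_diff pev_monom)
    have "(\<Sum>j<n. avg_mat a j ?g * M b j) = avg (\<lambda>p. sc (v p a) * pev ?g (EE p) * lrow n M (w p) b)"
      unfolding avg_mat_def avg_right[symmetric] avg_sum[symmetric] lrow_def sum_distrib_left
      by (intro avg_cong sum.cong refl) (simp add: sm_norm)
    also have "\<dots> = avg (\<lambda>p. sc (v p a) * (pev ?g (EE p) * ?e p) + sc (v p a * w p b) * pev (pCons 0 ?g) (EE p))"
      by (intro avg_cong) (simp add: pev_commute sm_norm)
    also have "\<dots> = avg (\<lambda>p. sc (v p a) * (((EE p + 1) ^ m - EE p ^ m) * ?e p)) + avg_mat a b (pCons 0 ?g)"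
      by (simp only: avg_add avg_mat_def g)
    also have "\<dots> \<approx> avg (\<lambda>p. sc (v p a) * (drank1 n M (v p) (w p) b m - sc (of_nat m * w p b) * EE p ^ m)) + avg_mat a b (pCons 0 ?g)"
    proof (intro cg_add avg_cg cg_left cg_refl)
      fix p assume "p \<in> K"
      then have "drank1 n M (v p) (w p) b m \<approx> ((EE p + 1) ^ m - EE p ^ m) * ?e p + sc (of_nat m * w p b) * EE p ^ m"
        by (intro drank1_cg normalized assms)
      then show "((EE p + 1) ^ m - EE p ^ m) * ?e p \<approx> drank1 n M (v p) (w p) b m - sc (of_nat m * w p b) * EE p ^ m"
        using J_uminus by (fastforce simp: cg_def algebra_simps)
    qed
    also have "avg (\<lambda>p. sc (v p a) * (drank1 n M (v p) (w p) b m - sc (of_nat m * w p b) * EE p ^ m))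
        = avg (\<lambda>p. sc (vmono (v p) {#a#} * vmono (w p) {#}) * drank1 n M (v p) (w p) b m) - sc (of_nat m) * avg_mat a b (monom 1 m)"
      unfolding avg_mat_monom avg_sc[symmetric] avg_diff[symmetric]
      by (intro avg_cong) (simp add: sm_norm)
    also have "avg (\<lambda>p. sc (vmono (v p) {#a#} * vmono (w p) {#}) * drank1 n M (v p) (w p) b m)
        = sc (of_nat (n + m)) * avg_mat a b (monom 1 m) - sc (kd a b) * avg_fun (monom 1 m)"
      using avg_Wick[of "{#a#}" "{#}" m b, unfolded count_avg_single] assms m by (simp add: avg_fun_monom avg_mat_monom eq_diff_eq)
    \<comment> \<open>The degree m cancels from the coefficients; this is why the identity extends
      linearly from monomials to f.\<close>
    also have "sc (of_nat (n + m)) * avg_mat a b (monom 1 m) - sc (kd a b) * avg_fun (monom 1 m)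
        - sc (of_nat m) * avg_mat a b (monom 1 m) + avg_mat a b (pCons 0 ?g)
      = avg_mat a b (pCons 0 ?g) + sc (of_nat n) * avg_mat a b (monom 1 m) - sc (kd a b) * avg_fun (monom 1 m)"
      by (simp add: sc_add algebra_simps)
    finally show "?P (monom 1 m)" .
  next
    fix s q assume "?P q"
    then have "sc s * (\<Sum>j<n. avg_mat a j (fdiff q) * M b j)
      \<approx> sc s * (avg_mat a b (pCons 0 (fdiff q)) + sc (of_nat n) * avg_mat a b q - sc (kd a b) * avg_fun q)"
      by (rule cg_left)
    moreover have "pCons 0 (fdiff (smult s q)) = smult s (pCons 0 (fdiff q))"
      by (simp add: fdiff_smult)
    ultimately show "?P (smult s q)"
      by (simp only: fdiff_smult avg_mat_smult avg_fun_smult)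
         (simp add: sm_norm)
  next
    fix q r assume "?P q" "?P r"
    from cg_add[OF this] have "(\<Sum>j<n. avg_mat a j (fdiff q) * M b j) + (\<Sum>j<n. avg_mat a j (fdiff r) * M b j)
       \<approx> avg_mat a b (pCons 0 (fdiff q)) + sc (of_nat n) * avg_mat a b q - sc (kd a b) * avg_fun q
        + (avg_mat a b (pCons 0 (fdiff r)) + sc (of_nat n) * avg_mat a b r - sc (kd a b) * avg_fun r)" .
    moreover have "pCons 0 (fdiff (q + r)) = pCons 0 (fdiff q) + pCons 0 (fdiff r)"
      by (simp add: fdiff_add)
    ultimately show "?P (q + r)"
      by (simp only: fdiff_add avg_mat_add avg_fun_add) (simp add: algebra_simps sum.distrib)
  qed
qed

end

section \<open>Action on a highest weight vector\<close>

locale highest_weight = gl_cubature sc J n M D K c v w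
  for sc :: "complex \<Rightarrow> 'a::ring_1" and J n M D and K :: "'p set" and c v w +
  fixes I :: "'a set" and mu :: "nat \<Rightarrow> complex"
  assumes J_subset: "J \<subseteq> I" and I_add: "\<lbrakk>a \<in> I; b \<in> I\<rbrakk> \<Longrightarrow> a + b \<in> I" and I_left: "a \<in> I \<Longrightarrow> x * a \<in> I"
    and raising: "\<lbrakk>i < j; j < n\<rbrakk> \<Longrightarrow> M i j \<in> I"
    and weight: "i < n \<Longrightarrow> M i i - sc (mu i) \<in> I"
begin

text \<open>Congruence modulo a left ideal admits multiplication on the left only, so whatever is to
  be evaluated on the highest weight vector has to stand on the right.\<close>

definition lc :: "'a \<Rightarrow> 'a \<Rightarrow> bool"  (infix "\<sim>" 50) where
  "a \<sim> b \<longleftrightarrow> a - b \<in> I"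

lemma I_0: "0 \<in> I"
  using J_0 J_subset by blast

lemma lc_refl [simp]: "a \<sim> a"
  by (simp add: lc_def I_0)

lemma lc_trans [trans]: "a \<sim> b \<Longrightarrow> b \<sim> d \<Longrightarrow> a \<sim> d"
  using I_add[of "a - b" "b - d"] by (simp add: lc_def)

lemma lc_eq_trans [trans]: "a \<sim> b \<Longrightarrow> b = d \<Longrightarrow> a \<sim> d"
  by simp

lemma eq_lc_trans [trans]: "a = b \<Longrightarrow> b \<sim> d \<Longrightarrow> a \<sim> d"
  by simp

lemma cg_lc: "a \<approx> b \<Longrightarrow> a \<sim> b"
  using J_subset by (auto simp: cg_def lc_def)

lemma lc_add: "a \<sim> b \<Longrightarrow> d \<sim> e \<Longrightarrow> a + d \<sim> b + e"
  using I_add[of "a - b" "d - e"] by (simp add: lc_def algebra_simps)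

lemma lc_left: "a \<sim> b \<Longrightarrow> x * a \<sim> x * b"
  using I_left[of "a - b" x] by (simp add: lc_def algebra_simps)

lemma lc_diff: "a \<sim> b \<Longrightarrow> d \<sim> e \<Longrightarrow> a - d \<sim> b - e"
  using lc_add[of a b "- d" "- e"] lc_left[of d e "- 1"] by simp

lemma lc_sum: "(\<And>x. x \<in> A \<Longrightarrow> f x \<sim> g x) \<Longrightarrow> sum f A \<sim> sum g A"
  by (induction A rule: infinite_finite_induct) (auto simp: lc_add)

lemma lc_cancel: "s \<noteq> 0 \<Longrightarrow> sc s * a \<sim> sc s * b \<Longrightarrow> a \<sim> b"
  using lc_left[of "sc s * a" "sc s * b" "sc (1 / s)"] by (simp add: sc_mult_left)

text \<open>Chosen so that \<open>kap a + 1\<close> is mu_a - a + n, the coefficient required by the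
  diagonal recursion in \<open>highest_weight_values_aux\<close>.\<close>

definition kap :: "nat \<Rightarrow> complex" where "kap j = mu j - of_nat j + of_nat (n - 1)"

text \<open>Raising the points by 1 one after another leads from \<open>pts 0\<close> to its
  translate \<open>pts n\<close>; the n steps correspond to the n diagonal entries Q_aa.\<close>

definition pts :: "nat \<Rightarrow> complex multiset" where
  "pts a = image_mset (\<lambda>j. if j < a then kap j + 1 else kap j) (mset_set {..<n})"

definition dd :: "nat \<Rightarrow> complex poly \<Rightarrow> complex" where "dd a p = ddiff (pts a) p"

lemma size_pts: "size (pts a) = n"
  by (simp add: pts_def)

lemma pts_split:
  assumes "a < n"
  obtains U where "pts a = add_mset (kap a) U" "pts (Suc a) = add_mset (kap a + 1) U"
proof -
  let ?S = "{..<n} - {a}"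
  have S: "mset_set {..<n} = add_mset a (mset_set ?S)"
    using assms by (simp add: mset_set.remove)
  have "pts a = add_mset (kap a) (image_mset (\<lambda>j. if j < a then kap j + 1 else kap j) (mset_set ?S))"
    unfolding pts_def S by simp
  moreover have "pts (Suc a) = add_mset (kap a + 1) (image_mset (\<lambda>j. if j < Suc a then kap j + 1 else kap j) (mset_set ?S))"
    unfolding pts_def S by simp
  moreover have "image_mset (\<lambda>j. if j < Suc a then kap j + 1 else kap j) (mset_set ?S)
      = image_mset (\<lambda>j. if j < a then kap j + 1 else kap j) (mset_set ?S)"
    by (rule image_mset_cong) auto
  ultimately show ?thesis using that by simp
qed

lemma dd_step: "a < n \<Longrightarrow> dd (Suc a) p - dd a p = ddiff (add_mset (kap a + 1) (pts a)) p"
  using pts_split[of a] by (metis (no_types, lifting) add.commute add_diff_cancel_right' dd_def ddiff_exchange mult_1_left)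

text \<open>By \<open>dd_step\<close> the difference is a divided difference with the additional
  point \<open>kap a + 1\<close>, which the factor z - (kap a + 1) removes again.\<close>

lemma dd_factor:
  assumes "a < n"
  shows "dd (Suc a) (pCons 0 p - smult (kap a + 1) p) - dd a (pCons 0 p - smult (kap a + 1) p) = dd a p"
proof -
  have "pts a \<noteq> {#}" using size_pts[of a] n_pos by auto
  then show ?thesis using dd_step[OF assms] ddiff_factor[of "pts a"] by (simp add: dd_def)
qed

lemma dd_diff: "dd a (p - q) = dd a p - dd a q"
  by (simp add: dd_def ddiff_diff)

lemma dd_smult: "dd a (smult s p) = s * dd a p"
  by (simp add: dd_def ddiff_smult)

lemma dd_shift: "dd n p - dd 0 p = dd 0 (fdiff p)"
proof -
  have "pts n = image_mset (\<lambda>x. x + 1) (pts 0)"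
    unfolding pts_def image_mset.compositionality o_def by (rule image_mset_cong) auto
  moreover have "pts 0 \<noteq> {#}" using size_pts[of 0] n_pos by auto
  ultimately show ?thesis by (simp add: dd_def ddiff_shift fdiff_def ddiff_diff)
qed

lemma sum_dd: "(\<Sum>j<a. dd (Suc j) p - dd j p) = dd a p - dd 0 p"
  by (rule sum_lessThan_telescope)

lemma avg_one: "avg (\<lambda>p. 1) = 1"
proof -
  have "(\<Sum>p\<in>K. c p * (vmono (v p) {#} * vmono (w p) {#})) = moment n {#} {#}"
    by (rule moments) auto
  then have "(\<Sum>p\<in>K. c p) = 1" by (simp add: moment_def mfact_def)
  then show ?thesis by (simp add: avg_def sc_sum[symmetric])
qed

text \<open>The predicted value of Q_aa(f), where p is an n-th antidifference of f;
  \<open>tval p\<close> predicts T(f). They satisfy \<open>sum_qval\<close>, the counterpart of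
  \<open>sum_avg_mat\<close>.\<close>

definition qval :: "nat \<Rightarrow> complex poly \<Rightarrow> complex" where
  "qval a p = fact (n - 1) * (dd (Suc a) p - dd a p)"

definition tval :: "complex poly \<Rightarrow> complex" where "tval p = fact (n - 1) * dd 0 (fdiff p)"

lemma sum_qval: "(\<Sum>a<n. qval a p) = tval p"
  by (simp add: qval_def tval_def sum_distrib_left[symmetric] sum_dd dd_shift)

text \<open>The start of the induction: for a constant f the recursion loses its terms with D f and
  forces n Q_aa(f) = T(f).\<close>

lemma vals_const:
  assumes "(fdiff ^^ n) p = [:s:]"
  shows "tval p = s" "a < n \<Longrightarrow> of_nat n * qval a p = s"
proof -
  have "degree ((fdiff ^^ n) p) = 0" using assms by simp
  then have d: "degree p \<le> n" by (simp add: fdiff_iter_degree)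
  obtain m where n: "n = Suc m" using n_pos by (cases n) auto
  have df: "degree (fdiff p) \<le> m" using d n by (simp add: fdiff_degree)
  have "(fdiff ^^ m) (fdiff p) = [:s:]" using assms n by (simp add: funpow_swap1)
  then have "fact m * coeff (fdiff p) m = s" using coeff_fdiff_iter[OF df] by simp
  moreover have "ddiff (pts 0) (fdiff p) = coeff (fdiff p) m"
    by (rule ddiff_top) (use df n size_pts[of 0] in simp_all)
  moreover have m: "n - 1 = m" using n by simp
  ultimately show "tval p = s" unfolding tval_def dd_def m by simp
  assume a: "a < n"
  have "fact n * coeff p n = s" using coeff_fdiff_iter[OF d] assms by simp
  moreover have "dd (Suc a) p - dd a p = coeff p n"
    unfolding dd_step[OF a] using d by (intro ddiff_top) (simp_all add: size_pts)
  moreover have "of_nat n * fact (n - 1) = (fact n :: complex)"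
    using n by simp
  ultimately show "of_nat n * qval a p = s"
    by (simp add: qval_def mult.assoc[symmetric])
qed

text \<open>Induction on a bound k for the degree of f. The coefficient of z^k in z D f is k times
  that in f, so z D f = k f + r with r of lower degree, and the recursion expresses (n + k) Q_ab(f)
  - delta_ab T(f) by known values. The sum over a = b then separates T(f) from the diagonal entries.
  The vanishing for b < a, where Q_ab behaves like the raising operator e_ba, has to be carried
  along to evaluate the products Q_aj e_bj.\<close>

lemma highest_weight_values_aux:
  assumes "degree ((fdiff ^^ n) G) \<le> k" "k + 2 \<le> D"
  shows "avg_fun ((fdiff ^^ n) G) \<sim> sc (tval G)
    \<and> (\<forall>a<n. avg_mat a a ((fdiff ^^ n) G) \<sim> sc (qval a G))
    \<and> (\<forall>a<n. \<forall>b<a. avg_mat a b ((fdiff ^^ n) G) \<sim> 0)"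
  using assms
proof (induction k arbitrary: G)
  case 0
  define f where "f = (fdiff ^^ n) G"
  obtain s where s: "f = [:s:]" using 0 degree_eq_zeroE unfolding f_def by blast
  have avg_fun: "avg_fun f = sc s" by (simp add: avg_fun_def s avg_left[of "sc s" "\<lambda>p. 1", simplified] avg_one)
  have rec: "0 \<approx> sc (of_nat n) * avg_mat a b f - sc (kd a b) * avg_fun f" if "a < n" "b < n" for a b
    using avg_mat_recursion[of f a b] 0 that by (simp add: s avg_mat_def avg_def)
  have "sc (of_nat n) * avg_mat a a f \<sim> sc (of_nat n) * sc (qval a G)" if a: "a < n" for a
  proof -
    have "sc (of_nat n) * avg_mat a a f \<approx> sc s"
      using rec[OF a a] by (intro cg_sym[of "sc s"]) (simp add: cg_def avg_fun kd_def J_uminus[of "sc s - sc (of_nat n) * avg_mat a a f"] algebra_simps)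
    also have "sc s = sc (of_nat n) * sc (qval a G)"
      using vals_const(2)[of G s a] a s by (simp add: f_def sc_mult[symmetric])
    finally show ?thesis by (rule cg_lc)
  qed
  moreover have "sc (of_nat n) * avg_mat a b f \<sim> sc (of_nat n) * 0" if "a < n" "b < a" for a b
    using cg_lc[OF cg_sym[OF rec[of a b]]] that by (simp add: kd_def)
  moreover have "(of_nat n :: complex) \<noteq> 0" using n_pos by simp
  ultimately show ?case
    unfolding f_def[symmetric] using lc_cancel[of "of_nat n"] avg_fun vals_const(1)[of G s] s
    by (auto simp: f_def[symmetric])
next
  case (Suc k')
  define k where "k = Suc k'"
  define f where "f = (fdiff ^^ n) G"
  define g where "g = fdiff G"
  define r where "r = pCons 0 (fdiff f) - smult (of_nat k) f"
  \<comment> \<open>By the Leibniz rule the n-th difference of z g is z D f + n D f + n f; the other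
    two terms reduce this to r.\<close>
  define Gr where "Gr = pCons 0 g - smult (of_nat n) g - smult (of_nat (n + k)) G"
  obtain m where n: "n = Suc m" using n_pos by (cases n) auto
  have deg: "degree f \<le> Suc k'" using Suc.prems by (simp add: f_def)
  have fg: "fdiff f = (fdiff ^^ n) g" by (simp add: f_def g_def funpow_swap1)
  have fm: "f = (fdiff ^^ m) g" by (simp add: f_def g_def n funpow_swap1)
  have rG: "r = (fdiff ^^ n) Gr"
    using fdiff_iter_mult_X[of m g, folded n]
    by (simp add: r_def Gr_def fdiff_iter_diff fdiff_iter_add fdiff_iter_smult fg[symmetric] fm[symmetric] f_def[symmetric]
        smult_add_left smult_add_right)
  have "degree r \<le> k'"
  proof -
    have "degree r \<le> Suc k'" unfolding r_def
      using fdiff_coeff[OF deg] deg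
      by (intro degree_diff_le) (auto intro: order.trans[OF degree_pCons_le] order.trans[OF degree_smult_le])
    moreover have "coeff r (Suc k') = 0"
      using fdiff_coeff[OF deg] by (simp add: r_def k_def)
    ultimately show ?thesis by (metis degree_0 eq_zero_or_degree_less le_less less_Suc_eq_le zero_le)
  qed
  then have IHr: "avg_mat a a r \<sim> sc (qval a Gr)" "b < a \<Longrightarrow> avg_mat a b r \<sim> 0" if "a < n" for a b
    using Suc.IH[of Gr] that Suc.prems by (auto simp: rG)
  have "degree (fdiff f) \<le> k'" using fdiff_coeff[OF deg] by simp
  then have IHg: "avg_mat a a (fdiff f) \<sim> sc (qval a g)" "b < a \<Longrightarrow> avg_mat a b (fdiff f) \<sim> 0" if "a < n" for a b
    using Suc.IH[of g] that Suc.prems by (auto simp: fg)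
  \<comment> \<open>For j > b the factor e_bj raises, and for j = b it is a weight. For j < b it is
    commuted to the left of Q_aj, and what it then multiplies vanishes because j < b \<le>
    a.\<close>
  have entry: "avg_mat a j (fdiff f) * M b j \<sim> (if j < b then sc (kd a b) * avg_mat j j (fdiff f) - avg_mat a b (fdiff f)
      else if j = b then sc (mu b) * avg_mat a b (fdiff f) else 0)"
    if ab: "a < n" "b \<le> a" "j < n" for a b j
  proof (cases "j < b")
    case True
    have b: "b < n" using ab by simp
    have "M b j * avg_mat a j (fdiff f) - avg_mat a j (fdiff f) * M b j
        \<approx> sc (kd j j) * avg_mat a b (fdiff f) - sc (kd a b) * avg_mat j j (fdiff f)"
      using \<open>degree (fdiff f) \<le> k'\<close> Suc.prems ab b by (intro avg_mat_commutator) auto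
    from cg_lc[OF this] have "M b j * avg_mat a j (fdiff f) - avg_mat a j (fdiff f) * M b j
        \<sim> avg_mat a b (fdiff f) - sc (kd a b) * avg_mat j j (fdiff f)"
      by (simp add: kd_def)
    from lc_diff[OF lc_left[of "avg_mat a j (fdiff f)" 0 "M b j"] this]
    show ?thesis using IHg(2)[of a j] True ab by simp
  next
    case False
    show ?thesis
    proof (cases "j = b")
      case True
      have "avg_mat a b (fdiff f) * M b b \<sim> avg_mat a b (fdiff f) * sc (mu b)"
        using ab weight[of b] by (intro lc_left) (simp add: lc_def)
      then show ?thesis using True by (simp add: sc_commute)
    next
      case F: False
      then have "M b j \<sim> 0" using False ab raising[of b j] by (simp add: lc_def)
      from lc_left[OF this, of "avg_mat a j (fdiff f)"] show ?thesis using F False by simp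
    qed
  qed
  have rec: "sc (of_nat (n + k)) * avg_mat a b f - sc (kd a b) * avg_fun f
      \<sim> (\<Sum>j<n. if j < b then sc (kd a b) * avg_mat j j (fdiff f) - avg_mat a b (fdiff f)
      else if j = b then sc (mu b) * avg_mat a b (fdiff f) else 0) - avg_mat a b r"
    if ab: "a < n" "b \<le> a" for a b
  proof -
    have "pCons 0 (fdiff f) = smult (of_nat k) f + r" by (simp add: r_def)
    then have "(\<Sum>j<n. avg_mat a j (fdiff f) * M b j)
        \<approx> sc (of_nat k) * avg_mat a b f + avg_mat a b r + sc (of_nat n) * avg_mat a b f - sc (kd a b) * avg_fun f"
      using avg_mat_recursion[of f a b] deg ab Suc.prems by (simp add: avg_mat_add avg_mat_smult)
    from cg_lc[OF cg_diff[OF cg_sym[OF this] cg_refl[of "avg_mat a b r"]]]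
    have "sc (of_nat (n + k)) * avg_mat a b f - sc (kd a b) * avg_fun f
      \<sim> (\<Sum>j<n. avg_mat a j (fdiff f) * M b j) - avg_mat a b r"
      by (simp add: sc_add algebra_simps)
    also have "\<dots> \<sim> (\<Sum>j<n. if j < b then sc (kd a b) * avg_mat j j (fdiff f) - avg_mat a b (fdiff f)
      else if j = b then sc (mu b) * avg_mat a b (fdiff f) else 0) - avg_mat a b r"
      by (intro lc_diff lc_sum lc_refl entry) (use ab in auto)
    finally show ?thesis .
  qed
  have nk: "(of_nat (n + k) :: complex) \<noteq> 0" unfolding of_nat_eq_0_iff using n by simp
  have off: "avg_mat a b f \<sim> 0" if ab: "a < n" "b < a" for a b
  proof -
    have "sc (of_nat (n + k)) * avg_mat a b f
        \<sim> (\<Sum>j<n. if j < b then - avg_mat a b (fdiff f) else if j = b then sc (mu b) * avg_mat a b (fdiff f) else 0) - avg_mat a b r"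
      using rec[of a b] ab by (simp add: kd_def cong: if_cong)
    also have "\<dots> \<sim> (\<Sum>j<n. if j < b then - 0 else if j = b then sc (mu b) * 0 else 0) - 0"
    proof (intro lc_diff lc_sum IHr(2))
      fix j
      have "avg_mat a b (fdiff f) \<sim> 0" using IHg(2) ab by simp
      from lc_left[OF this, of "- 1"] lc_left[OF this, of "sc (mu b)"]
      show "(if j < b then - avg_mat a b (fdiff f) else if j = b then sc (mu b) * avg_mat a b (fdiff f) else 0)
        \<sim> (if j < b then - 0 else if j = b then sc (mu b) * 0 else 0)" by simp
    qed (use ab in auto)
    also have "\<dots> = sc (of_nat (n + k)) * 0" by (subst sum.neutral) auto
    finally show ?thesis by (rule lc_cancel[OF nk])
  qed
  have diag: "sc (of_nat (n + k)) * (avg_mat a a f - sc (qval a G)) \<sim> avg_fun f - sc (tval G)" if a: "a < n" for a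
  proof -
    have "sc (of_nat (n + k)) * avg_mat a a f - avg_fun f
        \<sim> (\<Sum>j<n. if j < a then avg_mat j j (fdiff f) - avg_mat a a (fdiff f) else if j = a then sc (mu a) * avg_mat a a (fdiff f) else 0) - avg_mat a a r"
      using rec[of a a] a by (simp add: kd_def cong: if_cong)
    also have "\<dots> \<sim> (\<Sum>j<n. if j < a then sc (qval j g) - sc (qval a g) else if j = a then sc (mu a) * sc (qval a g) else 0) - sc (qval a Gr)"
    proof (intro lc_diff lc_sum IHr(1))
      fix j assume "j \<in> {..<n}"
      then show "(if j < a then avg_mat j j (fdiff f) - avg_mat a a (fdiff f) else if j = a then sc (mu a) * avg_mat a a (fdiff f) else 0)
        \<sim> (if j < a then sc (qval j g) - sc (qval a g) else if j = a then sc (mu a) * sc (qval a g) else 0)"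
        using IHg(1) a by (auto intro: lc_diff lc_left)
    qed (use a in auto)
    also have "\<dots> = sc ((\<Sum>j<n. if j < a then qval j g - qval a g else if j = a then mu a * qval a g else 0) - qval a Gr)"
      unfolding sc_diff sc_sum by (intro arg_cong2[where f = "(-)"] sum.cong refl) (auto simp: sc_diff sc_mult)
    also have "(\<Sum>j<n. if j < a then qval j g - qval a g else if j = a then mu a * qval a g else 0)
        = (\<Sum>j<a. qval j g - qval a g) + mu a * qval a g"
    proof -
      have "{..<n} = {..<a} \<union> {a} \<union> {a<..<n}" using a by auto
      then have "(\<Sum>j<n. if j < a then qval j g - qval a g else if j = a then mu a * qval a g else 0)
        = (\<Sum>j\<in>{..<a} \<union> {a} \<union> {a<..<n}. if j < a then qval j g - qval a g else if j = a then mu a * qval a g else 0)"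
        by simp
      also have "\<dots> = (\<Sum>j<a. qval j g - qval a g) + mu a * qval a g"
        by (subst sum.union_disjoint; (auto)?)+
      finally show ?thesis .
    qed
    \<comment> \<open>The terms with \<open>dd a g\<close> and with \<open>qval a g\<close> all
      cancel; of the telescoping sum there remains \<open>- dd 0 g\<close>, which gives
      \<open>- tval G\<close>.\<close>
    also have "(\<Sum>j<a. qval j g - qval a g) + mu a * qval a g - qval a Gr
        = of_nat (n + k) * qval a G - tval G"
    proof -
      have "(\<Sum>j<a. qval j g) = fact (n - 1) * (dd a g - dd 0 g)"
        by (simp add: qval_def sum_distrib_left[symmetric] sum_dd)
      then have 1: "(\<Sum>j<a. qval j g - qval a g) = fact (n - 1) * (dd a g - dd 0 g) - of_nat a * qval a g"
        by (simp add: sum_subtractf)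
      have q1: "qval a (p - q) = qval a p - qval a q" for p q
        by (simp add: qval_def dd_diff algebra_simps)
      have q2: "qval a (smult s p) = s * qval a p" for s p
        by (simp add: qval_def dd_smult algebra_simps)
      have "qval a (pCons 0 g) - (kap a + 1) * qval a g = fact (n - 1) * dd a g"
        using dd_factor[OF a, of g] q1[of "pCons 0 g" "smult (kap a + 1) g"] q2[of "kap a + 1" g]
        by (simp add: qval_def)
      then have "qval a (pCons 0 g) = fact (n - 1) * dd a g + (kap a + 1) * qval a g"
        by (simp add: diff_eq_eq)
      moreover have "kap a + 1 = mu a - of_nat a + of_nat n"
        unfolding kap_def using n_pos by (simp add: of_nat_diff)
      ultimately have 2: "qval a (pCons 0 g) = fact (n - 1) * dd a g + (mu a - of_nat a + of_nat n) * qval a g"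
        by simp
      show ?thesis
        unfolding 1 Gr_def q1 q2 2 by (simp add: tval_def g_def algebra_simps)
    qed
    finally have "sc (of_nat (n + k)) * avg_mat a a f - avg_fun f \<sim> sc (of_nat (n + k) * qval a G - tval G)" .
    moreover have "sc (of_nat (n + k)) * (avg_mat a a f - sc (qval a G)) - (avg_fun f - sc (tval G))
        = sc (of_nat (n + k)) * avg_mat a a f - avg_fun f - sc (of_nat (n + k) * qval a G - tval G)"
      by (simp only: right_diff_distrib sc_diff sc_mult) simp
    ultimately show ?thesis by (simp only: lc_def)
  qed
  \<comment> \<open>For the error d = T(f) - \<open>tval G\<close>, the sum of \<open>diag\<close>
    over a gives (n + k) d = n d modulo \<open>I\<close>, and k > 0 forces d to vanish.\<close>
  have "sc (of_nat (n + k)) * (avg_fun f - sc (tval G)) = (\<Sum>a<n. sc (of_nat (n + k)) * (avg_mat a a f - sc (qval a G)))"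
    by (simp only: sum_avg_mat[symmetric] sum_qval[symmetric] sc_sum sum_subtractf[symmetric] sum_distrib_left)
  also have "\<dots> \<sim> (\<Sum>a<n. avg_fun f - sc (tval G))"
    by (intro lc_sum diag) auto
  also have "\<dots> = sc (of_nat n) * (avg_fun f - sc (tval G))" by (simp add: sc_of_nat)
  finally have "sc (of_nat k) * (avg_fun f - sc (tval G)) \<sim> sc (of_nat k) * 0"
    by (simp add: lc_def sc_add algebra_simps)
  then have T: "avg_fun f - sc (tval G) \<sim> 0"
    by (rule lc_cancel[rotated]) (simp add: k_def del: of_nat_Suc)
  have "avg_mat a a f \<sim> sc (qval a G)" if "a < n" for a
  proof -
    have "sc (of_nat (n + k)) * (avg_mat a a f - sc (qval a G)) \<sim> sc (of_nat (n + k)) * 0"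
      using lc_trans[OF diag[OF that] T] by simp
    from lc_cancel[OF nk this] show ?thesis by (simp add: lc_def)
  qed
  then show ?case using T off by (auto simp: f_def[symmetric] lc_def)
qed

text \<open>\<open>tval\<close> refers to n-th antidifferences, hence the auxiliary H one step above
  G.\<close>

lemma avg_fun_highest_weight:
  assumes "(fdiff ^^ (n - 1)) G = f" "degree f + 2 \<le> D"
  shows "avg_fun f \<sim> sc (fact (n - 1) * ddiff (image_mset kap (mset_set {..<n})) G)"
proof -
  obtain H where H: "fdiff H = G" using fdiff_surj by blast
  have "n = Suc (n - 1)" using n_pos by simp
  then have "(fdiff ^^ n) H = f" using assms(1) H by (metis funpow_Suc_right o_apply)
  moreover have "pts 0 = image_mset kap (mset_set {..<n})" by (simp add: pts_def)
  ultimately show ?thesis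
    using highest_weight_values_aux[of H "degree f"] assms(2) by (simp add: tval_def dd_def H)
qed

end

section \<open>The Casimir element is central\<close>

text \<open>\<open>YX\<close> is the commutation relation of y and x in averaged form;
  \<open>symm_r_fun_sum\<close> identifies its right-hand side with the sum of the zeta_j
  r_j.\<close>

locale casimir_rel = gl_cubature sc J n M D K c v w
  for sc :: "complex \<Rightarrow> 'a::ring_1" and J n M D and K :: "'p set" and c v w +
  fixes x y :: "nat \<Rightarrow> 'a" and f :: "complex poly"
  assumes XX: "\<lbrakk>i < n; j < n\<rbrakk> \<Longrightarrow> x i * x j \<approx> x j * x i"
    and YY: "\<lbrakk>i < n; j < n\<rbrakk> \<Longrightarrow> y i * y j \<approx> y j * y i"
    and MX: "\<lbrakk>i < n; j < n; k < n\<rbrakk> \<Longrightarrow> M i j * x k \<approx> x k * M i j - sc (kd i k) * x j"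
    and MY: "\<lbrakk>i < n; j < n; k < n\<rbrakk> \<Longrightarrow> M i j * y k \<approx> y k * M i j + sc (kd j k) * y i"
    and YX: "\<lbrakk>k < n; l < n\<rbrakk> \<Longrightarrow> y k * x l \<approx> x l * y k + sc (1 / fact (n - 1)) * avg_mat l k (f - pcompose f [:- 1, 1:])"
    and deg_f: "degree f + 1 \<le> D"
begin

definition cas :: 'a where "cas = (\<Sum>j<n. x j * y j) + sc (1 / fact (n - 1)) * avg_fun f"

abbreviation nf :: "complex poly" where "nf \<equiv> f - pcompose f [:- 1, 1:]"

text \<open>x_k is split into x_k - s_k xi and s_k xi with xi = sum t_j x_j. Because of s . t = 1
  the first part commutes with the rank-one element, while xi shifts it by -1.\<close>

lemma rank1_x:
  fixes s t :: "nat \<Rightarrow> complex"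
  assumes k: "k < n" and norm: "(\<Sum>i<n. s i * t i) = 1"
  shows "pev f (rank1 n M s t) * x k \<approx> x k * pev f (rank1 n M s t)
     - sc (s k) * (\<Sum>j<n. sc (t j) * x j) * pev nf (rank1 n M s t)"
proof -
  let ?R = "rank1 n M s t" and ?xi = "\<Sum>j<n. sc (t j) * x j"
  have Rx: "?R * x k \<approx> x k * ?R - sc (s k) * ?xi" if k: "k < n" for k
  proof -
    have "?R * x k = (\<Sum>i<n. \<Sum>j<n. sc (s i * t j) * (M i j * x k))"
      by (simp add: rank1_def sm_norm)
    also have "\<dots> \<approx> (\<Sum>i<n. \<Sum>j<n. sc (s i * t j) * (x k * M i j - sc (kd i k) * x j))"
      by (intro cg_sum cg_left MX) (use k in auto)
    also have "\<dots> = x k * ?R - (\<Sum>i<n. sc (kd k i) * (\<Sum>j<n. sc (s i * t j) * x j))"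
      by (simp add: rank1_def sm_norm kd_sym)
    also have "\<dots> = x k * ?R - sc (s k) * ?xi"
      using k by (simp add: sum_kd) (simp add: sm_norm)
    finally show ?thesis .
  qed
  have "?R * ?xi = (\<Sum>j<n. sc (t j) * (?R * x j))" by (simp add: sm_norm)
  also have "\<dots> \<approx> (\<Sum>j<n. sc (t j) * (x j * ?R - sc (s j) * ?xi))"
    by (intro cg_sum cg_left Rx) auto
  also have "\<dots> = ?xi * ?R - sc (\<Sum>j<n. s j * t j) * ?xi"
    unfolding sc_sum sum_distrib_right right_diff_distrib sum_subtractf sc_mult_left
    by (simp add: mult.assoc mult.commute[of "t _"])
  also have "\<dots> = ?xi * (?R + sc (- 1))" by (simp add: norm sc_uminus algebra_simps)
  finally have Rxi: "?R * ?xi \<approx> ?xi * (?R + sc (- 1))" .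
  then have xi: "pev f ?R * ?xi \<approx> ?xi * pev (pcompose f [:- 1, 1:]) ?R"
    by (rule pev_intertwine_left)
  have "?R * (x k - sc (s k) * ?xi) = ?R * x k - sc (s k) * (?R * ?xi)"
    by (simp only: right_diff_distrib sc_left_commute)
  also have "\<dots> \<approx> (x k * ?R - sc (s k) * ?xi) - sc (s k) * (?xi * (?R + sc (- 1)))"
    by (intro cg_diff cg_left Rx k Rxi)
  also have "\<dots> = (x k - sc (s k) * ?xi) * (?R + sc 0)"
    by (simp add: sc_uminus algebra_simps)
  finally have xk: "pev f ?R * (x k - sc (s k) * ?xi) \<approx> (x k - sc (s k) * ?xi) * pev (pcompose f [:0, 1:]) ?R"
    by (rule pev_intertwine_left)
  have "pev f ?R * x k = pev f ?R * (x k - sc (s k) * ?xi) + sc (s k) * (pev f ?R * ?xi)"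
    by (simp only: right_diff_distrib sc_left_commute) simp
  also have "\<dots> \<approx> (x k - sc (s k) * ?xi) * pev (pcompose f [:0, 1:]) ?R + sc (s k) * (?xi * pev (pcompose f [:- 1, 1:]) ?R)"
    by (intro cg_add cg_left xi xk)
  also have "\<dots> = x k * pev f ?R - sc (s k) * ?xi * pev nf ?R"
    by (simp add: pev_diff algebra_simps)
  finally show ?thesis .
qed

text \<open>The mirror image of \<open>rank1_x\<close>: s and t are exchanged and the polynomial is
  moved to the other side.\<close>

lemma rank1_y:
  fixes s t :: "nat \<Rightarrow> complex"
  assumes k: "k < n" and norm: "(\<Sum>i<n. s i * t i) = 1"
  shows "y k * pev f (rank1 n M s t) \<approx> pev f (rank1 n M s t) * y k
     - sc (t k) * (pev nf (rank1 n M s t) * (\<Sum>i<n. sc (s i) * y i))"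
proof -
  let ?R = "rank1 n M s t" and ?xi = "\<Sum>j<n. sc (s j) * y j"
  have Rx: "y k * ?R \<approx> ?R * y k - sc (t k) * ?xi" if k: "k < n" for k
  proof -
    have "?R * y k = (\<Sum>i<n. \<Sum>j<n. sc (s i * t j) * (M i j * y k))"
      by (simp add: rank1_def sm_norm)
    also have "\<dots> \<approx> (\<Sum>i<n. \<Sum>j<n. sc (s i * t j) * (y k * M i j + sc (kd j k) * y i))"
      by (intro cg_sum cg_left MY) (use k in auto)
    also have "\<dots> = y k * ?R + (\<Sum>i<n. \<Sum>j<n. sc (kd k j) * (sc (s i * t j) * y i))"
      by (simp add: rank1_def sm_norm kd_sym)
    also have "\<dots> = y k * ?R + sc (t k) * ?xi"
      using k by (simp add: sum_kd) (simp add: sm_norm)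
    finally have "?R * y k \<approx> y k * ?R + sc (t k) * ?xi" .
    from cg_sym[OF cg_diff[OF this cg_refl[of "sc (t k) * ?xi"]]] show ?thesis by simp
  qed
  have "?xi * ?R = (\<Sum>j<n. sc (s j) * (y j * ?R))" by (simp add: sm_norm)
  also have "\<dots> \<approx> (\<Sum>j<n. sc (s j) * (?R * y j - sc (t j) * ?xi))"
    by (intro cg_sum cg_left Rx) auto
  also have "\<dots> = ?R * ?xi - sc (\<Sum>j<n. s j * t j) * ?xi"
    unfolding sc_sum sum_distrib_right sum_distrib_left[of ?R] right_diff_distrib sum_subtractf sc_mult_left
    by (simp add: sc_left_commute[of ?R])
  also have "\<dots> = (?R + sc (- 1)) * ?xi" by (simp add: norm sc_uminus algebra_simps)
  finally have Rxi: "?xi * ?R \<approx> (?R + sc (- 1)) * ?xi" .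
  then have xi: "?xi * pev f ?R \<approx> pev (pcompose f [:- 1, 1:]) ?R * ?xi"
    by (rule pev_intertwine_right)
  have "(y k - sc (t k) * ?xi) * ?R = y k * ?R - sc (t k) * (?xi * ?R)"
    by (simp only: left_diff_distrib mult.assoc)
  also have "\<dots> \<approx> (?R * y k - sc (t k) * ?xi) - sc (t k) * ((?R + sc (- 1)) * ?xi)"
    by (intro cg_diff cg_left Rx k Rxi)
  also have "\<dots> = (?R + sc 0) * (y k - sc (t k) * ?xi)"
    by (simp add: sc_uminus algebra_simps sc_left_commute[of ?R])
  finally have xk: "(y k - sc (t k) * ?xi) * pev f ?R \<approx> pev (pcompose f [:0, 1:]) ?R * (y k - sc (t k) * ?xi)"
    by (rule pev_intertwine_right)
  have "y k * pev f ?R = (y k - sc (t k) * ?xi) * pev f ?R + sc (t k) * (?xi * pev f ?R)"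
    by (simp only: left_diff_distrib mult.assoc) simp
  also have "\<dots> \<approx> pev (pcompose f [:0, 1:]) ?R * (y k - sc (t k) * ?xi) + sc (t k) * (pev (pcompose f [:- 1, 1:]) ?R * ?xi)"
    by (intro cg_add cg_left xi xk)
  also have "\<dots> = pev f ?R * y k - sc (t k) * (pev nf ?R * ?xi)"
    by (simp add: pev_diff right_diff_distrib left_diff_distrib sc_left_commute[of "pev f ?R"])
  finally show ?thesis .
qed

text \<open>Moving x_l through y_j and through the average produces the same terms x_j Q_lj with
  opposite signs, since \<open>YX\<close> contains exactly f(z) - f(z - 1).\<close>

lemma cas_commute_x:
  assumes "l < n"
  shows "cas * x l \<approx> x l * cas"
proof -
  let ?s = "sc (1 / fact (n - 1))"
  have "avg_fun f * x l = avg (\<lambda>p. pev f (EE p) * x l)" by (simp add: avg_fun_def avg_right)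
  also have "\<dots> \<approx> avg (\<lambda>p. x l * pev f (EE p) - sc (v p l) * (\<Sum>j<n. sc (w p j) * x j) * pev nf (EE p))"
    by (intro avg_cg rank1_x normalized assms)
  also have "\<dots> = avg (\<lambda>p. x l * pev f (EE p) - (\<Sum>j<n. x j * (sc (v p l * w p j) * pev nf (EE p))))"
    by (intro avg_cong) (simp add: sm_norm)
  also have "\<dots> = x l * avg_fun f - (\<Sum>j<n. x j * avg_mat l j nf)"
    unfolding avg_diff avg_sum avg_left avg_fun_def avg_mat_def ..
  finally have T: "avg_fun f * x l \<approx> x l * avg_fun f - (\<Sum>j<n. x j * avg_mat l j nf)" .
  have "cas * x l = (\<Sum>j<n. x j * (y j * x l)) + ?s * (avg_fun f * x l)"
    by (simp add: cas_def distrib_right sum_distrib_right mult.assoc)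
  also have "\<dots> \<approx> (\<Sum>j<n. x j * (x l * y j + ?s * avg_mat l j nf)) + ?s * (x l * avg_fun f - (\<Sum>j<n. x j * avg_mat l j nf))"
    by (intro cg_add cg_sum cg_left YX T) (use assms in auto)
  also have "\<dots> = (\<Sum>j<n. (x j * x l) * y j) + x l * (?s * avg_fun f)"
    by (simp add: sm_norm)
  also have "\<dots> \<approx> (\<Sum>j<n. (x l * x j) * y j) + x l * (?s * avg_fun f)"
    by (intro cg_add cg_sum cg_right XX cg_refl) (use assms in auto)
  also have "\<dots> = x l * cas"
    by (simp add: cas_def distrib_left sum_distrib_left mult.assoc)
  finally show ?thesis .
qed

lemma cas_commute_y:
  assumes "l < n"
  shows "cas * y l \<approx> y l * cas"
proof -
  let ?s = "sc (1 / fact (n - 1))"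
  have "y l * avg_fun f = avg (\<lambda>p. y l * pev f (EE p))" by (simp add: avg_fun_def avg_left)
  also have "\<dots> \<approx> avg (\<lambda>p. pev f (EE p) * y l - sc (w p l) * (pev nf (EE p) * (\<Sum>i<n. sc (v p i) * y i)))"
    by (intro avg_cg rank1_y normalized assms)
  also have "\<dots> = avg (\<lambda>p. pev f (EE p) * y l - (\<Sum>j<n. (sc (v p j * w p l) * pev nf (EE p)) * y j))"
    by (intro avg_cong) (simp add: sm_norm)
  also have "\<dots> = avg_fun f * y l - (\<Sum>j<n. avg_mat j l nf * y j)"
    unfolding avg_diff avg_sum avg_right avg_fun_def avg_mat_def ..
  finally have T: "y l * avg_fun f \<approx> avg_fun f * y l - (\<Sum>j<n. avg_mat j l nf * y j)" .
  have "y l * cas = (\<Sum>j<n. (y l * x j) * y j) + ?s * (y l * avg_fun f)"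
    by (simp add: cas_def distrib_left sum_distrib_left mult.assoc sc_left_commute[of "y l"])
  also have "\<dots> \<approx> (\<Sum>j<n. (x j * y l + ?s * avg_mat j l nf) * y j) + ?s * (avg_fun f * y l - (\<Sum>j<n. avg_mat j l nf * y j))"
    by (intro cg_add cg_sum cg_left cg_right YX T) (use assms in auto)
  also have "\<dots> = (\<Sum>j<n. x j * (y l * y j)) + (?s * avg_fun f) * y l"
    by (simp add: sm_norm)
  also have "\<dots> \<approx> (\<Sum>j<n. x j * (y j * y l)) + (?s * avg_fun f) * y l"
    by (intro cg_add cg_sum cg_left YY cg_refl) (use assms in auto)
  also have "\<dots> = cas * y l"
    by (simp add: cas_def distrib_right sum_distrib_right mult.assoc)
  finally show ?thesis by (rule cg_sym)
qed

lemma cas_commute_M: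
  assumes "i < n" "j < n"
  shows "M i j * cas \<approx> cas * M i j"
proof -
  let ?s = "sc (1 / fact (n - 1))"
  have "M i j * cas = (\<Sum>k<n. (M i j * x k) * y k) + ?s * (M i j * avg_fun f)"
    by (simp add: cas_def distrib_left sum_distrib_left mult.assoc sc_left_commute[of "M i j"])
  also have "\<dots> \<approx> (\<Sum>k<n. (x k * M i j - sc (kd i k) * x j) * y k) + ?s * (avg_fun f * M i j)"
    by (intro cg_add cg_sum cg_left cg_right MX avg_fun_commute_M) (use assms deg_f in auto)
  also have "\<dots> = (\<Sum>k<n. x k * (M i j * y k)) - (\<Sum>k<n. sc (kd i k) * (x j * y k)) + ?s * avg_fun f * M i j"
    by (simp add: left_diff_distrib sum_subtractf mult.assoc)
  also have "(\<Sum>k<n. sc (kd i k) * (x j * y k)) = x j * y i"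
    using assms by (simp add: sum_kd)
  also have "(\<Sum>k<n. x k * (M i j * y k)) - x j * y i + ?s * avg_fun f * M i j
      \<approx> (\<Sum>k<n. x k * (y k * M i j + sc (kd j k) * y i)) - x j * y i + ?s * avg_fun f * M i j"
    by (intro cg_add cg_diff cg_sum cg_left MY cg_refl) (use assms in auto)
  also have "\<dots> = (\<Sum>k<n. x k * y k * M i j) + (\<Sum>k<n. sc (kd j k) * (x k * y i)) - x j * y i + ?s * avg_fun f * M i j"
    by (simp add: distrib_left sum.distrib mult.assoc sc_left_commute[of "x _"])
  also have "(\<Sum>k<n. sc (kd j k) * (x k * y i)) = x j * y i"
    using assms by (simp add: sum_kd)
  also have "(\<Sum>k<n. x k * y k * M i j) + x j * y i - x j * y i + ?s * avg_fun f * M i j = cas * M i j"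
    by (simp add: cas_def distrib_right sum_distrib_right mult.assoc)
  finally show ?thesis .
qed

end

section \<open>The polynomial functions of the Hecke relations as averages\<close>

text \<open>Composition with a fixed permutation identifies the fibres over all rearrangements of
  xs. Each of them therefore has as many elements as the factorial of the length divided by the
  number of rearrangements.\<close>

lemma card_permute_list_eq:
  fixes xs :: "nat list"
  assumes "set xs \<subseteq> {..<n}"
  shows "card {\<sigma>. \<sigma> permutes {..<length xs} \<and> permute_list \<sigma> xs = ys}
    = (if mset ys = mset xs then \<Prod>i<n. fact (count (mset xs) i) else 0)"
proof (cases "mset ys = mset xs")
  case False
  then have "{\<sigma>. \<sigma> permutes {..<length xs} \<and> permute_list \<sigma> xs = ys} = {}"
    using mset_permute_list by blast
  then show ?thesis using False by (simp only: card.empty if_False)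
next
  case True
  let ?P = "{\<sigma>. \<sigma> permutes {..<length xs}}"
  let ?F = "\<lambda>zs. {\<sigma>. \<sigma> permutes {..<length xs} \<and> permute_list \<sigma> xs = zs}"
  have fib: "card (?F zs) = card (?F xs)" if zs: "mset zs = mset xs" for zs
  proof -
    obtain \<tau> where \<tau>: "\<tau> permutes {..<length xs}" "permute_list \<tau> xs = zs"
      using mset_eq_permutation[OF zs] by blast
    have inv: "inv \<tau> permutes {..<length xs}" using \<tau>(1) by (rule permutes_inv)
    have "bij_betw (\<lambda>\<sigma>. \<sigma> \<circ> \<tau>) (?F xs) (?F zs)"
    proof (rule bij_betw_byWitness[where f' = "\<lambda>\<sigma>. \<sigma> \<circ> inv \<tau>"])
      show "\<forall>\<sigma>\<in>?F xs. \<sigma> \<circ> \<tau> \<circ> inv \<tau> = \<sigma>"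
        using permutes_inv_o(1)[OF \<tau>(1)] by (simp add: o_assoc[symmetric])
      show "\<forall>\<sigma>\<in>?F zs. \<sigma> \<circ> inv \<tau> \<circ> \<tau> = \<sigma>"
        using permutes_inv_o(2)[OF \<tau>(1)] by (simp add: o_assoc[symmetric])
      show "(\<lambda>\<sigma>. \<sigma> \<circ> \<tau>) ` ?F xs \<subseteq> ?F zs"
        using \<tau> by (auto simp: permute_list_compose intro: permutes_compose)
      have "permute_list (inv \<tau>) zs = xs"
        using permute_list_compose[OF inv, of \<tau>] permutes_inv_o(1)[OF \<tau>(1)] \<tau>(2) by simp
      then show "(\<lambda>\<sigma>. \<sigma> \<circ> inv \<tau>) ` ?F zs \<subseteq> ?F xs"
        using inv by (auto simp: permute_list_compose intro: permutes_compose)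
    qed
    then show ?thesis by (rule bij_betw_same_card[symmetric])
  qed
  have "fact (length xs) = card ?P" by (simp add: card_permutations)
  also have "?P = (\<Union>zs\<in>permutations_of_multiset (mset xs). ?F zs)"
    by (auto simp: permutations_of_multiset_def)
  also have "card \<dots> = (\<Sum>zs\<in>permutations_of_multiset (mset xs). card (?F zs))"
    by (rule card_UN_disjoint) (auto intro: finite_subset[OF _ finite_permutations[of "{..<length xs}"]])
  also have "\<dots> = (\<Sum>zs\<in>permutations_of_multiset (mset xs). card (?F xs))"
    by (rule sum.cong[OF refl], rule fib) (rule permutations_of_multisetD)
  also have "\<dots> = card (permutations_of_multiset (mset xs)) * card (?F xs)" by simp
  finally have "card (permutations_of_multiset (mset xs)) * card (?F xs)
      = card (permutations_of_multiset (mset xs)) * (\<Prod>x\<in>set_mset (mset xs). fact (count (mset xs) x))"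
    using card_permutations_of_multiset_aux[of "mset xs"] by simp
  moreover have "card (permutations_of_multiset (mset xs)) \<noteq> 0" by simp
  ultimately have "card (?F xs) = (\<Prod>x\<in>set_mset (mset xs). fact (count (mset xs) x))"
    by (simp del: set_mset_mset)
  also have "\<dots> = (\<Prod>i<n. fact (count (mset xs) i))"
    by (rule prod.mono_neutral_left) (use assms in \<open>auto simp: count_list_0_iff count_mset\<close>)
  finally show ?thesis using True fib[OF True] by simp
qed

definition idx_lists :: "nat \<Rightarrow> nat \<Rightarrow> nat list set" where
  "idx_lists n m = {is. length is = m \<and> set is \<subseteq> {..<n}}"

lemma finite_idx_lists [simp]: "finite (idx_lists n m)"
  using finite_lists_length_eq[of "{..<n}" m] by (simp add: idx_lists_def conj_commute)

lemma sum_pair_lists_zip: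
  "(\<Sum>xs\<in>pair_lists n m. F (map snd xs) (map fst xs)) = (\<Sum>is\<in>idx_lists n m. \<Sum>js\<in>idx_lists n m. F is js)"
proof -
  have "(\<Sum>xs\<in>pair_lists n m. F (map snd xs) (map fst xs)) = (\<Sum>(is, js)\<in>idx_lists n m \<times> idx_lists n m. F is js)"
    by (rule sum.reindex_bij_witness[of _ "\<lambda>(is, js). zip js is" "\<lambda>xs. (map snd xs, map fst xs)"])
       (auto simp: pair_lists_def idx_lists_def zip_map_fst_snd dest: set_zip_leftD set_zip_rightD)
  then show ?thesis by (simp add: sum.cartesian_product)
qed

interpretation cscal: scalars "\<lambda>x::complex. x"
  by unfold_locales (simp_all add: mult.commute)

text \<open>For the identity embedding these read \<open>0 = 0\<close> and \<open>1 = 1\<close> and make the simplifier loop.\<close>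

declare cscal.sc_0 [simp del] cscal.sc_1 [simp del]

text \<open>The average of (w . A v)^m, normalized so as to be Tr S^m A. Expressed by
  \<open>moment\<close> it does not depend on a cubature with its degree bound, so all m can be
  collected in one power series. The entries of A are transposed because of the trace form.\<close>

definition hcoef :: "nat \<Rightarrow> (nat \<Rightarrow> nat \<Rightarrow> complex) \<Rightarrow> nat \<Rightarrow> complex" where
  "hcoef n A m = pochhammer (of_nat n) m / fact m *
    (\<Sum>xs\<in>pair_lists n m. moment n (mset (map fst xs)) (mset (map snd xs)) * cscal.word (\<lambda>i j. A j i) xs)"

text \<open>The same with the additional factor v_l w_k; \<open>r_fun_eq_rcoef\<close> identifies it
  with r_m(y_k, x_l).\<close>

definition rcoef :: "nat \<Rightarrow> (nat \<Rightarrow> nat \<Rightarrow> complex) \<Rightarrow> nat \<Rightarrow> nat \<Rightarrow> nat \<Rightarrow> complex" where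
  "rcoef n A l k m = pochhammer (of_nat n) (Suc m) / fact m *
    (\<Sum>xs\<in>pair_lists n m. moment n (add_mset l (mset (map fst xs))) (add_mset k (mset (map snd xs))) * cscal.word (\<lambda>i j. A j i) xs)"

lemma word_nth:
  "cscal.word (\<lambda>i j. A j i) xs = (\<Prod>t<length xs. A (map snd xs ! t) (map fst xs ! t))"
  by (simp add: cscal.word_def prod.list_conv_set_nth lessThan_atLeast0)

text \<open>A permutation enters the trace only through the permuted index list, and the number of
  permutations with the same list is the product of factorials in \<open>moment\<close>.\<close>

lemma trSym_eq_hcoef:
  assumes "n \<ge> 1"
  shows "trSym n m A = hcoef n A m"
proof -
  let ?P = "{\<sigma>. \<sigma> permutes {..<m}}"
  let ?w = "\<lambda>is js. \<Prod>t<m. A (is ! t) (js ! t)"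
  have fin: "finite ?P" by (rule finite_permutations) simp
  have inner: "(\<Sum>\<sigma>\<in>?P. \<Prod>t<m. A (is ! t) (is ! \<sigma> t))
      = (\<Sum>js\<in>idx_lists n m. (if mset js = mset is then mfact n (mset is) else 0) * ?w is js)"
    if "is": "is \<in> idx_lists n m" for "is"
  proof -
    have len: "length is = m" "set is \<subseteq> {..<n}" using "is" by (auto simp: idx_lists_def)
    have "(\<Sum>\<sigma>\<in>?P. \<Prod>t<m. A (is ! t) (is ! \<sigma> t)) = (\<Sum>\<sigma>\<in>?P. ?w is (permute_list \<sigma> is))"
      by (intro sum.cong prod.cong refl) (simp add: permute_list_nth len)
    also have "\<dots> = (\<Sum>js\<in>idx_lists n m. \<Sum>\<sigma>\<in>{\<sigma> \<in> ?P. permute_list \<sigma> is = js}. ?w is (permute_list \<sigma> is))"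
      by (rule sum.group[symmetric]) (use fin len in simp, simp, use len in \<open>auto simp: idx_lists_def\<close>)
    also have "\<dots> = (\<Sum>js\<in>idx_lists n m. of_nat (card {\<sigma>. \<sigma> permutes {..<m} \<and> permute_list \<sigma> is = js}) * ?w is js)"
    proof (rule sum.cong[OF refl])
      fix js
      have "(\<Sum>\<sigma>\<in>{\<sigma> \<in> ?P. permute_list \<sigma> is = js}. ?w is (permute_list \<sigma> is))
          = (\<Sum>\<sigma>\<in>{\<sigma> \<in> ?P. permute_list \<sigma> is = js}. ?w is js)"
        by (rule sum.cong[OF refl]) (simp only: mem_Collect_eq)
      then show "(\<Sum>\<sigma>\<in>{\<sigma> \<in> ?P. permute_list \<sigma> is = js}. ?w is (permute_list \<sigma> is))
          = of_nat (card {\<sigma>. \<sigma> permutes {..<m} \<and> permute_list \<sigma> is = js}) * ?w is js"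
        by (simp only: sum_constant mem_Collect_eq)
    qed
    also have "\<dots> = (\<Sum>js\<in>idx_lists n m. (if mset js = mset is then mfact n (mset is) else 0) * ?w is js)"
    proof (intro sum.cong refl arg_cong2[where f = "(*)"])
      fix js
      have "card {\<sigma>. \<sigma> permutes {..<m} \<and> permute_list \<sigma> is = js}
          = (if mset js = mset is then \<Prod>i<n. fact (count (mset is) i) else 0)"
        using card_permute_list_eq[OF len(2), of js] unfolding len(1) .
      then show "of_nat (card {\<sigma>. \<sigma> permutes {..<m} \<and> permute_list \<sigma> is = js})
          = (if mset js = mset is then mfact n (mset is) else 0)"
        unfolding mfact_def by (cases "mset js = mset is") (simp_all only: simp_thms if_True if_False of_nat_prod of_nat_fact of_nat_0)
    qed
    finally show ?thesis .
  qed
  have "trSym n m A = 1 / fact m * (\<Sum>is\<in>idx_lists n m. \<Sum>\<sigma>\<in>?P. \<Prod>t<m. A (is ! t) (is ! \<sigma> t))"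
    unfolding trSym_def idx_lists_def by (rule arg_cong[where f = "(*) (1 / fact m)"]) (rule sum.swap)
  also have "\<dots> = 1 / fact m * (\<Sum>is\<in>idx_lists n m. \<Sum>js\<in>idx_lists n m. (if mset js = mset is then mfact n (mset is) else 0) * ?w is js)"
    by (simp only: inner cong: sum.cong)
  also have "\<dots> = 1 / fact m * (\<Sum>xs\<in>pair_lists n m. (if mset (map fst xs) = mset (map snd xs) then mfact n (mset (map snd xs)) else 0)
       * (\<Prod>t<m. A (map snd xs ! t) (map fst xs ! t)))"
    by (simp only: sum_pair_lists_zip[of "\<lambda>is js. (if mset js = mset is then mfact n (mset is) else 0) * ?w is js" n m])
  also have "\<dots> = hcoef n A m"
  proof -
    have "(if mset (map fst xs) = mset (map snd xs) then mfact n (mset (map snd xs)) else 0) * (\<Prod>t<m. A (map snd xs ! t) (map fst xs ! t))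
      = pochhammer (of_nat n) m * (moment n (mset (map fst xs)) (mset (map snd xs)) * cscal.word (\<lambda>i j. A j i) xs)"
      if "xs \<in> pair_lists n m" for xs
    proof -
      have len: "length xs = m" "size (mset (map snd xs)) = m"
        using that by (simp_all add: pair_lists_def)
      have cancel: "a * b = q * (a / q * b)" if "q \<noteq> 0" for a b q :: complex
        using that by simp
      show ?thesis
      proof (cases "mset (map fst xs) = mset (map snd xs)")
        case True
        then show ?thesis
          unfolding word_nth moment_def True len if_P[OF refl]
          by (intro cancel pochhammer_nat_nz assms)
      next
        case False
        then show ?thesis
          unfolding moment_def if_not_P[OF False] by (simp only: mult_zero_left mult_zero_right)
      qed
    qed
    then show ?thesis by (simp only: hcoef_def sum_distrib_left times_divide_eq_left mult_1_left cong: sum.cong)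
  qed
  finally show ?thesis .
qed

lemma cscal_drank1:
  "cscal.drank1 n M v w b m = of_nat m * cscal.lrow n M w b * cscal.rank1 n M v w ^ (m - 1)"
proof (induction m)
  case (Suc m)
  then show ?case by (cases m) (simp_all add: algebra_simps)
qed simp

section \<open>The commutative case: power series of the averages\<close>

locale cubature_complex = cubature n D K c v w
  for n D and K :: "'p set" and c v w +
  fixes A :: "nat \<Rightarrow> nat \<Rightarrow> complex"
begin

sublocale M: cubature_alg "\<lambda>x. x" n D K c v w "\<lambda>i j. A j i" ..

definition lf :: "'p \<Rightarrow> complex" where "lf p = (\<Sum>i<n. \<Sum>j<n. w p i * A i j * v p j)"

lemma lf_rank1: "cscal.rank1 n (\<lambda>i j. A j i) (v p) (w p) = lf p"
  unfolding lf_def cscal.rank1_def by (subst sum.swap) (simp add: mult_ac)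

lemma hcoef_avg:
  assumes "m \<le> D"
  shows "hcoef n A m = pochhammer (of_nat n) m / fact m * M.avg (\<lambda>p. lf p ^ m)"
  using M.avg_power[of "{#}" "{#}" m] assms by (simp add: hcoef_def lf_rank1)

lemma rcoef_avg:
  assumes "m + 1 \<le> D" "l < n" "k < n"
  shows "rcoef n A l k m = pochhammer (of_nat n) (Suc m) / fact m * M.avg (\<lambda>p. v p l * w p k * lf p ^ m)"
  using M.avg_power[of "{#l#}" "{#k#}" m] assms by (simp add: rcoef_def lf_rank1)

lemma rcoef_0:
  assumes "1 \<le> D" "l < n" "k < n"
  shows "rcoef n A l k 0 = kd l k * hcoef n A 0"
proof -
  have "M.avg (\<lambda>p. 0) = 0" by (simp add: M.avg_def)
  then have "kd l k * M.avg (\<lambda>p. 1) = of_nat n * M.avg (\<lambda>p. v p l * w p k)"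
    using M.avg_Wick[of "{#l#}" "{#}" 0 k] assms by (cases "l = k") (simp_all add: kd_def)
  then show ?thesis using assms by (simp add: rcoef_avg hcoef_avg)
qed

text \<open>Integration by parts. For the power series H of \<open>hcoef\<close> and R of
  \<open>rcoef\<close> it says R (1 - tau A) = H.\<close>

lemma rcoef_Suc_right:
  assumes "m + 2 \<le> D" "l < n" "k < n"
  shows "rcoef n A l k (Suc m) = kd l k * hcoef n A (Suc m) + (\<Sum>a<n. rcoef n A l a m * A a k)"
proof -
  have "M.avg (\<lambda>p. v p l * cscal.drank1 n (\<lambda>i j. A j i) (v p) (w p) k (Suc m))
     + kd l k * M.avg (\<lambda>p. lf p ^ Suc m)
    = of_nat (n + Suc m) * M.avg (\<lambda>p. v p l * w p k * lf p ^ Suc m)"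
    using M.avg_Wick[of "{#l#}" "{#}" "Suc m" k] assms by (cases "l = k") (simp_all add: kd_def lf_rank1)
  moreover have "M.avg (\<lambda>p. v p l * cscal.drank1 n (\<lambda>i j. A j i) (v p) (w p) k (Suc m))
      = of_nat (Suc m) * (\<Sum>a<n. M.avg (\<lambda>p. v p l * w p a * lf p ^ m) * A a k)"
    unfolding M.avg_right[symmetric] M.avg_sum[symmetric] M.avg_left[symmetric]
    by (rule arg_cong[where f = M.avg], rule ext)
       (simp add: cscal_drank1 lf_rank1 cscal.lrow_def sum_distrib_left sum_distrib_right mult_ac del: of_nat_Suc)
  ultimately have "of_nat (n + Suc m) * M.avg (\<lambda>p. v p l * w p k * lf p ^ Suc m)
    = of_nat (Suc m) * (\<Sum>a<n. M.avg (\<lambda>p. v p l * w p a * lf p ^ m) * A a k) + kd l k * M.avg (\<lambda>p. lf p ^ Suc m)"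
    by simp
  moreover have "rcoef n A l k (Suc m) = pochhammer (of_nat n) (Suc m) / fact (Suc m) *
      (of_nat (n + Suc m) * M.avg (\<lambda>p. v p l * w p k * lf p ^ Suc m))"
    using assms by (simp add: rcoef_avg pochhammer_Suc[of _ "Suc m"] mult_ac del: fact_Suc)
  ultimately have "rcoef n A l k (Suc m) = pochhammer (of_nat n) (Suc m) / fact (Suc m) *
      (of_nat (Suc m) * (\<Sum>a<n. M.avg (\<lambda>p. v p l * w p a * lf p ^ m) * A a k) + kd l k * M.avg (\<lambda>p. lf p ^ Suc m))"
    by simp
  also have "\<dots> = (\<Sum>a<n. pochhammer (of_nat n) (Suc m) / fact m * M.avg (\<lambda>p. v p l * w p a * lf p ^ m) * A a k)
      + kd l k * (pochhammer (of_nat n) (Suc m) / fact (Suc m) * M.avg (\<lambda>p. lf p ^ Suc m))"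
    by (simp add: distrib_left sum_distrib_left mult_ac del: of_nat_Suc)
  also have "\<dots> = kd l k * hcoef n A (Suc m) + (\<Sum>a<n. rcoef n A l a m * A a k)"
    using assms by (simp add: rcoef_avg hcoef_avg del: fact_Suc)
  finally show ?thesis .
qed

text \<open>One factor w . A v is split off; for the power series this says H' = Tr(A R).\<close>

lemma hcoef_Suc:
  assumes "m + 1 \<le> D"
  shows "of_nat (Suc m) * hcoef n A (Suc m) = (\<Sum>i<n. \<Sum>j<n. A i j * rcoef n A j i m)"
proof -
  have "M.avg (\<lambda>p. lf p ^ Suc m) = (\<Sum>i<n. \<Sum>j<n. A i j * M.avg (\<lambda>p. v p j * w p i * lf p ^ m))"
    unfolding M.avg_left[symmetric] M.avg_sum[symmetric]
    by (rule arg_cong[where f = M.avg], rule ext) (simp add: lf_def sum_distrib_left sum_distrib_right mult_ac)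
  moreover have "of_nat (Suc m) * hcoef n A (Suc m) = pochhammer (of_nat n) (Suc m) / fact m * M.avg (\<lambda>p. lf p ^ Suc m)"
    using assms by (simp add: hcoef_avg del: of_nat_Suc)
  ultimately show ?thesis
    using assms by (simp add: rcoef_avg sum_distrib_left mult_ac)
qed

end

lemma hcoef_0: "n \<ge> 1 \<Longrightarrow> hcoef n A 0 = 1"
  by (simp add: hcoef_def sum_pair_lists_0 moment_def mfact_def)

lemma cubature_complex_exists:
  assumes "n \<ge> 1"
  obtains K c v w where "cubature_complex n D (K :: (nat \<Rightarrow> nat \<times> nat) set) c v w"
  using cubature_exists[OF assms, of D] by (auto simp: cubature_complex_def)

definition hgen :: "nat \<Rightarrow> (nat \<Rightarrow> nat \<Rightarrow> complex) \<Rightarrow> complex fps" where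
  "hgen n A = Abs_fps (hcoef n A)"

definition rgen :: "nat \<Rightarrow> (nat \<Rightarrow> nat \<Rightarrow> complex) \<Rightarrow> nat \<Rightarrow> nat \<Rightarrow> complex fps" where
  "rgen n A l k = Abs_fps (rcoef n A l k)"

definition cmat :: "(nat \<Rightarrow> nat \<Rightarrow> complex) \<Rightarrow> nat \<Rightarrow> nat \<Rightarrow> complex fps" where
  "cmat A = (\<lambda>a b. (if a = b then 1 else 0) - fps_const (A a b) * fps_X)"

lemma rgen_right:
  assumes "n \<ge> 1" "l < n" "k < n"
  shows "rgen n A l k = fps_const (kd l k) * hgen n A + (\<Sum>a<n. rgen n A l a * fps_const (A a k)) * fps_X"
proof (rule fps_ext)
  fix m
  obtain K c v w where "cubature_complex n (Suc (Suc m)) (K :: (nat \<Rightarrow> nat \<times> nat) set) c v w"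
    using cubature_complex_exists[OF assms(1)] by blast
  then interpret cubature_complex n "Suc (Suc m)" K c v w A .
  show "fps_nth (rgen n A l k) m = fps_nth (fps_const (kd l k) * hgen n A + (\<Sum>a<n. rgen n A l a * fps_const (A a k)) * fps_X) m"
  proof (cases m)
    case 0
    then show ?thesis using rcoef_0 assms by (simp add: rgen_def hgen_def)
  next
    case (Suc j)
    then show ?thesis using rcoef_Suc_right[of j] assms by (simp add: rgen_def hgen_def fps_sum_nth)
  qed
qed

lemma rgen_cmat:
  assumes "n \<ge> 1" "l < n" "k < n"
  shows "(\<Sum>a<n. rgen n A l a * cmat A a k) = fps_const (kd l k) * hgen n A"
proof -
  have "(\<Sum>a<n. rgen n A l a * cmat A a k)
      = (\<Sum>a<n. if a = k then rgen n A l a else 0) - (\<Sum>a<n. rgen n A l a * fps_const (A a k)) * fps_X"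
    unfolding sum_distrib_right sum_subtractf[symmetric]
    by (rule sum.cong) (auto simp: cmat_def algebra_simps)
  also have "\<dots> = fps_const (kd l k) * hgen n A"
    using assms rgen_right[OF assms, of A] by simp
  finally show ?thesis .
qed

lemma hgen_deriv:
  assumes "n \<ge> 1"
  shows "fps_deriv (hgen n A) = (\<Sum>i<n. \<Sum>j<n. fps_const (A i j) * rgen n A j i)"
proof (rule fps_ext)
  fix m
  obtain K c v w where "cubature_complex n (Suc (Suc m)) (K :: (nat \<Rightarrow> nat \<times> nat) set) c v w"
    using cubature_complex_exists[OF assms(1)] by blast
  then interpret cubature_complex n "Suc (Suc m)" K c v w A .
  show "fps_nth (fps_deriv (hgen n A)) m = fps_nth (\<Sum>i<n. \<Sum>j<n. fps_const (A i j) * rgen n A j i) m"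
    using hcoef_Suc[of m] by (simp add: hgen_def rgen_def fps_sum_nth)
qed

section \<open>Determinants over power series and Jacobi's formula\<close>

lemma detn_upd_row:
  assumes "i < n"
  shows "detn n (B(i := r)) = (\<Sum>\<sigma> | \<sigma> permutes {..<n}. of_int (sign \<sigma>) * (r (\<sigma> i) * (\<Prod>k\<in>{..<n} - {i}. B k (\<sigma> k))))"
  unfolding detn_def
proof (intro sum.cong refl arg_cong2[where f = "(*)"])
  fix \<sigma>
  have "(\<Prod>k<n. (B(i := r)) k (\<sigma> k)) = r (\<sigma> i) * (\<Prod>k\<in>{..<n} - {i}. (B(i := r)) k (\<sigma> k))"
    using assms by (subst prod.remove[of _ i]) auto
  also have "(\<Prod>k\<in>{..<n} - {i}. (B(i := r)) k (\<sigma> k)) = (\<Prod>k\<in>{..<n} - {i}. B k (\<sigma> k))"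
    by (rule prod.cong) auto
  finally show "(\<Prod>k<n. (B(i := r)) k (\<sigma> k)) = r (\<sigma> i) * (\<Prod>k\<in>{..<n} - {i}. B k (\<sigma> k))" .
qed

lemma detn_row_sum:
  assumes "i < n"
  shows "detn n (B(i := \<lambda>b. \<Sum>a\<in>S. f a * r a b)) = (\<Sum>a\<in>S. f a * detn n (B(i := r a)))"
  unfolding detn_upd_row[OF assms] sum_distrib_left sum_distrib_right
  by (subst sum.swap) (simp add: mult_ac)

lemma detn_equal_rows:
  fixes B :: "nat \<Rightarrow> nat \<Rightarrow> complex fps"
  assumes "i < n" "j < n" "i \<noteq> j" "B i = B j"
  shows "detn n B = 0"
proof -
  let ?\<tau> = "Transposition.transpose i j"
  have t: "?\<tau> permutes {..<n}" using assms by (intro permutes_swap_id) auto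
  have "detn n B = (\<Sum>\<sigma> | \<sigma> permutes {..<n}. of_int (sign (\<sigma> \<circ> ?\<tau>)) * (\<Prod>k<n. B k ((\<sigma> \<circ> ?\<tau>) k)))"
    unfolding detn_def by (rule sum_permutations_compose_right[OF t])
  also have "\<dots> = (\<Sum>\<sigma> | \<sigma> permutes {..<n}. - (of_int (sign \<sigma>) * (\<Prod>k<n. B k (\<sigma> k))))"
  proof (intro sum.cong refl)
    fix \<sigma> assume "\<sigma> \<in> {\<sigma>. \<sigma> permutes {..<n}}"
    then have "permutation \<sigma>" using permutation_permutes by blast
    then have "sign (\<sigma> \<circ> ?\<tau>) = - sign \<sigma>"
      using assms by (simp add: sign_compose permutation_swap_id sign_swap_id)
    moreover have "(\<Prod>k<n. B k ((\<sigma> \<circ> ?\<tau>) k)) = (\<Prod>k<n. B k (\<sigma> k))"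
    proof -
      have "(\<Prod>k<n. B k (\<sigma> k)) = (\<Prod>k<n. B (?\<tau> k) (\<sigma> (?\<tau> k)))"
        using prod.permute[OF t, of "\<lambda>k. B k (\<sigma> k)"] by (simp add: o_def)
      also have "\<dots> = (\<Prod>k<n. B k (\<sigma> (?\<tau> k)))"
        by (intro prod.cong refl) (metis assms(4) transpose_apply_first transpose_apply_other transpose_apply_second)
      finally show ?thesis by simp
    qed
    ultimately show "of_int (sign (\<sigma> \<circ> ?\<tau>)) * (\<Prod>k<n. B k ((\<sigma> \<circ> ?\<tau>) k)) = - (of_int (sign \<sigma>) * (\<Prod>k<n. B k (\<sigma> k)))"
      by simp
  qed
  also have "\<dots> = - detn n B" by (simp add: detn_def sum_negf)
  finally have "detn n B + detn n B = 0" by (simp add: eq_neg_iff_add_eq_0)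
  then have "fps_nth (detn n B) k + fps_nth (detn n B) k = 0" for k
    by (metis fps_add_nth fps_zero_nth)
  then show ?thesis by (intro fps_ext) (simp flip: mult_2)
qed

text \<open>The form of multilinearity and alternation that turns a matrix identity H B' = - C B
  into a trace in \<open>hgen_detn\<close>.\<close>

lemma detn_row_combination:
  fixes B :: "nat \<Rightarrow> nat \<Rightarrow> complex fps"
  assumes "i < n"
  shows "detn n (B(i := \<lambda>b. \<Sum>a<n. f a * B a b)) = f i * detn n B"
proof -
  have "detn n (B(i := B a)) = (if a = i then detn n B else 0)" if "a < n" for a
    using that assms detn_equal_rows[of a n i "B(i := B a)"] by auto
  then have "(\<Sum>a<n. f a * detn n (B(i := B a))) = (\<Sum>a<n. if a = i then f a * detn n B else 0)"
    by (intro sum.cong refl) auto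
  then show ?thesis
    unfolding detn_row_sum[OF assms] using assms by simp
qed

lemma detn_row_cong:
  assumes "\<And>b. b < n \<Longrightarrow> r b = s b" "i < n"
  shows "detn n (B(i := r)) = detn n (B(i := s))"
  unfolding detn_upd_row[OF assms(2)]
  by (intro sum.cong refl) (use assms permutes_in_image in fastforce)

lemma fps_deriv_prod:
  fixes F :: "'b \<Rightarrow> complex fps"
  assumes "finite S"
  shows "fps_deriv (\<Prod>i\<in>S. F i) = (\<Sum>i\<in>S. fps_deriv (F i) * (\<Prod>k\<in>S - {i}. F k))"
  using assms
proof (induction S)
  case (insert x S)
  have "(\<Sum>i\<in>S. fps_deriv (F i) * (\<Prod>k\<in>insert x S - {i}. F k)) = F x * (\<Sum>i\<in>S. fps_deriv (F i) * (\<Prod>k\<in>S - {i}. F k))"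
    unfolding sum_distrib_left
  proof (rule sum.cong[OF refl])
    fix i assume i: "i \<in> S"
    then have "insert x S - {i} = insert x (S - {i})" using insert.hyps by auto
    then show "fps_deriv (F i) * (\<Prod>k\<in>insert x S - {i}. F k) = F x * (fps_deriv (F i) * (\<Prod>k\<in>S - {i}. F k))"
      using insert.hyps by simp
  qed
  then show ?case using insert by (simp add: algebra_simps)
qed simp

lemma fps_deriv_detn:
  fixes B :: "nat \<Rightarrow> nat \<Rightarrow> complex fps"
  shows "fps_deriv (detn n B) = (\<Sum>i<n. detn n (B(i := \<lambda>b. fps_deriv (B i b))))"
proof -
  have di: "fps_deriv (of_int k) = (0 :: complex fps)" for k
    by (metis fps_deriv_const fps_of_int)
  have "fps_deriv (detn n B) = (\<Sum>\<sigma> | \<sigma> permutes {..<n}. of_int (sign \<sigma>) *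
      (\<Sum>i<n. fps_deriv (B i (\<sigma> i)) * (\<Prod>k\<in>{..<n} - {i}. B k (\<sigma> k))))"
    unfolding detn_def by (simp add: fps_deriv_sum fps_deriv_prod di)
  also have "\<dots> = (\<Sum>i<n. detn n (B(i := \<lambda>b. fps_deriv (B i b))))"
    unfolding sum_distrib_left by (subst sum.swap) (intro sum.cong refl, simp add: detn_upd_row)
  finally show ?thesis .
qed

text \<open>Let B = 1 - tau A and C = A R. Then H B' = - C B and H' = Tr C. Jacobi's formula gives H
  (det B)' = - Tr(C) det B, so H det B has derivative 0 and equals its constant term 1. Eigenvalues
  of A are avoided in this way.\<close>

lemma hgen_detn:
  assumes n: "n \<ge> 1"
  shows "hgen n A * detn n (cmat A) = 1"
proof -
  let ?B = "cmat A" and ?H = "hgen n A"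
  define C where "C i a = (\<Sum>l<n. fps_const (A i l) * rgen n A l a)" for i a
  have row: "?H * fps_deriv (?B i b) = - (\<Sum>a<n. C i a * ?B a b)" if "b < n" for i b
  proof -
    have "(\<Sum>a<n. C i a * ?B a b) = (\<Sum>l<n. fps_const (A i l) * (\<Sum>a<n. rgen n A l a * ?B a b))"
      unfolding C_def sum_distrib_left sum_distrib_right by (subst sum.swap) (simp add: mult.assoc)
    also have "\<dots> = (\<Sum>l<n. if l = b then fps_const (A i l) * ?H else 0)"
      using that n by (intro sum.cong refl) (auto simp: rgen_cmat kd_def)
    also have "\<dots> = fps_const (A i b) * ?H" using that by simp
    also have "fps_const (A i b) = - fps_deriv (?B i b)" by (simp add: cmat_def)
    finally show ?thesis by (simp add: mult.commute)
  qed
  have "?H * detn n (?B(i := \<lambda>b. fps_deriv (?B i b))) = - C i i * detn n ?B" if i: "i < n" for i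
  proof -
    have "?H * detn n (?B(i := \<lambda>b. fps_deriv (?B i b))) = detn n (?B(i := \<lambda>b. ?H * fps_deriv (?B i b)))"
      using detn_row_sum[OF i, of ?B "\<lambda>_. ?H" "\<lambda>_ b. fps_deriv (?B i b)" "{()}"] by simp
    also have "\<dots> = detn n (?B(i := \<lambda>b. \<Sum>a<n. - C i a * ?B a b))"
      by (rule detn_row_cong[OF _ i]) (simp add: row sum_negf)
    also have "\<dots> = - C i i * detn n ?B" by (rule detn_row_combination[OF i])
    finally show ?thesis .
  qed
  then have "?H * fps_deriv (detn n ?B) = - (\<Sum>i<n. C i i) * detn n ?B"
    unfolding fps_deriv_detn sum_distrib_left by (simp add: sum_negf sum_distrib_right)
  moreover have "(\<Sum>i<n. C i i) = fps_deriv ?H" by (simp add: hgen_deriv[OF n] C_def)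
  ultimately have "fps_deriv (?H * detn n ?B) = 0" by (simp add: fps_deriv_mult)
  then have "?H * detn n ?B = fps_const (fps_nth (?H * detn n ?B) 0)" by (simp only: fps_deriv_eq_0_iff)
  moreover have "fps_nth (detn n ?B) 0 = 1"
  proof -
    have p0: "fps_nth (\<Prod>i\<in>S. F i) 0 = (\<Prod>i\<in>S. fps_nth (F i) 0)" for F :: "nat \<Rightarrow> complex fps" and S
      by (induction S rule: infinite_finite_induct) auto
    have i0: "fps_nth (of_int k :: complex fps) 0 = of_int k" for k
      by (metis fps_nth_fps_const fps_of_int)
    have "fps_nth (detn n ?B) 0 = (\<Sum>\<sigma> | \<sigma> permutes {..<n}. of_int (sign \<sigma>) * (\<Prod>i<n. if i = \<sigma> i then 1 else 0))"
      unfolding detn_def fps_sum_nth fps_mult_nth_0 p0 i0 by (intro sum.cong prod.cong arg_cong2[where f = "(*)"] refl) (simp add: cmat_def)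
    also have "\<dots> = (\<Sum>\<sigma> | \<sigma> permutes {..<n}. if \<sigma> = id then 1 else 0)"
    proof (intro sum.cong refl)
      fix \<sigma> assume s: "\<sigma> \<in> {\<sigma>. \<sigma> permutes {..<n}}"
      show "of_int (sign \<sigma>) * (\<Prod>i<n. if i = \<sigma> i then 1 else 0) = (if \<sigma> = id then 1 else (0::complex))"
      proof (cases "\<sigma> = id")
        case False
        then obtain i where "\<sigma> i \<noteq> i" by (metis ext id_apply)
        moreover then have "i < n" using s by (metis lessThan_iff mem_Collect_eq permutes_not_in)
        ultimately have "(\<Prod>i<n. if i = \<sigma> i then 1 else (0::complex)) = 0"
          by (intro prod_zero) (auto intro!: bexI[of _ i])
        then show ?thesis using False by simp
      qed simp
    qed
    also have "\<dots> = 1" by (simp add: finite_permutations permutes_id)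
    finally show ?thesis .
  qed
  moreover have "fps_nth ?H 0 = 1" using hcoef_0[OF n] by (simp add: hgen_def)
  ultimately show ?thesis by simp
qed

section \<open>Identification of the functions r_j\<close>

lemma matpow_Suc: "matpow n A (Suc s) l k = (\<Sum>a<n. A l a * matpow n A s a k)"
  by (simp add: matpow_def matmul_def)

lemma matpow_Suc_right:
  assumes "l < n" "k < n"
  shows "matpow n A (Suc s) l k = (\<Sum>a<n. matpow n A s l a * A a k)"
  using assms
proof (induction s arbitrary: l)
  case 0
  have "matpow n A (Suc 0) l k = (\<Sum>a<n. A l a * (if a = k then 1 else 0))"
    by (simp only: matpow_def matmul_def funpow.simps o_apply id_apply)
  also have "\<dots> = (\<Sum>a<n. if a = k then A l a else 0)"
    by (intro sum.cong) auto
  also have "\<dots> = (\<Sum>a<n. if l = a then A a k else 0)" using 0 by simp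
  also have "\<dots> = (\<Sum>a<n. matpow n A 0 l a * A a k)"
    by (intro sum.cong) (auto simp: matpow_def)
  finally show ?case .
next
  case (Suc s)
  have "matpow n A (Suc (Suc s)) l k = (\<Sum>a<n. A l a * (\<Sum>b<n. matpow n A s a b * A b k))"
    unfolding matpow_Suc[of n A "Suc s"] using Suc by (intro sum.cong refl) auto
  also have "\<dots> = (\<Sum>b<n. matpow n A (Suc s) l b * A b k)"
    unfolding matpow_Suc sum_distrib_left sum_distrib_right by (subst sum.swap) (simp add: mult.assoc)
  finally show ?case .
qed

text \<open>Both series solve F = H + F A tau as matrices, and this equation determines F
  coefficient by coefficient.\<close>

lemma r_fun_eq_rcoef:
  assumes n: "n \<ge> 1" and l: "l < n" and k: "k < n"
  shows "r_fun n k l j A = rcoef n A l k j"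
proof -
  let ?P = "\<lambda>l k. Abs_fps (\<lambda>s. matpow n A s l k)"
  have "inverse (detn n (cmat A)) = hgen n A"
    using hgen_detn[OF n] by (metis fps_inverse_unique mult.commute)
  then have r: "r_fun n k l j A = fps_nth (?P l k * hgen n A) j" by (simp add: r_fun_def cmat_def)
  have P: "?P l k = fps_const (kd l k) + (\<Sum>a<n. ?P l a * fps_const (A a k)) * fps_X" if "k < n" for k
  proof (rule fps_ext)
    fix m
    show "fps_nth (?P l k) m = fps_nth (fps_const (kd l k) + (\<Sum>a<n. ?P l a * fps_const (A a k)) * fps_X) m"
      using that l by (cases m) (simp_all add: matpow_Suc_right fps_sum_nth, simp add: matpow_def kd_def)
  qed
  have "fps_nth (?P l k * hgen n A) m = fps_nth (rgen n A l k) m" if "k < n" for m k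
    using that
  proof (induction m arbitrary: k)
    case 0
    have "fps_nth (?P l k * hgen n A) 0 = kd l k * hcoef n A 0"
      by (simp add: hgen_def matpow_def kd_def)
    moreover have "fps_nth (rgen n A l k) 0 = kd l k * hcoef n A 0"
      by (subst rgen_right[OF n l 0]) (simp add: hgen_def)
    ultimately show ?case by simp
  next
    case (Suc m)
    have "?P l k * hgen n A = fps_const (kd l k) * hgen n A + (\<Sum>a<n. (?P l a * hgen n A) * fps_const (A a k)) * fps_X"
      by (subst P[OF Suc.prems]) (simp add: algebra_simps sum_distrib_left)
    then have "fps_nth (?P l k * hgen n A) (Suc m) = kd l k * hcoef n A (Suc m) + (\<Sum>a<n. fps_nth (?P l a * hgen n A) m * A a k)"
      by (simp add: hgen_def fps_sum_nth)
    also have "\<dots> = kd l k * hcoef n A (Suc m) + (\<Sum>a<n. fps_nth (rgen n A l a) m * A a k)"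
      using Suc.IH by simp
    also have "\<dots> = fps_nth (rgen n A l k) (Suc m)"
      by (subst rgen_right[OF n l Suc.prems]) (simp add: hgen_def fps_sum_nth)
    finally show ?case .
  qed
  then show ?thesis using r k by (simp add: rgen_def)
qed

section \<open>The free algebra\<close>

text \<open>With concatenation as addition, the convolution product of \<open>gen list \<Rightarrow>\<^sub>0 complex\<close> is that of the free algebra.\<close>

instantiation list :: (type) monoid_add
begin

definition zero_list_def: "0 = []"
definition plus_list_def: "xs + ys = xs @ ys"

instance
  by standard (auto simp: zero_list_def plus_list_def)

end

type_synonym fr = "gen list \<Rightarrow>\<^sub>0 complex"

abbreviation lk :: "fr \<Rightarrow> fa" where "lk \<equiv> Poly_Mapping.lookup"

definition scal :: "complex \<Rightarrow> fr" where "scal c = Poly_Mapping.single [] c"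
definition gn :: "gen \<Rightarrow> fr" where "gn g = Poly_Mapping.single [g] 1"

text \<open>In the convolution sum at u only the prefixes of u contribute, each with a unique
  complement.\<close>

lemma lk_times: "lk (a * b) = fa_mul (lk a) (lk b)"
proof
  fix u :: "gen list"
  let ?T = "(\<lambda>k. take k u) ` {..length u}"
  have inner: "Sum_any (\<lambda>q. lk b q when u = l + q) = (if take (length l) u = l then lk b (drop (length l) u) else 0)" for l
  proof (cases "take (length l) u = l")
    case True
    then have "u = l + q \<longleftrightarrow> q = drop (length l) u" for q
      by (auto simp: plus_list_def) (metis append_take_drop_id)
    then show ?thesis using True by simp
  next
    case False
    then have "u \<noteq> l + q" for q by (auto simp: plus_list_def)
    then show ?thesis using False by simp
  qed
  have "lk (a * b) u = Sum_any (\<lambda>l. lk a l * (if take (length l) u = l then lk b (drop (length l) u) else 0))"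
    by (simp only: Poly_Mapping.lookup_mult inner)
  also have "\<dots> = (\<Sum>l\<in>?T. lk a l * (if take (length l) u = l then lk b (drop (length l) u) else 0))"
  proof (rule Sum_any.expand_superset)
    show "{l. lk a l * (if take (length l) u = l then lk b (drop (length l) u) else 0) \<noteq> 0} \<subseteq> ?T"
    proof safe
      fix l assume "lk a l * (if take (length l) u = l then lk b (drop (length l) u) else 0) \<noteq> 0"
      then have t: "take (length l) u = l" by (auto split: if_splits)
      then have "length l \<le> length u" by (metis length_take min.cobounded1 min.commute)
      then show "l \<in> ?T" using t by force
    qed
  qed simp
  also have "\<dots> = (\<Sum>k\<le>length u. lk a (take k u) * lk b (drop k u))"
  proof (subst sum.reindex)
    show "inj_on (\<lambda>k. take k u) {..length u}"
      by (rule inj_onI) (metis atMost_iff length_take min.absorb2)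
  qed (auto intro!: sum.cong simp: min_absorb2)
  finally show "lk (a * b) u = fa_mul (lk a) (lk b) u" by (simp add: fa_mul_def)
qed

lemma lk_plus: "lk (a + b) = fa_add (lk a) (lk b)"
  by (rule ext) (simp add: fa_add_def lookup_add)

lemma lk_minus: "lk (a - b) = fa_sub (lk a) (lk b)"
  by (rule ext) (simp add: fa_sub_def lookup_minus)

lemma lk_gn: "lk (gn g) = fa_gen g"
  by (rule ext) (auto simp: gn_def fa_gen_def lookup_single when_def)

lemma lk_scal: "lk (scal c) = fa_smul c fa_one"
  by (rule ext) (auto simp: scal_def fa_smul_def fa_one_def lookup_single when_def)

lemma fa_mul_scal_left: "fa_mul (fa_smul c fa_one) p = fa_smul c p"
proof
  fix u
  have "fa_mul (fa_smul c fa_one) p u = (\<Sum>k\<le>length u. if k = 0 then c * p u else 0)"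
    unfolding fa_mul_def by (intro sum.cong refl) (auto simp: fa_smul_def fa_one_def)
  then show "fa_mul (fa_smul c fa_one) p u = fa_smul c p u" by (simp add: fa_smul_def)
qed

lemma fa_mul_scal_right: "fa_mul p (fa_smul c fa_one) = fa_smul c p"
proof
  fix u
  have "fa_mul p (fa_smul c fa_one) u = (\<Sum>k\<le>length u. if k = length u then c * p u else 0)"
    unfolding fa_mul_def by (intro sum.cong refl) (auto simp: fa_smul_def fa_one_def)
  then show "fa_mul p (fa_smul c fa_one) u = fa_smul c p u" by (simp add: fa_smul_def)
qed

lemma lk_scal_times: "lk (scal c * a) = fa_smul c (lk a)"
  by (simp add: lk_times lk_scal fa_mul_scal_left)

lemma fr_eqI: "lk a = lk b \<Longrightarrow> a = b"
  by (rule poly_mapping_eqI) simp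

interpretation fs: scalars scal
proof
  fix a b :: complex and x :: fr
  show "scal (a + b) = scal a + scal b" by (simp add: scal_def single_add)
  show "scal (a * b) = scal a * scal b" by (simp add: scal_def mult_single plus_list_def)
  show "scal 1 = 1" by (simp add: scal_def flip: zero_list_def)
  show "scal a * x = x * scal a"
    by (rule fr_eqI) (simp add: lk_times lk_scal fa_mul_scal_left fa_mul_scal_right)
qed

definition wrd :: "gen list \<Rightarrow> fr" where "wrd u = prod_list (map gn u)"

lemma wrd_single: "wrd u = Poly_Mapping.single u 1"
proof (induction u)
  case Nil
  then show ?case unfolding wrd_def by simp (metis single_one zero_list_def)
next
  case (Cons g u)
  then show ?case by (simp add: wrd_def gn_def mult_single plus_list_def)
qed

lemma fr_expand: "a = (\<Sum>u\<in>Poly_Mapping.keys a. scal (lk a u) * wrd u)"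
proof (rule poly_mapping_eqI)
  fix u
  have "lk (\<Sum>u\<in>Poly_Mapping.keys a. scal (lk a u) * wrd u) u
      = (\<Sum>t\<in>Poly_Mapping.keys a. if t = u then lk a u else 0)"
    unfolding lookup_sum
    by (intro sum.cong refl) (auto simp: wrd_single scal_def mult_single plus_list_def lookup_single when_def)
  then show "lk a u = lk (\<Sum>u\<in>Poly_Mapping.keys a. scal (lk a u) * wrd u) u"
    by (auto simp: in_keys_iff)
qed

text \<open>Every element is a combination of words, so it suffices to absorb scalars and
  letters.\<close>

lemma left_closed:
  assumes "0 \<in> S" "\<And>a b. a \<in> S \<Longrightarrow> b \<in> S \<Longrightarrow> a + b \<in> S" "\<And>c a. a \<in> S \<Longrightarrow> scal c * a \<in> S"
    "\<And>g a. a \<in> S \<Longrightarrow> gn g * a \<in> S" "a \<in> S"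
  shows "x * a \<in> S"
proof -
  have w: "wrd u * a \<in> S" for u
    by (induction u) (auto simp: wrd_def mult.assoc assms)
  have "(\<Sum>u\<in>U. scal (lk x u) * wrd u * a) \<in> S" for U
    by (induction U rule: infinite_finite_induct) (auto simp: mult.assoc assms w)
  then show ?thesis by (subst fr_expand) (simp add: sum_distrib_right)
qed

lemma right_closed:
  assumes "0 \<in> S" "\<And>a b. a \<in> S \<Longrightarrow> b \<in> S \<Longrightarrow> a + b \<in> S" "\<And>c a. a \<in> S \<Longrightarrow> scal c * a \<in> S"
    "\<And>g a. a \<in> S \<Longrightarrow> a * gn g \<in> S" "a \<in> S"
  shows "a * x \<in> S"
proof -
  have w: "b * wrd u \<in> S" if "b \<in> S" for u b
    using that by (induction u arbitrary: b) (auto simp: wrd_def mult.assoc[symmetric] assms)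
  have "(\<Sum>u\<in>U. scal (lk x u) * (a * wrd u)) \<in> S" for U
    by (induction U rule: infinite_finite_induct) (auto simp: assms w)
  then show ?thesis by (subst fr_expand) (simp add: sum_distrib_left fs.sc_left_commute[of a])
qed

section \<open>Restriction to the letters of \<open>gens n\<close> and the two ideals\<close>

definition gens_part :: "nat \<Rightarrow> fa \<Rightarrow> fa" where "gens_part n p = (\<lambda>u. if set u \<subseteq> gens n then p u else 0)"

lemma gens_part_simps:
  "gens_part n (fa_add p q) = fa_add (gens_part n p) (gens_part n q)" "gens_part n (fa_sub p q) = fa_sub (gens_part n p) (gens_part n q)"
  "gens_part n (fa_smul c p) = fa_smul c (gens_part n p)" "gens_part n fa_one = fa_one" "gens_part n (\<lambda>u. 0) = (\<lambda>u. 0)"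
  by (auto simp: gens_part_def fa_add_def fa_sub_def fa_smul_def fa_one_def)

text \<open>A word uses only allowed letters iff both parts of any factorization do, so the
  truncation is an algebra homomorphism.\<close>

lemma gens_part_mul: "gens_part n (fa_mul p q) = fa_mul (gens_part n p) (gens_part n q)"
proof
  fix u :: "gen list"
  have "set (take k u) \<union> set (drop k u) = set u" for k
    by (metis append_take_drop_id set_append)
  then have sp: "set u \<subseteq> gens n \<longleftrightarrow> set (take k u) \<subseteq> gens n \<and> set (drop k u) \<subseteq> gens n" for k
    by (metis Un_subset_iff)
  show "gens_part n (fa_mul p q) u = fa_mul (gens_part n p) (gens_part n q) u"
  proof (cases "set u \<subseteq> gens n")
    case True
    then have "set (take k u) \<subseteq> gens n" "set (drop k u) \<subseteq> gens n" for k using sp by auto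
    then show ?thesis using True by (simp add: gens_part_def fa_mul_def)
  next
    case False
    have "gens_part n p (take k u) * gens_part n q (drop k u) = 0" for k
      using False sp[of k] by (auto simp: gens_part_def)
    then have "fa_mul (gens_part n p) (gens_part n q) u = 0" unfolding fa_mul_def by (intro sum.neutral ballI)
    then show ?thesis using False by (simp add: gens_part_def)
  qed
qed

lemma gens_part_gen: "gens_part n (fa_gen g) = (if g \<in> gens n then fa_gen g else (\<lambda>u. 0))"
  by (auto simp: gens_part_def fa_gen_def)

lemma gens_part_symm: "gens_part n (symm n d P) = symm n d P"
  by (rule ext) (auto simp: gens_part_def symm_def gens_def)

lemma gens_part_sum_smul: "gens_part n (\<lambda>u. \<Sum>j\<in>S. s j * p j u) = (\<lambda>u. \<Sum>j\<in>S. s j * gens_part n (p j) u)"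
  by (rule ext) (simp add: gens_part_def)

lemma gens_simps [simp]: "E i j \<in> gens n \<longleftrightarrow> i < n \<and> j < n" "X i \<in> gens n \<longleftrightarrow> i < n" "Y i \<in> gens n \<longleftrightarrow> i < n"
  by (auto simp: gens_def)

lemma gens_part_hrels: "r \<in> hrels n zeta \<Longrightarrow> gens_part n r = r"
  unfolding hrels_def fa_comm_def
  by (auto simp: gens_part_simps gens_part_mul gens_part_gen gens_part_sum_smul gens_part_symm)

text \<open>Discarding words with a letter outside \<open>gens n\<close> makes both sets closed under multiplication
  by all of \<open>fr\<close>, although \<open>tideal\<close> and \<open>lideal\<close> only absorb letters of \<open>gens n\<close>.\<close>

definition rel_ideal :: "nat \<Rightarrow> complex poly \<Rightarrow> fr set" where
  "rel_ideal n zeta = {a. gens_part n (lk a) \<in> tideal n (hrels n zeta)}"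

definition verma_lideal :: "nat \<Rightarrow> complex poly \<Rightarrow> (nat \<Rightarrow> complex) \<Rightarrow> fr set" where
  "verma_lideal n zeta mu = {a. gens_part n (lk a) \<in> verma_ideal n zeta mu}"

lemma fa_mul_zero: "fa_mul (\<lambda>u. 0) p = (\<lambda>u. 0)" "fa_mul p (\<lambda>u. 0) = (\<lambda>u. 0)"
  by (simp_all add: fa_mul_def)

lemma lk_zero: "lk 0 = (\<lambda>u. 0)"
  by (rule ext) simp

lemma rel_ideal_closed:
  "0 \<in> rel_ideal n zeta" "a \<in> rel_ideal n zeta \<Longrightarrow> b \<in> rel_ideal n zeta \<Longrightarrow> a + b \<in> rel_ideal n zeta"
  "a \<in> rel_ideal n zeta \<Longrightarrow> x * a \<in> rel_ideal n zeta" "a \<in> rel_ideal n zeta \<Longrightarrow> a * x \<in> rel_ideal n zeta"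
proof -
  show z: "0 \<in> rel_ideal n zeta" by (simp add: rel_ideal_def lk_zero gens_part_simps tideal.zero)
  show add: "a + b \<in> rel_ideal n zeta" if "a \<in> rel_ideal n zeta" "b \<in> rel_ideal n zeta" for a b
    using that by (simp add: rel_ideal_def lk_plus gens_part_simps tideal.add)
  have sm: "scal c * a \<in> rel_ideal n zeta" if "a \<in> rel_ideal n zeta" for c a
    using that by (simp add: rel_ideal_def lk_scal_times gens_part_simps tideal.smul)
  show "x * a \<in> rel_ideal n zeta" if "a \<in> rel_ideal n zeta" for x a
    by (rule left_closed[OF z add sm _ that])
      (auto simp: rel_ideal_def lk_times lk_gn gens_part_mul gens_part_gen fa_mul_zero tideal.zero tideal.lmul)
  show "a * x \<in> rel_ideal n zeta" if "a \<in> rel_ideal n zeta" for x a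
    by (rule right_closed[OF z add sm _ that])
      (auto simp: rel_ideal_def lk_times lk_gn gens_part_mul gens_part_gen fa_mul_zero tideal.zero tideal.rmul)
qed

lemma rel_ideal_rel: "lk a \<in> hrels n zeta \<Longrightarrow> a \<in> rel_ideal n zeta"
  by (simp add: rel_ideal_def gens_part_hrels tideal.gen)

lemma verma_lideal_closed:
  "a \<in> verma_lideal n zeta mu \<Longrightarrow> b \<in> verma_lideal n zeta mu \<Longrightarrow> a + b \<in> verma_lideal n zeta mu"
  "a \<in> verma_lideal n zeta mu \<Longrightarrow> x * a \<in> verma_lideal n zeta mu" "rel_ideal n zeta \<subseteq> verma_lideal n zeta mu"
proof -
  have z: "0 \<in> verma_lideal n zeta mu" by (simp add: verma_lideal_def verma_ideal_def lk_zero gens_part_simps lideal.zero)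
  show add: "a + b \<in> verma_lideal n zeta mu" if "a \<in> verma_lideal n zeta mu" "b \<in> verma_lideal n zeta mu" for a b
    using that by (simp add: verma_lideal_def verma_ideal_def lk_plus gens_part_simps lideal.add)
  have sm: "scal c * a \<in> verma_lideal n zeta mu" if "a \<in> verma_lideal n zeta mu" for c a
    using that by (simp add: verma_lideal_def verma_ideal_def lk_scal_times gens_part_simps lideal.smul)
  show "x * a \<in> verma_lideal n zeta mu" if "a \<in> verma_lideal n zeta mu" for x a
    by (rule left_closed[OF z add sm _ that])
      (auto simp: verma_lideal_def verma_ideal_def lk_times lk_gn gens_part_mul gens_part_gen fa_mul_zero lideal.zero lideal.lmul)
  show "rel_ideal n zeta \<subseteq> verma_lideal n zeta mu"
    by (auto simp: verma_lideal_def rel_ideal_def verma_ideal_def intro: lideal.gen)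
qed

lemma verma_lideal_gen:
  assumes "k < n"
  shows "gn (Y k) \<in> verma_lideal n zeta mu" "j < k \<Longrightarrow> gn (E j k) \<in> verma_lideal n zeta mu"
    "gn (E k k) - scal (mu k) \<in> verma_lideal n zeta mu"
  using assms by (auto simp: verma_lideal_def verma_ideal_def lk_gn lk_minus lk_scal gens_part_simps gens_part_gen intro!: lideal.gen)

section \<open>Symmetrization of powers of linear functions\<close>

definition gl_word :: "nat \<Rightarrow> nat \<Rightarrow> gen list \<Rightarrow> bool" where
  "gl_word n m u \<longleftrightarrow> length u = m \<and> (\<forall>g\<in>set u. \<exists>a b. a < n \<and> b < n \<and> g = E b a)"

lemma gl_word_simps [simp]:
  "gl_word n 0 u \<longleftrightarrow> u = []" "\<not> gl_word n (Suc m) []"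
  "gl_word n (Suc m) (h # t) \<longleftrightarrow> (\<exists>a b. a < n \<and> b < n \<and> h = E b a) \<and> gl_word n m t"
  by (auto simp: gl_word_def)

lemma symm_altdef:
  "symm n d P u = (if gl_word n d u then polar d P (map (\<lambda>g. case g of E b a \<Rightarrow> (a, b) | _ \<Rightarrow> (0, 0)) u) else 0)"
  by (simp only: symm_def gl_word_def)

lemma symm_sum: "symm n d (\<lambda>A. \<Sum>p\<in>S. s p * P p A) = (\<lambda>u. \<Sum>p\<in>S. s p * symm n d (P p) u)"
proof
  fix u
  have "polar d (\<lambda>A. \<Sum>p\<in>S. s p * P p A) ps = (\<Sum>p\<in>S. s p * polar d (P p) ps)" for ps
    unfolding polar_def sum_distrib_left by (subst sum.swap) (simp add: mult_ac)
  then show "symm n d (\<lambda>A. \<Sum>p\<in>S. s p * P p A) u = (\<Sum>p\<in>S. s p * symm n d (P p) u)"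
    by (simp add: symm_altdef)
qed

lemma sum_single:
  fixes n :: nat
  assumes "j < n" "\<And>i. i < n \<Longrightarrow> i \<noteq> j \<Longrightarrow> f i = 0"
  shows "(\<Sum>i<n. f i) = f j"
  using assms by (subst sum.remove[of _ j]) auto

lemma fa_mul_gen: "fa_mul (fa_gen g) p u = (case u of [] \<Rightarrow> 0 | h # t \<Rightarrow> if h = g then p t else 0)"
proof (cases u)
  case (Cons h t)
  have "fa_mul (fa_gen g) p u = (\<Sum>k\<le>length u. if k = 1 then (if h = g then p t else 0) else 0)"
    unfolding fa_mul_def
  proof (intro sum.cong refl)
    fix k assume "k \<in> {..length u}"
    then show "fa_gen g (take k u) * p (drop k u) = (if k = 1 then (if h = g then p t else 0) else 0)"
      using Cons by (cases k; cases "k - 1") (auto simp: fa_gen_def take_Cons' split: if_splits)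
  qed
  also have "\<dots> = (if h = g then p t else 0)"
    using Cons by (subst sum.delta) auto
  finally show ?thesis using Cons by simp
qed (simp add: fa_mul_def fa_gen_def)

definition letter :: "(nat \<Rightarrow> complex) \<Rightarrow> (nat \<Rightarrow> complex) \<Rightarrow> gen \<Rightarrow> complex" where
  "letter v w g = (case g of E i j \<Rightarrow> v i * w j | _ \<Rightarrow> 0)"

abbreviation gE :: "nat \<Rightarrow> nat \<Rightarrow> fr" where "gE i j \<equiv> gn (E i j)"

lemma lk_rank1_power:
  "lk (fs.rank1 n gE v w ^ m) u = (if gl_word n m u
     then prod_list (map (letter v w) u) else 0)"
proof (induction m arbitrary: u)
  case 0
  then show ?case by (simp add: lookup_one zero_list_def when_def)
next
  case (Suc m)
  have "lk (fs.rank1 n gE v w ^ Suc m) u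
      = (\<Sum>i<n. \<Sum>j<n. v i * w j * lk (gE i j * fs.rank1 n gE v w ^ m) u)"
    by (simp add: fs.rank1_def sum_distrib_right lookup_sum mult.assoc)
       (simp add: fs.rank1_def[symmetric] lk_scal_times fa_smul_def mult.assoc)
  also have "\<dots> = (\<Sum>i<n. \<Sum>j<n. v i * w j * (case u of [] \<Rightarrow> 0 | h # t \<Rightarrow> if h = E i j then lk (fs.rank1 n gE v w ^ m) t else 0))"
    by (simp add: lk_times lk_gn fa_mul_gen)
  also have "\<dots> = (if gl_word n (Suc m) u
     then prod_list (map (letter v w) u) else 0)"
  proof (cases u)
    case (Cons h t)
    show ?thesis
    proof (cases "\<exists>i j. i < n \<and> j < n \<and> h = E i j")
      case True
      then obtain i j where h: "i < n" "j < n" "h = E i j" by blast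
      have "(\<Sum>i'<n. \<Sum>j'<n. v i' * w j' * (case u of [] \<Rightarrow> 0 | h # t \<Rightarrow> if h = E i' j' then lk (fs.rank1 n gE v w ^ m) t else 0))
        = (\<Sum>j'<n. v i * w j' * (case u of [] \<Rightarrow> 0 | h # t \<Rightarrow> if h = E i j' then lk (fs.rank1 n gE v w ^ m) t else 0))"
        by (rule sum_single[OF h(1)]) (simp add: Cons h)
      also have "\<dots> = v i * w j * (case u of [] \<Rightarrow> 0 | h # t \<Rightarrow> if h = E i j then lk (fs.rank1 n gE v w ^ m) t else 0)"
        by (rule sum_single[OF h(2)]) (simp add: Cons h)
      also have "\<dots> = v i * w j * lk (fs.rank1 n gE v w ^ m) t" by (simp add: Cons h)
      finally show ?thesis using h by (auto simp: Suc.IH Cons letter_def)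
    next
      case False
      then have "(\<Sum>i'<n. \<Sum>j'<n. v i' * w j' * (case u of [] \<Rightarrow> 0 | h # t \<Rightarrow> if h = E i' j' then lk (fs.rank1 n gE v w ^ m) t else 0)) = 0"
        by (intro sum.neutral ballI) (auto simp: Cons)
      then show ?thesis using False by (auto simp: Cons)
    qed
  qed simp
  finally show ?case .
qed

text \<open>Under the trace form the linear function w . A v is the element sum v_i w_j e_ij, and
  the polar form of a power is the product of the values of the linear function. The equality holds
  in the free algebra, before any relation is imposed.\<close>

lemma symm_power:
  "symm n m (\<lambda>A. (\<Sum>i<n. \<Sum>j<n. w i * A i j * v j) ^ m) = lk (fs.rank1 n gE v w ^ m)"
proof
  fix u
  show "symm n m (\<lambda>A. (\<Sum>i<n. \<Sum>j<n. w i * A i j * v j) ^ m) u = lk (fs.rank1 n gE v w ^ m) u"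
  proof (cases "gl_word n m u")
    case gl: True
    then have True: "length u = m" "\<forall>g\<in>set u. \<exists>a b. a < n \<and> b < n \<and> g = E b a"
      by (auto simp: gl_word_def)
    let ?f = "\<lambda>g. case g of E b a \<Rightarrow> (a, b) | _ \<Rightarrow> (0, 0)"
    let ?ps = "map ?f u"
    have ps: "fst (?ps ! t) < n \<and> snd (?ps ! t) < n \<and> w (fst (?ps ! t)) * v (snd (?ps ! t)) = letter v w (u ! t)"
      if t: "t < m" for t
    proof -
      have "u ! t \<in> set u" using t True by simp
      then obtain a b where "a < n" "b < n" "u ! t = E b a" using True by blast
      then show ?thesis using t True by (simp add: letter_def)
    qed
    have unit: "(\<Sum>i<n. \<Sum>j<n. w i * matunit a b i j * v j) = w a * v b" if "a < n" "b < n" for a b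
    proof -
      have "(\<Sum>i<n. \<Sum>j<n. w i * matunit a b i j * v j) = (\<Sum>j<n. w a * matunit a b a j * v j)"
        by (rule sum_single[OF that(1)]) (simp add: matunit_def)
      also have "\<dots> = w a * matunit a b a b * v b"
        by (rule sum_single[OF that(2)]) (simp add: matunit_def)
      finally show ?thesis by (simp add: matunit_def)
    qed
    \<comment> \<open>By linearity the value at a sum of matrix units is a sum of letters, which
      brings \<open>polar\<close> into the shape of \<open>polarization_power\<close>.\<close>
    have lin: "(\<Sum>i<n. \<Sum>j<n. w i * (\<Sum>t\<in>S. matunit (fst (?ps ! t)) (snd (?ps ! t)) i j) * v j)
        = (\<Sum>t\<in>S. letter v w (u ! t))" if "S \<in> Pow {..<m}" for S
    proof -
      have "(\<Sum>i<n. \<Sum>j<n. w i * (\<Sum>t\<in>S. matunit (fst (?ps ! t)) (snd (?ps ! t)) i j) * v j)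
          = (\<Sum>t\<in>S. \<Sum>i<n. \<Sum>j<n. w i * matunit (fst (?ps ! t)) (snd (?ps ! t)) i j * v j)"
        unfolding sum_distrib_left sum_distrib_right
        by (subst sum.swap, rule sum.cong[OF refl], subst sum.swap) (rule refl)
      also have "\<dots> = (\<Sum>t\<in>S. letter v w (u ! t))"
        by (rule sum.cong[OF refl]) (use that ps unit in auto)
      finally show ?thesis .
    qed
    have "polar m (\<lambda>A. (\<Sum>i<n. \<Sum>j<n. w i * A i j * v j) ^ m) ?ps
        = 1 / fact m * (\<Sum>S\<in>Pow {..<m}. (-1) ^ (m - card S) * (\<Sum>t\<in>S. letter v w (u ! t)) ^ m)"
      unfolding polar_def by (rule arg_cong[where f = "(*) (1 / fact m)"], rule sum.cong[OF refl], subst lin, assumption, rule refl)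
    also have "\<dots> = (\<Prod>t<m. letter v w (u ! t))"
      unfolding polarization_power by simp
    also have "\<dots> = prod_list (map (letter v w) u)"
      using True by (simp add: prod.list_conv_set_nth lessThan_atLeast0)
    finally show ?thesis using gl by (simp add: symm_altdef lk_rank1_power)
  qed (simp add: symm_altdef lk_rank1_power)
qed

section \<open>Action on Verma modules\<close>

lemma fact_mult_pochhammer: "fact m * pochhammer (of_nat (Suc m)) k = (fact (m + k) :: complex)"
  using pochhammer_product'[of "1::complex" m k] by (simp add: pochhammer_fact)

lemma two_sided_rel_ideal: "two_sided scal (rel_ideal n zeta)"
  by unfold_locales (fact rel_ideal_closed)+

lemma gl_rel_rel_ideal: "gl_rel scal (rel_ideal n zeta) n gE"
proof -
  interpret two_sided scal "rel_ideal n zeta" by (rule two_sided_rel_ideal)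
  write cg (infix "\<approx>" 50)
  show ?thesis
  proof
    fix i j k l assume "i < n" "j < n" "k < n" "l < n"
    then have "lk (gE i j * gE k l - gE k l * gE i j - (scal (kd j k) * gE i l - scal (kd l i) * gE k j)) \<in> hrels n zeta"
      unfolding lk_minus lk_scal_times unfolding lk_times lk_gn fa_comm_def[symmetric] hrels_def by blast
    then show "gE i j * gE k l - gE k l * gE i j \<approx> scal (kd j k) * gE i l - scal (kd l i) * gE k j"
      unfolding cg_def by (rule rel_ideal_rel)
  qed
qed

text \<open>The relations contain powers up to the degree of zeta with one extra pair v_l w_k, the
  highest weight computation powers up to the degree of f with two extra pairs; one cubature has to
  serve both.\<close>

locale hecke_cubature = cubature n D K c v w
  for n D and K :: "'p set" and c v w +
  fixes zeta f :: "complex poly"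
  assumes deg: "degree f + degree zeta + 2 \<le> D"
    and f0: "poly f 0 = 0"
    and f_zeta: "\<forall>z. poly f z - poly f (z - 1) = poly ((pderiv ^^ n) (monom 1 n * zeta)) z"
begin

sublocale gl_cubature scal "rel_ideal n zeta" n gE D K c v w
  by (intro gl_cubature.intro gl_rel_rel_ideal) unfold_locales

notation cg (infix "\<approx>" 50)

lemma lk_avg: "lk (avg F) u = (\<Sum>p\<in>K. c p * lk (F p) u)"
  by (simp add: avg_def lookup_sum lk_scal_times fa_smul_def)

lemma symm_trSym:
  assumes "m \<le> D"
  shows "symm n m (trSym n m) u = pochhammer (of_nat n) m / fact m * lk (avg_fun (monom 1 m)) u"
proof -
  let ?s = "pochhammer (of_nat n) m / fact m :: complex"
  have "trSym n m A = (\<Sum>p\<in>K. (?s * c p) * (\<Sum>i<n. \<Sum>j<n. w p i * A i j * v p j) ^ m)" for A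
  proof -
    interpret cc: cubature_complex n D K c v w A ..
    show ?thesis
      unfolding trSym_eq_hcoef[OF n_pos] cc.hcoef_avg[OF assms] cc.M.avg_def cc.lf_def
      by (simp add: sum_distrib_left mult.assoc)
  qed
  then have "trSym n m = (\<lambda>A. \<Sum>p\<in>K. (?s * c p) * (\<Sum>i<n. \<Sum>j<n. w p i * A i j * v p j) ^ m)"
    by (rule ext)
  then have "symm n m (trSym n m) u = (\<Sum>p\<in>K. (?s * c p) * lk (EE p ^ m) u)"
    by (simp only: symm_sum symm_power)
  then show ?thesis
    by (simp add: avg_fun_monom lk_avg sum_distrib_left mult.assoc)
qed

lemma symm_r_fun:
  assumes "m + 1 \<le> D" "l < n" "k < n"
  shows "symm n m (r_fun n k l m) u = pochhammer (of_nat n) (Suc m) / fact m * lk (avg_mat l k (monom 1 m)) u"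
proof -
  let ?s = "pochhammer (of_nat n) (Suc m) / fact m :: complex"
  have "r_fun n k l m A = (\<Sum>p\<in>K. (?s * (c p * (v p l * w p k))) * (\<Sum>i<n. \<Sum>j<n. w p i * A i j * v p j) ^ m)" for A
  proof -
    interpret cc: cubature_complex n D K c v w A ..
    show ?thesis
      unfolding r_fun_eq_rcoef[OF n_pos assms(2,3)] cc.rcoef_avg[OF assms] cc.M.avg_def cc.lf_def
      by (simp add: sum_distrib_left mult.assoc)
  qed
  then have "r_fun n k l m = (\<lambda>A. \<Sum>p\<in>K. (?s * (c p * (v p l * w p k))) * (\<Sum>i<n. \<Sum>j<n. w p i * A i j * v p j) ^ m)"
    by (rule ext)
  then have "symm n m (r_fun n k l m) u = (\<Sum>p\<in>K. (?s * (c p * (v p l * w p k))) * lk (EE p ^ m) u)"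
    by (simp only: symm_sum symm_power)
  then show ?thesis
    by (simp add: avg_mat_monom lk_avg lk_scal_times fa_smul_def sum_distrib_left mult.assoc)
qed

text \<open>The numbers (n + j)! / j! from the n-th derivative of z^(n+j) are (n-1)! times the
  normalization of r_j in \<open>rcoef\<close>; this is the origin of the factor 1 / (n-1)! in
  \<open>YX\<close>.\<close>

lemma nabla_f: "f - pcompose f [:- 1, 1:] = (\<Sum>j\<le>degree zeta. smult (coeff zeta j * (fact (n + j) / fact j)) (monom 1 j))"
proof (rule poly_eqI)
  fix j
  have "poly (f - pcompose f [:- 1, 1:]) = poly ((pderiv ^^ n) (monom 1 n * zeta))"
    using f_zeta by (intro ext) (simp add: poly_pcompose)
  then have "f - pcompose f [:- 1, 1:] = (pderiv ^^ n) (monom 1 n * zeta)"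
    by (simp only: poly_eq_poly_eq_iff)
  moreover have "pochhammer (of_nat (Suc j)) n = (fact (n + j) / fact j :: complex)"
    using fact_mult_pochhammer[of j n] by (simp add: field_simps del: of_nat_Suc)
  ultimately have "coeff (f - pcompose f [:- 1, 1:]) j = coeff zeta j * (fact (n + j) / fact j)"
    by (simp only: coeff_higher_pderiv coeff_monom_mult) simp
  also have "\<dots> = (\<Sum>i\<le>degree zeta. if i = j then coeff zeta i * (fact (n + i) / fact i) else 0)"
    by (auto simp: coeff_eq_0)
  also have "\<dots> = coeff (\<Sum>i\<le>degree zeta. smult (coeff zeta i * (fact (n + i) / fact i)) (monom 1 i)) j"
    unfolding coeff_sum by (intro sum.cong refl) auto
  finally show "coeff (f - pcompose f [:- 1, 1:]) j
      = coeff (\<Sum>j\<le>degree zeta. smult (coeff zeta j * (fact (n + j) / fact j)) (monom 1 j)) j" .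
qed

lemma pochhammer_n: "pochhammer (of_nat n :: complex) k = fact (n - 1 + k) / fact (n - 1)"
  using fact_mult_pochhammer[of "n - 1" k] n_pos by (simp add: field_simps del: of_nat_Suc)

lemma symm_r_fun_sum:
  assumes "l < n" "k < n"
  shows "(\<lambda>u. \<Sum>j\<le>degree zeta. coeff zeta j * symm n j (r_fun n k l j) u)
     = lk (scal (1 / fact (n - 1)) * avg_mat l k (f - pcompose f [:- 1, 1:]))"
proof
  fix u
  have avg_mat_sum: "avg_mat l k (\<Sum>j\<in>S. smult (s j) (monom 1 j)) = (\<Sum>j\<in>S. scal (s j) * avg_mat l k (monom 1 j))"
    if "finite S" for S :: "nat set" and s
    using that
  proof (induction S)
    case empty
    show ?case by (simp add: avg_mat_def avg_def)
  qed (simp add: avg_mat_add avg_mat_smult)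
  have "lk (scal (1 / fact (n - 1)) * avg_mat l k (f - pcompose f [:- 1, 1:])) u
      = (\<Sum>j\<le>degree zeta. 1 / fact (n - 1) * (coeff zeta j * (fact (n + j) / fact j)) * lk (avg_mat l k (monom 1 j)) u)"
    unfolding nabla_f avg_mat_sum[OF finite_atMost] lk_scal_times
    by (simp add: fa_smul_def lookup_sum lk_scal_times sum_distrib_left mult.assoc)
  also have "\<dots> = (\<Sum>j\<le>degree zeta. coeff zeta j * symm n j (r_fun n k l j) u)"
  proof (rule sum.cong[OF refl])
    fix j assume "j \<in> {..degree zeta}"
    then have "j + 1 \<le> D" using deg by simp
    moreover have "pochhammer (of_nat n :: complex) (Suc j) = fact (n + j) / fact (n - 1)"
      using pochhammer_n[of "Suc j"] n_pos by (metis add_Suc_right add_Suc Suc_diff_1 less_eq_Suc_le One_nat_def)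
    ultimately show "1 / fact (n - 1) * (coeff zeta j * (fact (n + j) / fact j)) * lk (avg_mat l k (monom 1 j)) u
      = coeff zeta j * symm n j (r_fun n k l j) u"
      by (simp add: symm_r_fun assms)
  qed
  finally show "(\<Sum>j\<le>degree zeta. coeff zeta j * symm n j (r_fun n k l j) u)
     = lk (scal (1 / fact (n - 1)) * avg_mat l k (f - pcompose f [:- 1, 1:])) u" ..
qed

sublocale casimir_rel scal "rel_ideal n zeta" n gE D K c v w "\<lambda>i. gn (X i)" "\<lambda>i. gn (Y i)" f
proof unfold_locales
  fix i j k l
  show "gn (X i) * gn (X j) \<approx> gn (X j) * gn (X i)" if "i < n" "j < n"
  proof -
    have "lk (gn (X i) * gn (X j) - gn (X j) * gn (X i)) \<in> hrels n zeta"
      unfolding lk_minus lk_plus lk_scal_times unfolding lk_times lk_gn fa_comm_def[symmetric] hrels_def using that by blast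
    then show ?thesis unfolding cg_def by (rule rel_ideal_rel)
  qed
  show "gn (Y i) * gn (Y j) \<approx> gn (Y j) * gn (Y i)" if "i < n" "j < n"
  proof -
    have "lk (gn (Y i) * gn (Y j) - gn (Y j) * gn (Y i)) \<in> hrels n zeta"
      unfolding lk_minus lk_plus lk_scal_times unfolding lk_times lk_gn fa_comm_def[symmetric] hrels_def using that by blast
    then show ?thesis unfolding cg_def by (rule rel_ideal_rel)
  qed
  show "gE i j * gn (X k) \<approx> gn (X k) * gE i j - scal (kd i k) * gn (X j)" if "i < n" "j < n" "k < n"
  proof -
    have "lk (gE i j * gn (X k) - gn (X k) * gE i j + scal (kd i k) * gn (X j)) \<in> hrels n zeta"
      unfolding lk_minus lk_plus lk_scal_times unfolding lk_times lk_gn fa_comm_def[symmetric] hrels_def using that by blast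
    then show ?thesis unfolding cg_def diff_diff_eq2 add_diff_eq diff_add_eq by (auto dest: rel_ideal_rel)
  qed
  show "gE i j * gn (Y k) \<approx> gn (Y k) * gE i j + scal (kd j k) * gn (Y i)" if "i < n" "j < n" "k < n"
  proof -
    have "lk (gE i j * gn (Y k) - gn (Y k) * gE i j - scal (kd j k) * gn (Y i)) \<in> hrels n zeta"
      unfolding lk_minus lk_plus lk_scal_times unfolding lk_times lk_gn fa_comm_def[symmetric] hrels_def using that by blast
    then show ?thesis unfolding cg_def diff_diff_eq[symmetric] by (rule rel_ideal_rel)
  qed
  show "gn (Y k) * gn (X l) \<approx> gn (X l) * gn (Y k)
      + scal (1 / fact (n - 1)) * avg_mat l k (f - pcompose f [:- 1, 1:])" if "k < n" "l < n"
  proof -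
    have "lk (gn (Y k) * gn (X l) - gn (X l) * gn (Y k)
        - scal (1 / fact (n - 1)) * avg_mat l k (f - pcompose f [:- 1, 1:])) \<in> hrels n zeta"
      unfolding lk_minus symm_r_fun_sum[OF that(2,1), symmetric] unfolding lk_times lk_gn fa_comm_def[symmetric] hrels_def
      using that by blast
    then show ?thesis unfolding cg_def diff_diff_eq[symmetric] by (rule rel_ideal_rel)
  qed
qed (use deg in simp)

text \<open>The normalization (n)_m / m! of Tr S^m, divided by the denominator (m + 1) ... (m + n -
  1) of g_m, is 1 / (n-1)! for every m. The term m = 0 is absent because f(0) = 0.\<close>

lemma lk_cas: "lk cas = casimir n f"
proof
  fix u
  have "coeff f 0 = 0" using f0 by (simp add: poly_0_coeff_0)
  have "avg_fun f = avg_fun (\<Sum>m\<le>degree f. smult (coeff f m) (monom 1 m))"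
    by (simp add: smult_monom poly_as_sum_of_monoms)
  also have "\<dots> = (\<Sum>m\<le>degree f. scal (coeff f m) * avg_fun (monom 1 m))"
  proof -
    have "avg_fun (\<Sum>m\<in>S. smult (coeff f m) (monom 1 m)) = (\<Sum>m\<in>S. scal (coeff f m) * avg_fun (monom 1 m))"
      if "finite S" for S :: "nat set"
      using that
    proof (induction S)
      case empty
      show ?case by (simp add: avg_fun_def avg_def)
    qed (simp add: avg_fun_add avg_fun_smult)
    then show ?thesis by simp
  qed
  finally have "lk (avg_fun f) u = (\<Sum>m\<le>degree f. coeff f m * lk (avg_fun (monom 1 m)) u)"
    by (simp add: lookup_sum lk_scal_times fa_smul_def)
  also have "\<dots> = (\<Sum>m\<in>{1..degree f}. coeff f m * lk (avg_fun (monom 1 m)) u)"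
    using \<open>coeff f 0 = 0\<close> by (intro sum.mono_neutral_right) (auto simp: not_less_eq_eq)
  finally have "1 / fact (n - 1) * lk (avg_fun f) u
      = (\<Sum>m\<in>{1..degree f}. 1 / fact (n - 1) * (coeff f m * lk (avg_fun (monom 1 m)) u))"
    by (simp add: sum_distrib_left)
  also have "\<dots> = (\<Sum>m\<in>{1..degree f}.
      (coeff f m / pochhammer (of_nat (m + 1) :: complex) (n - 1)) * symm n m (trSym n m) u)"
  proof (rule sum.cong[OF refl])
    fix m assume "m \<in> {1..degree f}"
    then have m: "m \<le> D" using deg by simp
    have "pochhammer (of_nat (m + 1) :: complex) (n - 1) = fact (n - 1 + m) / fact m"
      using fact_mult_pochhammer[of m "n - 1"] by (simp add: field_simps add.commute)
    then show "1 / fact (n - 1) * (coeff f m * lk (avg_fun (monom 1 m)) u)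
      = (coeff f m / pochhammer (of_nat (m + 1) :: complex) (n - 1)) * symm n m (trSym n m) u"
      by (simp add: symm_trSym[OF m] pochhammer_n)
  qed
  finally show "lk cas u = casimir n f u"
    by (simp add: cas_def casimir_def fa_add_def lk_plus lookup_sum lk_scal_times fa_smul_def)
       (simp add: lk_times lk_gn)
qed

text \<open>Centrality is known for the letters in \<open>gens n\<close>, hence it holds for words
  in them and for their combinations.\<close>

lemma cas_commute:
  assumes "lk a \<in> FA n"
  shows "cas * a \<approx> a * cas"
proof -
  have gen: "cas * gn g \<approx> gn g * cas" if "g \<in> gens n" for g
    using that cas_commute_x cas_commute_y cas_commute_M
    by (auto simp: gens_def intro: cg_sym)
  have word: "cas * wrd u \<approx> wrd u * cas" if "set u \<subseteq> gens n" for u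
    using that
  proof (induction u)
    case (Cons g u)
    have "cas * wrd (g # u) = (cas * gn g) * wrd u" by (simp add: wrd_def mult.assoc)
    also have "\<dots> \<approx> (gn g * cas) * wrd u" using Cons by (intro cg_right gen) simp
    also have "\<dots> = gn g * (cas * wrd u)" by (simp add: mult.assoc)
    also have "\<dots> \<approx> gn g * (wrd u * cas)" using Cons by (intro cg_left) simp
    also have "\<dots> = wrd (g # u) * cas" by (simp add: wrd_def mult.assoc)
    finally show ?case .
  qed (simp add: wrd_def)
  have "cas * (\<Sum>u\<in>Poly_Mapping.keys a. scal (lk a u) * wrd u)
      = (\<Sum>u\<in>Poly_Mapping.keys a. scal (lk a u) * (cas * wrd u))"
    by (simp add: sum_distrib_left fs.sc_left_commute[of cas])
  also have "\<dots> \<approx> (\<Sum>u\<in>Poly_Mapping.keys a. scal (lk a u) * (wrd u * cas))"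
    using assms by (intro cg_sum cg_left word) (auto simp: FA_def in_keys_iff)
  also have "\<dots> = (\<Sum>u\<in>Poly_Mapping.keys a. scal (lk a u) * wrd u) * cas"
    by (simp add: sum_distrib_right mult.assoc)
  finally show ?thesis unfolding fr_expand[of a, symmetric] .
qed

lemma cas_highest_weight:
  fixes lam :: "nat \<Rightarrow> complex"
  assumes W: "(sinh_op ^^ (n - 1)) (monom 1 (n - 1) * W) = f"
  defines "mu \<equiv> \<lambda>i. lam i - rho n i"
  shows "cas - scal (\<Sum>p\<le>degree W. coeff W p * complete_hom n p lam) \<in> verma_lideal n zeta mu"
proof -
  interpret highest_weight scal "rel_ideal n zeta" n gE D K c v w "verma_lideal n zeta mu" mu
  proof unfold_locales
    show "rel_ideal n zeta \<subseteq> verma_lideal n zeta mu" by (rule verma_lideal_closed)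
  qed (auto intro: verma_lideal_closed verma_lideal_gen)
  write lc (infix "\<sim>" 50)
  let ?G = "monom 1 (n - 1) * W" and ?s = "- of_nat (n - 1) / 2 :: complex"
  have "(fdiff ^^ (n - 1)) (pcompose ?G [:?s, 1:]) = f"
    using W by (simp only: fdiff_iter_pcompose_shift sinh_op_iter_conv)
  then have T: "avg_fun f \<sim> scal (fact (n - 1) * ddiff (image_mset kap (mset_set {..<n})) (pcompose ?G [:?s, 1:]))"
    using deg by (intro avg_fun_highest_weight) auto
  have "image_mset kap (mset_set {..<n}) \<noteq> {#}" using n_pos by (simp add: mset_set_empty_iff lessThan_empty_iff)
  then have "ddiff (image_mset kap (mset_set {..<n})) (pcompose ?G [:?s, 1:])
      = ddiff (image_mset (\<lambda>x. x + ?s) (image_mset kap (mset_set {..<n}))) ?G"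
    by (rule ddiff_shift[symmetric])
  \<comment> \<open>The shift by rho, the offset in \<open>kap\<close> and the half steps of the
    sinh operator cancel: kap j - (n-1)/2 = lam j.\<close>
  also have "image_mset (\<lambda>x. x + ?s) (image_mset kap (mset_set {..<n})) = image_mset lam (mset_set {..<n})"
    unfolding image_mset.compositionality by (rule image_mset_cong) (simp add: kap_def, simp add: mu_def rho_def field_simps)
  also have "ddiff (image_mset lam (mset_set {..<n})) ?G = (\<Sum>p\<le>degree W. coeff W p * complete_hom n p lam)"
    by (rule ddiff_complete_hom[OF n_pos])
  finally have T': "avg_fun f \<sim> scal (fact (n - 1) * (\<Sum>p\<le>degree W. coeff W p * complete_hom n p lam))"
    using T by simp
  have "cas \<sim> (\<Sum>j<n. gn (X j) * 0) + scal (1 / fact (n - 1)) * scal (fact (n - 1) * (\<Sum>p\<le>degree W. coeff W p * complete_hom n p lam))"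
    unfolding cas_def
  \<comment> \<open>Only the average contributes, since y_j kills the highest weight vector.\<close>
  proof (intro lc_add lc_sum lc_left T')
    fix j assume "j \<in> {..<n}"
    then show "gn (Y j) \<sim> 0" using verma_lideal_gen(1)[of j n zeta mu] by (simp add: lc_def)
  qed
  also have "\<dots> = scal (\<Sum>p\<le>degree W. coeff W p * complete_hom n p lam)"
    by (simp flip: fs.sc_mult)
  finally show ?thesis by (simp only: lc_def)
qed

lemma gens_part_casimir: "gens_part n (casimir n f) = casimir n f"
proof -
  have "gens_part n (\<lambda>u. \<Sum>j<n. fa_mul (fa_gen (X j)) (fa_gen (Y j)) u) = (\<lambda>u. \<Sum>j<n. fa_mul (fa_gen (X j)) (fa_gen (Y j)) u)"
    using gens_part_sum_smul[of n "\<lambda>_. 1" "\<lambda>j. fa_mul (fa_gen (X j)) (fa_gen (Y j))" "{..<n}"]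
    by (simp add: gens_part_mul gens_part_gen)
  then show ?thesis
    unfolding casimir_def gens_part_simps gens_part_sum_smul gens_part_symm by simp
qed

text \<open>The highest weight vector generates the Verma module, so centrality carries the scalar
  from this vector to the class of every a.\<close>

lemma casimir_action:
  fixes lam :: "nat \<Rightarrow> complex"
  assumes W: "(sinh_op ^^ (n - 1)) (monom 1 (n - 1) * W) = f" and a: "a \<in> FA n"
  defines "s \<equiv> \<Sum>p\<le>degree W. coeff W p * complete_hom n p lam"
  shows "fa_sub (fa_mul (casimir n f) a) (fa_smul s a) \<in> verma_ideal n zeta (\<lambda>i. lam i - rho n i)"
proof -
  let ?I = "verma_lideal n zeta (\<lambda>i. lam i - rho n i)"
  define b where "b = Abs_poly_mapping a"
  have lkb: "lk b = a" using a by (simp add: b_def FA_def)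
  have "cas * b - b * cas \<in> ?I"
    using cas_commute[of b] a verma_lideal_closed(3) by (auto simp: lkb cg_def)
  moreover have "b * (cas - scal s) \<in> ?I"
    unfolding s_def by (intro verma_lideal_closed(2) cas_highest_weight W)
  ultimately have "(cas * b - b * cas) + b * (cas - scal s) \<in> ?I" by (rule verma_lideal_closed(1))
  also have "(cas * b - b * cas) + b * (cas - scal s) = cas * b - scal s * b"
    by (simp add: right_diff_distrib fs.sc_commute)
  finally have "gens_part n (fa_sub (fa_mul (casimir n f) a) (fa_smul s a)) \<in> verma_ideal n zeta (\<lambda>i. lam i - rho n i)"
    unfolding verma_lideal_def mem_Collect_eq lk_minus lk_scal_times unfolding lk_times lk_cas lkb .
  moreover have "gens_part n a = a" using a by (auto simp: gens_part_def FA_def fun_eq_iff)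
  ultimately show ?thesis by (simp add: gens_part_simps gens_part_mul gens_part_casimir)
qed

end

text \<open>The vectors of the Verma module are the classes of elements of \<open>FA n\<close>
  modulo \<open>verma_ideal\<close>, with left multiplication as the action; acting by a scalar is
  therefore a statement about membership in that left ideal.\<close>

theorem theorem3p4:
  fixes n :: nat and zeta f :: "complex poly"
  assumes "n \<ge> 1"
    and "poly f 0 = 0"
    and "\<forall>z. poly f z - poly f (z - 1) = poly ((pderiv ^^ n) (monom 1 n * zeta)) z"
  shows "(\<exists>!w. (sinh_op ^^ (n - 1)) (monom 1 (n - 1) * w) = f) \<and>
    (\<forall>w. (sinh_op ^^ (n - 1)) (monom 1 (n - 1) * w) = f \<longrightarrow>
      (\<forall>lam :: nat \<Rightarrow> complex. \<forall>a \<in> FA n.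
         fa_sub (fa_mul (casimir n f) a)
                (fa_smul (\<Sum>p\<le>degree w. coeff w p * complete_hom n p lam) a)
         \<in> verma_ideal n zeta (\<lambda>i. lam i - rho n i)))"
proof -
  obtain K c v w where cub: "cubature n (degree f + degree zeta + 2) (K :: (nat \<Rightarrow> nat \<times> nat) set) c v w"
    using cubature_exists[OF assms(1)] by blast
  interpret hecke_cubature n "degree f + degree zeta + 2" K c v w zeta f
    using cub assms by (intro hecke_cubature.intro hecke_cubature_axioms.intro) auto
  show ?thesis
    using ex1_sinh_op casimir_action by blast
qed

end
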